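(* Let $0<R_1<R_2$, let $\Omega:=\{x\in\mathbb{R}^3: R_1<|x|<R_2\}$, and let $\Gamma_i:=\{x\in\mathbb{R}^3:|x|=R_i\}$, $i=1,2$. Let $v_*\in W^{1/2,2}(\partial\Omega)$ be a vector field with values in $\mathbb{R}^3$ such that $$\Phi:=\int_{\Gamma_2}v_*\cdot n=-\int_{\Gamma_1}v_*\cdot n,$$ where $n$ is the unit outer normal to $\partial\Omega$. If $\Phi>0$, then the Leray--Hopf Extension Condition does not hold for $v_*$.
   Context: Leray--Hopf Extension Condition for $v_*$: for every $\varepsilon>0$ there exists a solenoidal (i.e. divergence-free) vector field $V_\varepsilon\in W^{1,2}(\Omega)$ with values in $\mathbb{R}^3$, which is an extension of $v_*$ (i.e. $V_\varepsilon=v_*$ on $\partial\Omega$ in the trace sense), such that $$-(u\cdot\nabla V_\varepsilon,u)\le \varepsilon\,\|\nabla u\|_2^2$$ for all solenoidal vector fields $u\in W^{1,2}_0(\Omega)$ with values in $\mathbb{R}^3$. Notation: $(a,b)=\int_\Omega a_ib_i$ (summation over repeated indices), so that $(u\cdot\nabla V,u)=\int_\Omega u_j\,(\partial_jV_i)\,u_i$; $\|\cdot\|_2$ is the $L^2(\Omega)$-norm. $W^{1,2}(\Omega)$, $W^{1,2}_0(\Omega)$ and $W^{1/2,2}(\partial\Omega)$ are the usual Sobolev and trace spaces. *)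

theory Defs
  imports "HOL-Analysis.Analysis"
begin

section \<open>Smooth functions and test functions\<close>

definition partial :: "'n \<Rightarrow> (real^'n \<Rightarrow> real) \<Rightarrow> real^'n \<Rightarrow> real" where
  "partial j f x = frechet_derivative f (at x) (axis j 1)"

primrec C_k :: "nat \<Rightarrow> (real^'n \<Rightarrow> real) \<Rightarrow> bool" where
  "C_k 0 f \<longleftrightarrow> continuous_on UNIV f"
| "C_k (Suc k) f \<longleftrightarrow> (\<forall>x. f differentiable (at x)) \<and> (\<forall>j. C_k k (partial j f))"

definition smooth :: "(real^'n \<Rightarrow> real) \<Rightarrow> bool" where
  "smooth f \<longleftrightarrow> (\<forall>k. C_k k f)"

definition test_functions :: "(real^'n) set \<Rightarrow> (real^'n \<Rightarrow> real) set" where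
  "test_functions \<Omega> =
     {\<phi>. smooth \<phi> \<and> compact (closure {x. \<phi> x \<noteq> 0}) \<and> closure {x. \<phi> x \<noteq> 0} \<subseteq> \<Omega>}"


section \<open>Sobolev spaces\<close>

text \<open>
  Functions on a set are represented by total functions, of which only the values almost
  everywhere on that set matter; elements of the spaces below are representatives, not
  equivalence classes.
\<close>

definition L2 :: "'a measure \<Rightarrow> ('a \<Rightarrow> 'b::real_normed_vector) set" where
  "L2 M = {f \<in> borel_measurable M. integrable M (\<lambda>x. (norm (f x))\<^sup>2)}"

definition L2_norm :: "'a measure \<Rightarrow> ('a \<Rightarrow> 'b::real_normed_vector) \<Rightarrow> real" where
  "L2_norm M f = sqrt (\<integral>x. (norm (f x))\<^sup>2 \<partial>M)"

definition has_weak_partial ::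
  "(real^'n) set \<Rightarrow> 'n \<Rightarrow> (real^'n \<Rightarrow> real) \<Rightarrow> (real^'n \<Rightarrow> real) \<Rightarrow> bool" where
  "has_weak_partial \<Omega> j f g \<longleftrightarrow>
     (\<forall>\<phi>\<in>test_functions \<Omega>.
        (\<integral>x. f x * partial j \<phi> x \<partial>lebesgue_on \<Omega>) = - (\<integral>x. g x * \<phi> x \<partial>lebesgue_on \<Omega>))"

definition W12 :: "(real^'n) set \<Rightarrow> (real^'n \<Rightarrow> real) set" where
  "W12 \<Omega> = {f \<in> L2 (lebesgue_on \<Omega>). \<forall>j. \<exists>g\<in>L2 (lebesgue_on \<Omega>). has_weak_partial \<Omega> j f g}"

text \<open>For \<open>f \<in> W12 \<Omega>\<close> with \<open>\<Omega>\<close> open, the chosen function is unique up to null sets.\<close>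

definition weak_partial :: "(real^'n) set \<Rightarrow> 'n \<Rightarrow> (real^'n \<Rightarrow> real) \<Rightarrow> real^'n \<Rightarrow> real" where
  "weak_partial \<Omega> j f = (SOME g. g \<in> L2 (lebesgue_on \<Omega>) \<and> has_weak_partial \<Omega> j f g)"

definition W12_norm :: "(real^'n) set \<Rightarrow> (real^'n \<Rightarrow> real) \<Rightarrow> real" where
  "W12_norm \<Omega> f =
     sqrt ((L2_norm (lebesgue_on \<Omega>) f)\<^sup>2
           + (\<Sum>j\<in>UNIV. (L2_norm (lebesgue_on \<Omega>) (weak_partial \<Omega> j f))\<^sup>2))"

definition W12_0 :: "(real^'n) set \<Rightarrow> (real^'n \<Rightarrow> real) set" where
  "W12_0 \<Omega> =
     {f \<in> W12 \<Omega>. \<exists>\<phi>::nat \<Rightarrow> real^'n \<Rightarrow> real. (\<forall>n. \<phi> n \<in> test_functions \<Omega>) \<and>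
        (\<lambda>n. W12_norm \<Omega> (\<lambda>x. f x - \<phi> n x)) \<longlonglongrightarrow> 0}"

text \<open>
  The trace operator is the continuous extension to \<open>W12 \<Omega>\<close> of the restriction
  of smooth functions to the boundary. Here \<open>\<Omega>\<close> is meant to be a bounded Lipschitz domain and
  \<open>\<sigma>\<close> its surface measure, so that functions smooth on the whole space are dense in \<open>W12 \<Omega>\<close>.
\<close>

definition has_trace ::
  "(real^'n) set \<Rightarrow> (real^'n) measure \<Rightarrow> (real^'n \<Rightarrow> real) \<Rightarrow> (real^'n \<Rightarrow> real) \<Rightarrow> bool" where
  "has_trace \<Omega> \<sigma> f g \<longleftrightarrow> f \<in> W12 \<Omega> \<and> g \<in> L2 \<sigma> \<and>
     (\<exists>\<phi>::nat \<Rightarrow> real^'n \<Rightarrow> real. (\<forall>n. smooth (\<phi> n) \<and> \<phi> n \<in> W12 \<Omega> \<and> \<phi> n \<in> L2 \<sigma>) \<and>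
        (\<lambda>n. W12_norm \<Omega> (\<lambda>x. f x - \<phi> n x)) \<longlonglongrightarrow> 0 \<and>
        (\<lambda>n. L2_norm \<sigma> (\<lambda>x. g x - \<phi> n x)) \<longlonglongrightarrow> 0)"

text \<open>
  Sobolev--Slobodeckij space of order 1/2 on a surface in \<open>\<real>\<^sup>3\<close>: the exponent of the
  distance is the dimension 2 of the surface plus twice the order. On the diagonal the quotient
  is 0 by the convention on division by 0.
\<close>

definition W_half2 :: "(real^3) measure \<Rightarrow> (real^3 \<Rightarrow> real^3) set" where
  "W_half2 \<sigma> =
     {v \<in> L2 \<sigma>. integrable (\<sigma> \<Otimes>\<^sub>M \<sigma>) (\<lambda>(x, y). (norm (v x - v y))\<^sup>2 / (dist x y) ^ 3)}"


section \<open>The Leray--Hopf Extension Condition\<close>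

definition W12_field :: "(real^3) set \<Rightarrow> (real^3 \<Rightarrow> real^3) set" where
  "W12_field \<Omega> = {V. \<forall>i. (\<lambda>x. V x $ i) \<in> W12 \<Omega>}"

definition W12_0_field :: "(real^3) set \<Rightarrow> (real^3 \<Rightarrow> real^3) set" where
  "W12_0_field \<Omega> = {u. \<forall>i. (\<lambda>x. u x $ i) \<in> W12_0 \<Omega>}"

definition solenoidal :: "(real^3) set \<Rightarrow> (real^3 \<Rightarrow> real^3) \<Rightarrow> bool" where
  "solenoidal \<Omega> V \<longleftrightarrow>
     (AE x in lebesgue_on \<Omega>. (\<Sum>i\<in>UNIV. weak_partial \<Omega> i (\<lambda>y. V y $ i) x) = 0)"

definition grad_norm2 :: "(real^3) set \<Rightarrow> (real^3 \<Rightarrow> real^3) \<Rightarrow> real" where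
  "grad_norm2 \<Omega> u =
     sqrt (\<Sum>i\<in>UNIV. \<Sum>j\<in>UNIV. (L2_norm (lebesgue_on \<Omega>) (weak_partial \<Omega> j (\<lambda>y. u y $ i)))\<^sup>2)"

text \<open>
  \<open>convective_form \<Omega> u V\<close> is \<open>(u \<cdot> \<nabla>V, u)\<close>. For a bounded domain in \<open>\<real>\<^sup>3\<close>,
  \<open>V \<in> W12_field \<Omega>\<close> and \<open>u \<in> W12_0_field \<Omega>\<close> the integrand is integrable, since \<open>u\<close> belongs
  to the fourth Lebesgue space by the Sobolev embedding.
\<close>

definition convective_form :: "(real^3) set \<Rightarrow> (real^3 \<Rightarrow> real^3) \<Rightarrow> (real^3 \<Rightarrow> real^3) \<Rightarrow> real" where
  "convective_form \<Omega> u V =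
     (\<integral>x. (\<Sum>i\<in>UNIV. \<Sum>j\<in>UNIV. u x $ j * weak_partial \<Omega> j (\<lambda>y. V y $ i) x * u x $ i)
        \<partial>lebesgue_on \<Omega>)"

definition leray_hopf_extension_condition ::
  "(real^3) set \<Rightarrow> (real^3) measure \<Rightarrow> (real^3 \<Rightarrow> real^3) \<Rightarrow> bool" where
  "leray_hopf_extension_condition \<Omega> \<sigma> v \<longleftrightarrow>
     (\<forall>\<epsilon>>0. \<exists>V\<in>W12_field \<Omega>. solenoidal \<Omega> V \<and>
        (\<forall>i. has_trace \<Omega> \<sigma> (\<lambda>x. V x $ i) (\<lambda>x. v x $ i)) \<and>
        (\<forall>u\<in>W12_0_field \<Omega>. solenoidal \<Omega> u \<longrightarrow>
           - convective_form \<Omega> u V \<le> \<epsilon> * (grad_norm2 \<Omega> u)\<^sup>2))"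


section \<open>The spherical shell\<close>

definition shell :: "real \<Rightarrow> real \<Rightarrow> (real^3) set" where
  "shell R1 R2 = {x. R1 < norm x \<and> norm x < R2}"

text \<open>
  Surface measure on the sphere of radius \<open>R\<close> about 0, as a Borel measure on the whole space:
  the area of \<open>A\<close> is \<open>3 / R\<close> times the volume of the cone \<open>{t x | x \<in> A, 0 < t \<le> 1}\<close>, this
  being the measure that occurs in integration in polar coordinates. The total mass is
  \<open>(3 / R) * (4/3) \<pi> R\<^sup>3 = 4 \<pi> R\<^sup>2\<close>.
\<close>

definition sphere_measure :: "real \<Rightarrow> (real^3) measure" where
  "sphere_measure R =
     scale_measure (ennreal (3 / R))
       (distr (restrict_space lborel (cball 0 R - {0})) borel (\<lambda>x. (R / norm x) *\<^sub>R x))"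

text \<open>Surface measure on the boundary of the shell.\<close>

definition shell_boundary_measure :: "real \<Rightarrow> real \<Rightarrow> (real^3) measure" where
  "shell_boundary_measure R1 R2 =
     measure_of UNIV (sets borel)
       (\<lambda>A. emeasure (sphere_measure R1) A + emeasure (sphere_measure R2) A)"

lemma sets_sphere_measure [simp, measurable_cong]: "sets (sphere_measure R) = sets borel"
  by (simp add: sphere_measure_def)

lemma sets_shell_boundary_measure [simp, measurable_cong]:
  "sets (shell_boundary_measure R1 R2) = sets borel"
  unfolding shell_boundary_measure_def
  by (metis sets.sets_measure_of_eq space_borel)

lemma emeasure_shell_boundary_measure:
  assumes "A \<in> sets borel"
  shows "emeasure (shell_boundary_measure R1 R2) A =
           emeasure (sphere_measure R1) A + emeasure (sphere_measure R2) A"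
proof (rule emeasure_measure_of[OF shell_boundary_measure_def])
  show "countably_additive (sets (shell_boundary_measure R1 R2))
          (\<lambda>A. emeasure (sphere_measure R1) A + emeasure (sphere_measure R2) A)"
    by (auto simp: countably_additive_def suminf_add[symmetric] suminf_emeasure
        simp flip: suminf_add)
qed (use assms in \<open>auto simp: positive_def\<close>)

definition outer_normal :: "real \<Rightarrow> real \<Rightarrow> real^3 \<Rightarrow> real^3" where
  "outer_normal R1 R2 x = (if norm x = R2 then x /\<^sub>R R2 else - (x /\<^sub>R R1))"

end

theory Submission imports Defs begin

text \<open>
  Suppose that the condition holds and let \<open>V\<close> be an extension for a given \<open>\<epsilon>\<close>. Nothing is known about
  \<open>V\<close> apart from its trace, its vanishing divergence and hence its flux \<open>\<Phi>\<close> through the concentric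
  spheres. So the proof looks for finitely many solenoidal test fields \<open>u\<close>, independent of \<open>V\<close>, for
  which \<open>\<Sum> (u \<cdot> \<nabla>V, u)\<close> can be computed from \<open>\<Phi>\<close> alone. This is the case when the tensor
  \<open>\<Sum> u \<otimes> u\<close> is isotropic, say \<open>B Id - 2 T\<close> with a scalar function \<open>B\<close> and \<open>T = A(|x|\<^sup>2) x \<otimes> x\<close>: the part \<open>B Id\<close>
  pairs with \<open>\<nabla>V\<close> to \<open>B div V = 0\<close>, and after an integration by parts the other part gives
  \<open>2 \<integral> V \<cdot> div T\<close>, where \<open>div T\<close> is the gradient of a radial function \<open>H(|x|\<^sup>2)\<close> with \<open>H\<close>
  zero near the inner sphere. The result is \<open>2 H(R2\<^sup>2) \<Phi>\<close> (\<open>flux_radial\<close>).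

  Isotropy with finitely many fields comes from an algebraic identity:
  the monomials \<open>x\<^bsub>i1\<^esub> \<cdots> x\<^bsub>im\<^esub>\<close>, with \<open>(i1, \<dots>, im)\<close> running through all words of length \<open>m\<close>, satisfy
  \<open>\<Sum> P(x) P(y) = (x \<cdot> y)\<^sup>m\<close>, which is invariant under rotations. With \<open>g = h(|x|\<^sup>2) P(x)\<close> the fields are
  \<open>\<partial>\<^sub>q g e\<^sub>p - \<partial>\<^sub>p g e\<^sub>q\<close>. For a single \<open>g\<close> the sum of their tensor squares over \<open>p\<close> and \<open>q\<close> is
  \<open>2 (|\<nabla>g|\<^sup>2 Id - \<nabla>g \<otimes> \<nabla>g)\<close>, and the sum of \<open>\<nabla>g \<otimes> \<nabla>g\<close> over the monomials is isotropic
  (\<open>sum_convective_form_skew_gradient\<close>, \<open>sum_partial_radial_monomial\<close>).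

  It remains to get the sign right. For \<open>m = 2n\<close> and \<open>h(s) = \<chi>(s) / s\<^sup>n\<close> one finds
  \<open>A = 4 \<chi>'\<^sup>2 - 2n \<chi>\<^sup>2 / s\<^sup>2\<close> and \<open>H(R2\<^sup>2) = \<integral> A\<close>, which is negative for large \<open>n\<close>, when \<open>\<chi>\<close> is a fixed bump
  (\<open>ex_radial_profile\<close>). Large \<open>n\<close> means rapid tangential oscillation of \<open>g\<close>, which makes the radial
  component of the fields dominate; this is what a positive flux needs.
  So \<open>-\<Sum> (u \<cdot> \<nabla>V, u) = - 2 H(R2\<^sup>2) \<Phi>\<close> is a positive number that does not depend on \<open>\<epsilon>\<close>, while the
  condition bounds it by \<open>\<epsilon>\<close> times a constant.

  Two analytic facts support this. Weak derivatives are unique up to null sets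
  (\<open>orthogonal_to_test_functions_imp_AE_0\<close>), so the chosen weak derivatives of test functions are the
  classical ones. And the divergence theorem holds in a ball for the surface measure defined by cones
  (\<open>divergence_ball\<close>); it is applied to the smooth functions that define the trace.
\<close>

section \<open>Calculus of smooth functions\<close>

lemma has_derivative_imp_partial:
  assumes "(f has_derivative f') (at x)"
  shows "partial j f x = f' (axis j 1)"
  unfolding partial_def using frechet_derivative_at[OF assms] by simp

lemma partial_add:
  assumes "f differentiable (at x)" "g differentiable (at x)"
  shows "partial j (\<lambda>x. f x + g x) x = partial j f x + partial j g x"
  using has_derivative_imp_partial[OF has_derivative_add[OF assms[unfolded frechet_derivative_works]]]
  by (simp add: partial_def)

lemma partial_diff:
  assumes "f differentiable (at x)" "g differentiable (at x)"
  shows "partial j (\<lambda>x. f x - g x) x = partial j f x - partial j g x"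
  using has_derivative_imp_partial[OF has_derivative_diff[OF assms[unfolded frechet_derivative_works]]]
  by (simp add: partial_def)

lemma partial_mult:
  assumes "f differentiable (at x)" "g differentiable (at x)"
  shows "partial j (\<lambda>x. f x * g x) x = partial j f x * g x + f x * partial j g x"
  using has_derivative_imp_partial[OF has_derivative_mult[OF assms[unfolded frechet_derivative_works]]]
  by (simp add: partial_def algebra_simps)

lemma partial_const [simp]: "partial j (\<lambda>x. c) = (\<lambda>x. 0)"
  by (rule ext, rule has_derivative_imp_partial[OF has_derivative_const])

lemma partial_component: "partial j (\<lambda>x::real^'n. x $ i) = (\<lambda>x. if i = j then 1 else 0)"
proof
  fix x :: "real^'n"
  have "((\<lambda>x. x $ i) has_derivative (\<lambda>x. x $ i)) (at x)"
    by (intro bounded_linear_imp_has_derivative bounded_linear_vec_nth)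
  from has_derivative_imp_partial[OF this] show "partial j (\<lambda>x. x $ i) x = (if i = j then 1 else 0)"
    by (simp add: axis_def)
qed

lemma partial_compose:
  assumes "f differentiable (at x)" "(h has_real_derivative h') (at (f x))"
  shows "partial j (\<lambda>x. h (f x)) x = h' * partial j f x"
proof -
  have "((\<lambda>x. h (f x)) has_derivative (\<lambda>v. h' * frechet_derivative f (at x) v)) (at x)"
    using has_derivative_compose[OF assms(1)[unfolded frechet_derivative_works]
        assms(2)[unfolded has_field_derivative_def]] by simp
  from has_derivative_imp_partial[OF this] show ?thesis by (simp add: partial_def)
qed

lemma partial_norm_sq: "partial j (\<lambda>x::real^'n. (norm x)\<^sup>2) = (\<lambda>x. 2 * x $ j)"
proof
  fix x :: "real^'n"
  have "((\<lambda>x. x \<bullet> x) has_derivative (\<lambda>v. x \<bullet> v + v \<bullet> x)) (at x)"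
    by (intro has_derivative_inner has_derivative_ident)
  from has_derivative_imp_partial[OF this] show "partial j (\<lambda>x. (norm x)\<^sup>2) x = 2 * x $ j"
    by (simp add: power2_norm_eq_inner inner_axis inner_commute)
qed

lemma norm_sq_differentiable [simp]: "(\<lambda>x::real^'n. (norm x)\<^sup>2) differentiable (at x)"
proof -
  have "((\<lambda>x. x \<bullet> x) has_derivative (\<lambda>v. x \<bullet> v + v \<bullet> x)) (at x)"
    by (intro has_derivative_inner has_derivative_ident)
  thus ?thesis unfolding power2_norm_eq_inner differentiable_def by blast
qed

lemma component_differentiable [simp]: "(\<lambda>x::real^'n. x $ i) differentiable (at x)"
  by (intro bounded_linear_imp_differentiable bounded_linear_vec_nth)

lemma compose_differentiable:
  fixes f :: "real^'n \<Rightarrow> real"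
  assumes "f differentiable (at x)" "(h has_real_derivative h') (at (f x))"
  shows "(\<lambda>x. h (f x)) differentiable (at x)"
  using differentiable_compose[of h f x UNIV] assms
  by (meson differentiable_def has_derivative_compose has_field_derivative_def)

lemma frechet_derivative_eq_sum_partial:
  fixes f :: "real^'n \<Rightarrow> real"
  assumes "f differentiable (at x)"
  shows "frechet_derivative f (at x) v = (\<Sum>j\<in>UNIV. v $ j * partial j f x)"
proof -
  have lin: "linear (frechet_derivative f (at x))"
    using assms linear_frechet_derivative by blast
  have "frechet_derivative f (at x) (\<Sum>j\<in>UNIV. v $ j *\<^sub>R axis j 1) = (\<Sum>j\<in>UNIV. v $ j * partial j f x)"
    by (simp add: linear_sum[OF lin] linear_scale[OF lin] partial_def)
  thus ?thesis using basis_expansion[of v] by (simp add: scalar_mult_eq_scaleR)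
qed

lemma C_k_continuous: "C_k k f \<Longrightarrow> continuous_on UNIV f"
  by (cases k) (auto intro: differentiable_imp_continuous_on simp: differentiable_on_def)

lemma C_k_Suc_imp: "C_k (Suc k) f \<Longrightarrow> C_k k f"
proof (induction k arbitrary: f)
  case 0 thus ?case using C_k_continuous by fastforce
next
  case (Suc k) thus ?case by (metis C_k.simps(2))
qed

lemma C_k_SucI:
  assumes "\<And>x. f differentiable (at x)" "\<And>j. partial j f = f' j" "\<And>j. C_k k (f' j)"
  shows "C_k (Suc k) f"
  using assms by simp

lemma C_k_const: "C_k k (\<lambda>x. c)"
  by (induction k arbitrary: c) auto

lemma C_k_add: "C_k k f \<Longrightarrow> C_k k g \<Longrightarrow> C_k k (\<lambda>x. f x + g x)"
proof (induction k arbitrary: f g)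
  case 0 thus ?case by (auto intro: continuous_on_add)
next
  case (Suc k)
  have "partial j (\<lambda>x. f x + g x) = (\<lambda>x. partial j f x + partial j g x)" for j
    using Suc.prems by (auto simp: partial_add)
  thus ?case using Suc by auto
qed

lemma C_k_mult: "C_k k f \<Longrightarrow> C_k k g \<Longrightarrow> C_k k (\<lambda>x. f x * g x)"
proof (induction k arbitrary: f g)
  case 0 thus ?case by (auto intro: continuous_on_mult)
next
  case (Suc k)
  have "partial j (\<lambda>x. f x * g x) = (\<lambda>x. partial j f x * g x + f x * partial j g x)" for j
    using Suc.prems by (auto simp: partial_mult)
  moreover have "C_k k f" "C_k k g" using Suc.prems C_k_Suc_imp by blast+
  ultimately show ?case using Suc by (auto intro!: C_k_add)
qed

lemma smooth_const [simp]: "smooth (\<lambda>x. c)"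
  by (simp add: smooth_def C_k_const)

lemma smooth_add: "smooth f \<Longrightarrow> smooth g \<Longrightarrow> smooth (\<lambda>x. f x + g x)"
  by (simp add: smooth_def C_k_add)

lemma smooth_mult: "smooth f \<Longrightarrow> smooth g \<Longrightarrow> smooth (\<lambda>x. f x * g x)"
  by (simp add: smooth_def C_k_mult)

lemma smooth_diff: "smooth f \<Longrightarrow> smooth g \<Longrightarrow> smooth (\<lambda>x. f x - g x)"
  using smooth_add[of f "\<lambda>x. (-1) * g x"] smooth_mult[of "\<lambda>x. -1" g] by simp

lemma smooth_prod: "finite A \<Longrightarrow> (\<And>a. a \<in> A \<Longrightarrow> smooth (f a)) \<Longrightarrow> smooth (\<lambda>x. \<Prod>a\<in>A. f a x)"
  by (induction A rule: finite_induct) (auto intro: smooth_mult)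

lemma smooth_differentiable: "smooth f \<Longrightarrow> f differentiable (at x)"
  unfolding smooth_def by (metis C_k.simps(2))

lemma smooth_partial: "smooth f \<Longrightarrow> smooth (partial j f)"
  unfolding smooth_def by (metis C_k.simps(2))

lemma smooth_continuous: "smooth f \<Longrightarrow> continuous_on A f"
  unfolding smooth_def by (metis C_k.simps(1) continuous_on_subset subset_UNIV)

lemma smoothI:
  assumes "\<And>x. f differentiable (at x)" "\<And>j. smooth (partial j f)"
  shows "smooth f"
  unfolding smooth_def
proof
  fix k show "C_k k f"
    using C_k_Suc_imp[of k f] assms by (simp add: smooth_def)
qed

lemma smooth_component: "smooth (\<lambda>x. x $ i)"
  by (rule smoothI) (auto simp: partial_component)

lemma smooth_norm_sq: "smooth (\<lambda>x. (norm x)\<^sup>2)"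
  by (rule smoothI) (auto simp: partial_norm_sq intro!: smooth_mult smooth_component)


section \<open>Smooth functions of one variable\<close>

text \<open>
  The counterpart of \<open>C_k\<close> on the line, for the profiles of radial functions.
\<close>

primrec C_k_real :: "nat \<Rightarrow> (real \<Rightarrow> real) \<Rightarrow> bool" where
  "C_k_real 0 f \<longleftrightarrow> continuous_on UNIV f"
| "C_k_real (Suc k) f \<longleftrightarrow> (\<exists>f'. (\<forall>x. (f has_real_derivative f' x) (at x)) \<and> C_k_real k f')"

definition smooth_real :: "(real \<Rightarrow> real) \<Rightarrow> bool" where
  "smooth_real f \<longleftrightarrow> (\<forall>k. C_k_real k f)"

lemma C_k_real_continuous: "C_k_real k f \<Longrightarrow> continuous_on UNIV f"
  by (cases k) (auto simp: continuous_on_eq_continuous_at dest!: spec DERIV_isCont)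

lemma C_k_real_Suc_imp: "C_k_real (Suc k) f \<Longrightarrow> C_k_real k f"
proof (induction k arbitrary: f)
  case 0 thus ?case using C_k_real_continuous by fastforce
next
  case (Suc k) thus ?case by (metis C_k_real.simps(2))
qed

lemma C_k_real_const: "C_k_real k (\<lambda>x. c)"
  by (induction k arbitrary: c) (auto intro!: exI[of _ "\<lambda>x. 0"])

lemma C_k_real_add: "C_k_real k f \<Longrightarrow> C_k_real k g \<Longrightarrow> C_k_real k (\<lambda>x. f x + g x)"
proof (induction k arbitrary: f g)
  case 0 thus ?case by (auto intro: continuous_on_add)
next
  case (Suc k)
  then obtain f' g' where "\<forall>x. (f has_real_derivative f' x) (at x)" "C_k_real k f'"
    "\<forall>x. (g has_real_derivative g' x) (at x)" "C_k_real k g'" by auto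
  with Suc.IH[of f' g'] show ?case by (auto intro!: exI[of _ "\<lambda>x. f' x + g' x"] DERIV_add)
qed

lemma C_k_real_mult: "C_k_real k f \<Longrightarrow> C_k_real k g \<Longrightarrow> C_k_real k (\<lambda>x. f x * g x)"
proof (induction k arbitrary: f g)
  case 0 thus ?case by (auto intro: continuous_on_mult)
next
  case (Suc k)
  then obtain f' g' where *: "\<forall>x. (f has_real_derivative f' x) (at x)" "C_k_real k f'"
    "\<forall>x. (g has_real_derivative g' x) (at x)" "C_k_real k g'" by auto
  have "C_k_real k f" "C_k_real k g" using Suc.prems C_k_real_Suc_imp by blast+
  with * Suc.IH[of f' g] Suc.IH[of g' f] have "C_k_real k (\<lambda>x. f' x * g x + g' x * f x)"
    by (intro C_k_real_add) auto
  with * show ?case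
    by (auto intro!: exI[of _ "\<lambda>x. f' x * g x + g' x * f x"] DERIV_mult)
qed

lemma C_k_real_affine: "C_k_real k f \<Longrightarrow> C_k_real k (\<lambda>x. f (c + d * x))"
proof (induction k arbitrary: f)
  case 0 thus ?case by (auto intro!: continuous_on_compose2[of UNIV f] continuous_intros)
next
  case (Suc k)
  then obtain f' where *: "\<And>x. (f has_real_derivative f' x) (at x)" "C_k_real k f'" by auto
  have "((\<lambda>x. f (c + d * x)) has_real_derivative f' (c + d * x) * d) (at x)" for x
    by (rule DERIV_chain2[OF *(1)]) (auto intro!: derivative_eq_intros)
  moreover have "C_k_real k (\<lambda>x. f' (c + d * x) * d)"
    using Suc.IH[OF *(2)] by (intro C_k_real_mult C_k_real_const)
  ultimately show ?case
    unfolding C_k_real.simps by (intro exI[of _ "\<lambda>x. f' (c + d * x) * d"]) blast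
qed

lemma smooth_real_const: "smooth_real (\<lambda>x. c)"
  by (simp add: smooth_real_def C_k_real_const)

lemma smooth_real_add: "smooth_real f \<Longrightarrow> smooth_real g \<Longrightarrow> smooth_real (\<lambda>x. f x + g x)"
  by (simp add: smooth_real_def C_k_real_add)

lemma smooth_real_mult: "smooth_real f \<Longrightarrow> smooth_real g \<Longrightarrow> smooth_real (\<lambda>x. f x * g x)"
  by (simp add: smooth_real_def C_k_real_mult)

lemma smooth_real_affine: "smooth_real f \<Longrightarrow> smooth_real (\<lambda>x. f (c + d * x))"
  by (simp add: smooth_real_def C_k_real_affine)

lemma smooth_realI:
  assumes "\<And>x. (f has_real_derivative f' x) (at x)" "smooth_real f'"
  shows "smooth_real f"
  unfolding smooth_real_def
proof
  fix k show "C_k_real k f"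
    using C_k_real_Suc_imp[of k f] assms by (auto simp: smooth_real_def)
qed

lemma smooth_real_ident: "smooth_real (\<lambda>x. x)"
  by (rule smooth_realI[where f' = "\<lambda>x. 1"]) (auto simp: smooth_real_const)

lemma smooth_real_continuous: "smooth_real f \<Longrightarrow> continuous_on A f"
  unfolding smooth_real_def by (metis C_k_real.simps(1) continuous_on_subset subset_UNIV)

lemma smooth_real_has_deriv: "smooth_real f \<Longrightarrow> (f has_real_derivative deriv f x) (at x)"
  unfolding smooth_real_def by (metis C_k_real.simps(2) DERIV_deriv_iff_has_field_derivative)

lemma smooth_real_deriv:
  assumes "smooth_real f" shows "smooth_real (deriv f)"
  unfolding smooth_real_def
proof
  fix k
  obtain f' where f': "\<And>x. (f has_real_derivative f' x) (at x)" "C_k_real k f'"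
    using assms unfolding smooth_real_def by (metis C_k_real.simps(2))
  from f'(1) have "deriv f = f'" by (auto intro!: ext DERIV_imp_deriv)
  with f' show "C_k_real k (deriv f)" by simp
qed

text \<open>
  By induction on \<open>k\<close> with \<open>h\<close> arbitrary: the chain rule replaces \<open>h\<close> by \<open>h'\<close> and leaves the inner
  function unchanged.
\<close>

lemma C_k_compose_real: "C_k_real k h \<Longrightarrow> smooth f \<Longrightarrow> C_k k (\<lambda>x. h (f x))"
proof (induction k arbitrary: h)
  case 0 thus ?case
    using continuous_on_compose2[of UNIV h UNIV f] smooth_continuous[of f UNIV] by simp
next
  case (Suc k)
  then obtain h' where *: "\<And>x. (h has_real_derivative h' x) (at x)" "C_k_real k h'" by auto
  show ?case
  proof (rule C_k_SucI)
    show "(\<lambda>x. h (f x)) differentiable (at x)" for x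
      using compose_differentiable[OF smooth_differentiable[OF Suc.prems(2)] *(1)] .
    show "partial j (\<lambda>x. h (f x)) = (\<lambda>x. h' (f x) * partial j f x)" for j
      using partial_compose[OF smooth_differentiable[OF Suc.prems(2)] *(1)] by auto
    show "C_k k (\<lambda>x. h' (f x) * partial j f x)" for j
      using Suc.IH[OF *(2) Suc.prems(2)] smooth_partial[OF Suc.prems(2), of j]
      by (intro C_k_mult) (auto simp: smooth_def)
  qed
qed

lemma smooth_compose_real: "smooth_real h \<Longrightarrow> smooth f \<Longrightarrow> smooth (\<lambda>x. h (f x))"
  using C_k_compose_real[of _ h f] by (auto simp: smooth_def[of "\<lambda>x. h (f x)"] smooth_real_def)

text \<open>
  The classical flat function \<open>exp (-c / t)\<close>, together with a polynomial factor in \<open>1 / t\<close>: the factor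
  makes the class closed under differentiation, and it also provides the negative powers
  of \<open>t\<close> that are needed in the radial profile.
\<close>

definition flat :: "real \<Rightarrow> real poly \<Rightarrow> real \<Rightarrow> real" where
  "flat c p t = (if 0 < t then poly p (1 / t) * exp (- c / t) else 0)"

lemma poly_times_exp_tendsto_0:
  fixes c :: real
  assumes "0 < c"
  shows "((\<lambda>y. poly p y * exp (- c * y)) \<longlongrightarrow> 0) at_top"
proof -
  have mono: "((\<lambda>y. y ^ k * exp (- c * y)) \<longlongrightarrow> 0) at_top" for k
  proof -
    have "filterlim (\<lambda>y. c * y) at_top at_top"
      using assms by (intro filterlim_tendsto_pos_mult_at_top[OF tendsto_const] filterlim_ident)
    from filterlim_compose[OF tendsto_power_div_exp_0 this]
    have "((\<lambda>y. (c * y) ^ k / exp (c * y)) \<longlongrightarrow> 0) at_top" .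
    hence "((\<lambda>y. (1 / c ^ k) * ((c * y) ^ k / exp (c * y))) \<longlongrightarrow> (1 / c ^ k) * 0) at_top"
      by (rule tendsto_mult[OF tendsto_const])
    moreover have "(\<lambda>y. (1 / c ^ k) * ((c * y) ^ k / exp (c * y))) = (\<lambda>y. y ^ k * exp (- c * y))"
      using assms by (auto simp: power_mult_distrib exp_minus field_simps)
    ultimately show ?thesis by simp
  qed
  have "((\<lambda>y. \<Sum>i\<le>degree p. coeff p i * (y ^ i * exp (- c * y))) \<longlongrightarrow> (\<Sum>i\<le>degree p. coeff p i * 0)) at_top"
    by (intro tendsto_sum tendsto_mult[OF tendsto_const] mono)
  thus ?thesis by (simp add: poly_altdef sum_distrib_right mult.assoc)
qed

text \<open>
  At \<open>t = 0\<close> the exponential beats every power of \<open>1 / t\<close>, so the one-sided difference quotient tends to 0.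
\<close>

lemma flat_has_deriv:
  assumes "0 < c"
  shows "(flat c p has_real_derivative flat c ([:0, 0, 1:] * (smult c p - pderiv p)) t) (at t)"
proof -
  consider "t > 0" | "t < 0" | "t = 0" by linarith
  thus ?thesis
  proof cases
    case 1
    have "((\<lambda>t. poly p (1 / t) * exp (- c / t)) has_real_derivative
        poly (pderiv p) (1 / t) * (- 1 / t\<^sup>2) * exp (- c / t)
        + poly p (1 / t) * (exp (- c / t) * (c / t\<^sup>2))) (at t)"
      using 1 by (auto intro!: derivative_eq_intros DERIV_chain2[OF poly_DERIV] simp: power2_eq_square)
    moreover have "\<forall>\<^sub>F u in nhds t. flat c p u = poly p (1 / u) * exp (- c / u)"
      using eventually_nhds_in_open[of "{0<..}" t] 1
      by (auto simp: flat_def elim!: eventually_mono)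
    ultimately show ?thesis
      using 1 by (subst DERIV_cong_ev[OF refl _ refl]) (assumption, simp add: flat_def field_simps power2_eq_square)
  next
    case 2
    have "\<forall>\<^sub>F u in nhds t. flat c p u = 0"
      using eventually_nhds_in_open[of "{..<0}" t] 2
      by (auto simp: flat_def elim!: eventually_mono)
    moreover have "((\<lambda>u. 0) has_real_derivative 0) (at t)" by simp
    ultimately show ?thesis
      using 2 DERIV_cong_ev[OF refl, of "flat c p" "\<lambda>u. 0" t 0 0] by (simp add: flat_def)
  next
    case 3
    have right: "((\<lambda>h. flat c p h / h) \<longlongrightarrow> 0) (at_right 0)"
    proof (rule Lim_transform_eventually)
      show "((\<lambda>h. poly ([:0, 1:] * p) (inverse h) * exp (- c * inverse h)) \<longlongrightarrow> 0) (at_right 0)"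
        by (rule filterlim_compose[OF poly_times_exp_tendsto_0[OF assms] filterlim_inverse_at_top_right])
      show "\<forall>\<^sub>F h in at_right 0. poly ([:0, 1:] * p) (inverse h) * exp (- c * inverse h) = flat c p h / h"
        by (auto simp: eventually_at_filter flat_def divide_inverse mult_ac)
    qed
    have left: "((\<lambda>h. flat c p h / h) \<longlongrightarrow> 0) (at_left 0)"
      by (rule Lim_transform_eventually[OF tendsto_const])
         (auto simp: eventually_at_filter flat_def)
    have "((\<lambda>h. flat c p h / h) \<longlongrightarrow> 0) (at 0)"
      by (rule filterlim_split_at[OF left right])
    thus ?thesis using 3 by (simp add: DERIV_def flat_def)
  qed
qed

lemma smooth_real_flat:
  assumes "0 < c" shows "smooth_real (flat c p)"
proof -
  have "C_k_real k (flat c p)" for k p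
  proof (induction k arbitrary: p)
    case 0 show ?case
      using flat_has_deriv[OF assms] by (auto simp: continuous_on_eq_continuous_at intro: DERIV_isCont)
  next
    case (Suc k) thus ?case using flat_has_deriv[OF assms] by auto
  qed
  thus ?thesis by (simp add: smooth_real_def)
qed

lemma flat_1: "flat c 1 t = (if 0 < t then exp (- c / t) else 0)"
  by (simp add: flat_def)


section \<open>Test functions\<close>

lemma test_functionsI:
  assumes "smooth \<phi>" "compact K" "K \<subseteq> \<Omega>" "\<And>x. x \<notin> K \<Longrightarrow> \<phi> x = 0"
  shows "\<phi> \<in> test_functions \<Omega>"
proof -
  have "closure {x. \<phi> x \<noteq> 0} \<subseteq> K"
    using assms by (intro closure_minimal) (auto intro: compact_imp_closed)
  moreover have "compact (closure {x. \<phi> x \<noteq> 0})"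
    unfolding compact_closure using assms(4) by (intro bounded_subset[OF compact_imp_bounded[OF assms(2)]]) auto
  ultimately show ?thesis using assms by (auto simp: test_functions_def)
qed

lemma test_functionsE:
  assumes "\<phi> \<in> test_functions \<Omega>"
  obtains K where "smooth \<phi>" "compact K" "K \<subseteq> \<Omega>" "\<And>x. x \<notin> K \<Longrightarrow> \<phi> x = 0"
proof (rule that[of "closure {x. \<phi> x \<noteq> 0}"])
  show "\<phi> x = 0" if "x \<notin> closure {x. \<phi> x \<noteq> 0}" for x
    using that closure_subset[of "{x. \<phi> x \<noteq> 0}"] by blast
qed (use assms in \<open>auto simp: test_functions_def\<close>)

lemma test_functions_smooth: "\<phi> \<in> test_functions \<Omega> \<Longrightarrow> smooth \<phi>"
  by (simp add: test_functions_def)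

lemma test_functions_eq_0: "\<phi> \<in> test_functions \<Omega> \<Longrightarrow> x \<notin> \<Omega> \<Longrightarrow> \<phi> x = 0"
  using closure_subset[of "{x. \<phi> x \<noteq> 0}"] by (auto simp: test_functions_def)

lemma test_functions_mult:
  assumes "\<phi> \<in> test_functions \<Omega>" "smooth \<psi>"
  shows "(\<lambda>x. \<phi> x * \<psi> x) \<in> test_functions \<Omega>"
  using assms(1)
proof (rule test_functionsE)
  fix K assume "smooth \<phi>" "compact K" "K \<subseteq> \<Omega>" "\<And>x. x \<notin> K \<Longrightarrow> \<phi> x = 0"
  thus ?thesis using assms(2) by (intro test_functionsI[of _ K] smooth_mult) auto
qed

lemma test_functions_0: "(\<lambda>x. 0) \<in> test_functions \<Omega>"
  by (rule test_functionsI[of _ "{}"]) auto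

lemma test_functions_diff:
  assumes "\<phi> \<in> test_functions \<Omega>" "\<psi> \<in> test_functions \<Omega>"
  shows "(\<lambda>x. \<phi> x - \<psi> x) \<in> test_functions \<Omega>"
proof -
  obtain K where K: "smooth \<phi>" "compact K" "K \<subseteq> \<Omega>" "\<And>x. x \<notin> K \<Longrightarrow> \<phi> x = 0"
    using test_functionsE[OF assms(1)] by metis
  obtain L where L: "smooth \<psi>" "compact L" "L \<subseteq> \<Omega>" "\<And>x. x \<notin> L \<Longrightarrow> \<psi> x = 0"
    using test_functionsE[OF assms(2)] by metis
  show ?thesis
    using K L by (intro test_functionsI[of _ "K \<union> L"] smooth_diff) auto
qed

lemma test_functions_partial:
  assumes "\<phi> \<in> test_functions \<Omega>"
  shows "partial j \<phi> \<in> test_functions \<Omega>"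
  using assms
proof (rule test_functionsE)
  fix K assume K: "smooth \<phi>" "compact K" "K \<subseteq> \<Omega>" "\<And>x. x \<notin> K \<Longrightarrow> \<phi> x = 0"
  have "partial j \<phi> x = 0" if "x \<notin> K" for x
  proof -
    have "open (- K)" using K(2) compact_imp_closed by blast
    have "(\<phi> has_derivative (\<lambda>v. 0)) (at x)"
      by (rule has_derivative_transform_within_open[OF has_derivative_const \<open>open (- K)\<close>])
         (use that K in auto)
    from has_derivative_imp_partial[OF this] show ?thesis .
  qed
  thus ?thesis using K by (intro test_functionsI[of _ K] smooth_partial) auto
qed

lemma test_functions_bounded:
  assumes "\<phi> \<in> test_functions \<Omega>"
  obtains M where "\<And>x. \<bar>\<phi> x\<bar> \<le> M"
  using assms
proof (rule test_functionsE)
  fix K assume K: "smooth \<phi>" "compact K" "K \<subseteq> \<Omega>" "\<And>x. x \<notin> K \<Longrightarrow> \<phi> x = 0"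
  have "bounded (\<phi> ` K)"
    by (intro compact_imp_bounded compact_continuous_image smooth_continuous K)
  then obtain M where M: "\<And>x. x \<in> K \<Longrightarrow> \<bar>\<phi> x\<bar> \<le> M" by (auto simp: bounded_iff)
  have "\<bar>\<phi> x\<bar> \<le> max M 0" for x using M[of x] K(4)[of x] by (cases "x \<in> K") auto
  thus ?thesis using that by blast
qed

lemma smooth_borel_measurable:
  "smooth f \<Longrightarrow> f \<in> borel_measurable borel"
  by (intro borel_measurable_continuous_onI smooth_continuous)

lemma integrable_continuous_bounded_support:
  fixes G :: "'a::euclidean_space \<Rightarrow> real"
  assumes "continuous_on UNIV G" "\<And>x. R < norm x \<Longrightarrow> G x = 0"
  shows "integrable lborel G"
proof -
  have "integrable lborel (\<lambda>x. indicator (cball 0 R) x *\<^sub>R G x)"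
    by (intro borel_integrable_compact continuous_on_subset[OF assms(1)]) auto
  moreover have "(\<lambda>x. indicator (cball 0 R) x *\<^sub>R G x) = G"
    using assms(2) by (auto simp: indicator_def fun_eq_iff)
  ultimately show ?thesis by simp
qed

lemma test_functions_integrable_lborel:
  assumes "\<phi> \<in> test_functions \<Omega>"
  shows "integrable lborel \<phi>"
  using assms
proof (rule test_functionsE)
  fix K assume K: "smooth \<phi>" "compact K" "K \<subseteq> \<Omega>" "\<And>x. x \<notin> K \<Longrightarrow> \<phi> x = 0"
  obtain R where "\<And>x. x \<in> K \<Longrightarrow> norm x \<le> R"
    using compact_imp_bounded[OF K(2)] by (auto simp: bounded_iff)
  thus ?thesis
    using K by (intro integrable_continuous_bounded_support[of _ R] smooth_continuous) force+
qed


section \<open>Integration by parts\<close>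

text \<open>
  The difference quotients of \<open>G\<close> have integral 0 by translation invariance, and they are dominated
  because \<open>G\<close> is Lipschitz with bounded support. The null set on
  which \<open>G\<close> may fail to be differentiable makes room for cut-offs that are only piecewise smooth.
\<close>

lemma integral_line_derivative_eq_0:
  fixes G :: "'a::euclidean_space \<Rightarrow> real"
  assumes cont: "continuous_on UNIV G" and supp: "\<And>x. R < norm x \<Longrightarrow> G x = 0"
    and lip: "\<And>x t. \<bar>G (x + t *\<^sub>R e) - G x\<bar> \<le> L * \<bar>t\<bar>"
    and D: "D \<in> borel_measurable borel"
    and deriv: "AE x in lborel. ((\<lambda>t. G (x + t *\<^sub>R e)) has_real_derivative D x) (at 0)"
  shows "integrable lborel D" "(\<integral>x. D x \<partial>lborel) = 0"
proof -
  define q where "q k x = (G (x + (1 / real (Suc k)) *\<^sub>R e) - G x) * real (Suc k)" for k x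
  define w where "w x = L * indicat_real (cball 0 (R + norm e)) x" for x :: 'a
  have G: "integrable lborel G" by (rule integrable_continuous_bounded_support[OF cont supp])
  have [measurable]: "G \<in> borel_measurable borel" by (rule borel_measurable_continuous_onI[OF cont])
  have shift: "integrable lborel (\<lambda>x. G (x + c))" "(\<integral>x. G (x + c) \<partial>lborel) = (\<integral>x. G x \<partial>lborel)" for c
  proof -
    have "integrable (distr lborel borel ((+) c)) G" using G by (simp add: lborel_distr_plus)
    thus "integrable lborel (\<lambda>x. G (x + c))" by (subst (asm) integrable_distr_eq) (auto simp: add.commute)
    have "(\<integral>x. G x \<partial>lborel) = (\<integral>x. G x \<partial>distr lborel borel ((+) c))" by (simp add: lborel_distr_plus)
    also have "\<dots> = (\<integral>x. G (c + x) \<partial>lborel)" by (subst integral_distr) auto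
    finally show "(\<integral>x. G (x + c) \<partial>lborel) = (\<integral>x. G x \<partial>lborel)" by (simp add: add.commute)
  qed
  have q0: "(\<integral>x. q k x \<partial>lborel) = 0" for k
    unfolding q_def using shift G by (simp del: of_nat_Suc)
  have wint: "integrable lborel w"
    unfolding w_def by (intro integrable_mult_right integrable_real_indicator) (auto simp: emeasure_lborel_cball_finite[unfolded infinity_ennreal_def])
  have qm: "q k \<in> borel_measurable lborel" for k unfolding q_def by measurable
  have bound: "norm (q k x) \<le> w x" for k x
  proof (cases "norm x \<le> R + norm e")
    case True
    have "\<bar>q k x\<bar> \<le> (L * \<bar>1 / real (Suc k)\<bar>) * real (Suc k)"
      unfolding q_def abs_mult using lip[of x "1 / real (Suc k)"] by (intro mult_mono) auto
    also have "\<dots> = L" by simp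
    finally show ?thesis using True by (simp add: w_def)
  next
    case False
    have "norm e * 1 \<le> norm e * (1 + real k)" by (rule mult_left_mono) auto
    hence "norm ((1 / real (Suc k)) *\<^sub>R e) \<le> norm e" by (simp add: divide_le_eq)
    hence "R < norm (x + (1 / real (Suc k)) *\<^sub>R e)"
      using norm_triangle_ineq4[of "x + (1 / real (Suc k)) *\<^sub>R e" "(1 / real (Suc k)) *\<^sub>R e"] False by simp
    moreover have "R < norm x" using False norm_ge_zero[of e] by linarith
    ultimately show ?thesis using supp False by (simp add: q_def w_def)
  qed
  have lim: "AE x in lborel. (\<lambda>k. q k x) \<longlonglongrightarrow> D x"
    using deriv
  proof (rule AE_mp, intro AE_I2 impI)
    fix x assume "((\<lambda>t. G (x + t *\<^sub>R e)) has_real_derivative D x) (at 0)"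
    hence "((\<lambda>t. (G (x + t *\<^sub>R e) - G x) / t) \<longlongrightarrow> D x) (at 0)" by (simp add: DERIV_def)
    moreover have "filterlim (\<lambda>k. 1 / real (Suc k)) (at 0) sequentially"
      unfolding filterlim_at using LIMSEQ_Suc[OF lim_1_over_n] by auto
    ultimately have "(\<lambda>k. (G (x + (1 / real (Suc k)) *\<^sub>R e) - G x) / (1 / real (Suc k))) \<longlonglongrightarrow> D x"
      by (rule filterlim_compose)
    thus "(\<lambda>k. q k x) \<longlonglongrightarrow> D x" by (simp add: q_def)
  qed
  have Dm: "D \<in> borel_measurable lborel" using D by simp
  have bAE: "AE x in lborel. norm (q k x) \<le> w x" for k using bound by simp
  show "integrable lborel D"
    by (rule integrable_dominated_convergence[OF Dm qm wint lim bAE])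
  have "(\<lambda>k. \<integral>x. q k x \<partial>lborel) \<longlonglongrightarrow> (\<integral>x. D x \<partial>lborel)"
    by (rule integral_dominated_convergence[OF Dm qm wint lim bAE])
  thus "(\<integral>x. D x \<partial>lborel) = 0" by (simp add: q0 LIMSEQ_const_iff)
qed

lemma has_real_derivative_along_axis:
  fixes f :: "real^'n \<Rightarrow> real"
  assumes "f differentiable (at x)"
  shows "((\<lambda>t. f (x + t *\<^sub>R axis j 1)) has_real_derivative partial j f x) (at 0)"
proof -
  have lin: "linear (frechet_derivative f (at x))"
    using assms linear_frechet_derivative by blast
  have *: "((\<lambda>t. x + t *\<^sub>R axis j 1) has_derivative (\<lambda>t. t *\<^sub>R axis j 1)) (at 0)"
    by (auto intro!: derivative_eq_intros)
  have "(f has_derivative frechet_derivative f (at x)) (at (x + 0 *\<^sub>R axis j 1))"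
    using assms by (simp add: frechet_derivative_works)
  from has_derivative_compose[OF * this] show ?thesis
    unfolding has_field_derivative_def
    by (rule has_derivative_eq_rhs) (auto simp: linear_scale[OF lin] partial_def)
qed

lemma partial_bound_imp_Lipschitz:
  fixes f :: "real^'n \<Rightarrow> real"
  assumes "convex S" and diff: "\<And>x. f differentiable (at x)"
    and M: "\<And>x j. x \<in> S \<Longrightarrow> \<bar>partial j f x\<bar> \<le> M"
    and xy: "x \<in> S" "y \<in> S"
  shows "\<bar>f x - f y\<bar> \<le> real CARD('n) * M * norm (x - y)"
proof -
  have "norm (f x - f y) \<le> (real CARD('n) * M) * norm (x - y)"
  proof (rule differentiable_bound[OF assms(1) _ _ xy])
    show "(f has_derivative frechet_derivative f (at z)) (at z within S)" for z
      using diff by (meson frechet_derivative_works has_derivative_at_withinI)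
    fix z assume z: "z \<in> S"
    have M0: "0 \<le> M" using M[OF z, of undefined] by linarith
    show "onorm (frechet_derivative f (at z)) \<le> real CARD('n) * M"
    proof (rule onorm_le)
      fix v
      have "norm (frechet_derivative f (at z) v) \<le> (\<Sum>j\<in>UNIV. \<bar>v $ j * partial j f z\<bar>)"
        unfolding frechet_derivative_eq_sum_partial[OF diff] by (simp add: sum_abs)
      also have "\<dots> \<le> (\<Sum>j\<in>(UNIV::'n set). norm v * M)"
        by (intro sum_mono) (auto simp: abs_mult intro!: mult_mono component_le_norm_cart M z)
      finally show "norm (frechet_derivative f (at z) v) \<le> real CARD('n) * M * norm v"
        by (simp add: mult_ac)
    qed
  qed
  thus ?thesis by simp
qed

lemma test_functions_integral_partial:
  assumes "\<phi> \<in> test_functions (\<Omega> :: (real^'n) set)"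
  shows "(\<integral>x. partial j \<phi> x \<partial>lborel) = 0"
proof -
  have "\<exists>M. \<forall>x. \<bar>partial i \<phi> x\<bar> \<le> M" for i
    using test_functions_bounded[OF test_functions_partial[OF assms]] by metis
  then obtain m where m: "\<And>i x. \<bar>partial i \<phi> x\<bar> \<le> m i" by metis
  have mle: "\<bar>partial i \<phi> x\<bar> \<le> Max (range m)" for i x
    by (rule order_trans[OF m[of i x]]) (intro Max_ge, auto)
  obtain K where K: "smooth \<phi>" "compact K" "K \<subseteq> \<Omega>" "\<And>x. x \<notin> K \<Longrightarrow> \<phi> x = 0"
    using test_functionsE[OF assms] by metis
  obtain R where R: "\<And>x. x \<in> K \<Longrightarrow> norm x \<le> R"
    using compact_imp_bounded[OF K(2)] by (auto simp: bounded_iff)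
  show ?thesis
  proof (rule integral_line_derivative_eq_0(2))
    show "continuous_on UNIV \<phi>" by (rule smooth_continuous[OF K(1)])
    show "\<phi> x = 0" if "R < norm x" for x using R[of x] K(4)[of x] that by force
    show "\<bar>\<phi> (x + t *\<^sub>R axis j 1) - \<phi> x\<bar> \<le> (real CARD('n) * Max (range m)) * \<bar>t\<bar>" for x t
      using partial_bound_imp_Lipschitz[OF convex_UNIV smooth_differentiable[OF K(1)] mle, of "x + t *\<^sub>R axis j 1" x]
      by simp
    show "partial j \<phi> \<in> borel_measurable borel" by (intro smooth_borel_measurable smooth_partial K(1))
    show "AE x in lborel. ((\<lambda>t. \<phi> (x + t *\<^sub>R axis j 1)) has_real_derivative partial j \<phi> x) (at 0)"
      using has_real_derivative_along_axis[OF smooth_differentiable[OF K(1)]] by simp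
  qed
qed

lemma integral_lebesgue_on_eq_lborel:
  fixes f :: "'a::euclidean_space \<Rightarrow> real"
  assumes "f \<in> borel_measurable borel" "\<And>x. x \<notin> \<Omega> \<Longrightarrow> f x = 0" "\<Omega> \<in> sets lebesgue"
  shows "(\<integral>x. f x \<partial>lebesgue_on \<Omega>) = (\<integral>x. f x \<partial>lborel)"
proof -
  have "(\<lambda>x. indicator \<Omega> x *\<^sub>R f x) = f" using assms(2) by (auto simp: fun_eq_iff indicator_def)
  thus ?thesis using assms by (simp add: integral_restrict_space integral_completion)
qed

lemma integrable_lebesgue_on_iff_lborel:
  fixes f :: "'a::euclidean_space \<Rightarrow> real"
  assumes "f \<in> borel_measurable borel" "\<And>x. x \<notin> \<Omega> \<Longrightarrow> f x = 0" "\<Omega> \<in> sets lebesgue"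
  shows "integrable (lebesgue_on \<Omega>) f \<longleftrightarrow> integrable lborel f"
proof -
  have "(\<lambda>x. indicator \<Omega> x *\<^sub>R f x) = f" using assms(2) by (auto simp: fun_eq_iff indicator_def)
  thus ?thesis using assms by (simp add: integrable_restrict_space integrable_completion)
qed

lemma test_functions_integrable:
  assumes "\<phi> \<in> test_functions \<Omega>" "\<Omega> \<in> sets lebesgue"
  shows "integrable (lebesgue_on \<Omega>) \<phi>"
  using assms test_functions_integrable_lborel[OF assms(1)] test_functions_smooth[OF assms(1)]
  by (subst integrable_lebesgue_on_iff_lborel)
     (auto intro: test_functions_eq_0 smooth_borel_measurable)

lemma has_weak_partial_smooth:
  assumes "smooth f" "\<Omega> \<in> sets lebesgue"
  shows "has_weak_partial \<Omega> j f (partial j f)"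
  unfolding has_weak_partial_def
proof
  fix \<phi> assume \<phi>: "\<phi> \<in> test_functions \<Omega>"
  have t1: "(\<lambda>x. f x * partial j \<phi> x) \<in> test_functions \<Omega>"
    using test_functions_mult[OF test_functions_partial[OF \<phi>] assms(1)] by (simp add: mult.commute)
  have t2: "(\<lambda>x. partial j f x * \<phi> x) \<in> test_functions \<Omega>"
    using test_functions_mult[OF \<phi> smooth_partial[OF assms(1)]] by (simp add: mult.commute)
  have t: "(\<lambda>x. f x * \<phi> x) \<in> test_functions \<Omega>"
    using test_functions_mult[OF \<phi> assms(1)] by (simp add: mult.commute)
  have eq: "partial j (\<lambda>x. f x * \<phi> x) = (\<lambda>x. partial j f x * \<phi> x + f x * partial j \<phi> x)"
    by (intro ext partial_mult smooth_differentiable assms test_functions_smooth[OF \<phi>])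
  have pt: "(\<lambda>x. partial j f x * \<phi> x + f x * partial j \<phi> x) \<in> test_functions \<Omega>"
    using test_functions_partial[OF t, of j] by (simp add: eq)
  have "(\<integral>x. partial j f x * \<phi> x + f x * partial j \<phi> x \<partial>lebesgue_on \<Omega>) = 0"
    using test_functions_integral_partial[OF t, of j] assms pt
    by (subst integral_lebesgue_on_eq_lborel)
       (auto simp: eq intro!: smooth_borel_measurable test_functions_smooth dest: test_functions_eq_0)
  thus "(\<integral>x. f x * partial j \<phi> x \<partial>lebesgue_on \<Omega>) = - (\<integral>x. partial j f x * \<phi> x \<partial>lebesgue_on \<Omega>)"
    using test_functions_integrable[OF t1 assms(2)] test_functions_integrable[OF t2 assms(2)] by simp
qed


section \<open>The fundamental lemma of the calculus of variations\<close>

lemma box_test_functions: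
  fixes a b :: "real^'n"
  assumes "0 < c" "cbox a b \<subseteq> \<Omega>"
  shows "(\<lambda>x. \<Prod>i\<in>UNIV. flat c 1 (x $ i - a $ i) * flat c 1 (b $ i - x $ i)) \<in> test_functions \<Omega>"
proof (rule test_functionsI[OF _ compact_cbox assms(2)])
  have "smooth (\<lambda>x. flat c 1 (x $ i - a $ i))" for i
    by (rule smooth_compose_real[OF smooth_real_flat[OF assms(1)] smooth_diff[OF smooth_component smooth_const]])
  moreover have "smooth (\<lambda>x. flat c 1 (b $ i - x $ i))" for i
    by (rule smooth_compose_real[OF smooth_real_flat[OF assms(1)] smooth_diff[OF smooth_const smooth_component]])
  ultimately show "smooth (\<lambda>x. \<Prod>i\<in>UNIV. flat c 1 (x $ i - a $ i) * flat c 1 (b $ i - x $ i))"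
    by (intro smooth_prod smooth_mult) auto
  fix x assume "x \<notin> cbox a b"
  then obtain i where "x $ i < a $ i \<or> b $ i < x $ i" by (auto simp: mem_box_cart not_le)
  hence "flat c 1 (x $ i - a $ i) * flat c 1 (b $ i - x $ i) = 0" by (auto simp: flat_1)
  thus "(\<Prod>i\<in>UNIV. flat c 1 (x $ i - a $ i) * flat c 1 (b $ i - x $ i)) = 0"
    by (meson UNIV_I finite prod_zero)
qed

lemma flat_tendsto_indicator: "(\<lambda>k. flat (1 / real (Suc k)) 1 t) \<longlonglongrightarrow> (if 0 < t then 1 else 0)"
proof (cases "0 < t")
  case True
  have "(\<lambda>k. exp (- (1 / real (Suc k)) / t)) \<longlonglongrightarrow> exp (- 0 / t)"
    using LIMSEQ_Suc[OF lim_1_over_n[where 'a = real]] True by (intro tendsto_intros) auto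
  thus ?thesis using True by (simp add: flat_1)
qed (simp add: flat_1)

lemma flat_1_bounds: "0 < c \<Longrightarrow> 0 \<le> flat c 1 t \<and> flat c 1 t \<le> 1"
  by (auto simp: flat_1)

text \<open>
  The products of flat functions \<open>exp (-c / t)\<close> of the distances to the faces tend to the indicator of
  the open box as \<open>c\<close> tends to 0.
\<close>

lemma orthogonal_to_test_functions_imp_box_integral_0:
  fixes d :: "real^'n \<Rightarrow> real"
  assumes \<Omega>: "\<Omega> \<in> sets lebesgue" and d: "integrable (lebesgue_on \<Omega>) d"
    and orth: "\<And>\<phi>. \<phi> \<in> test_functions \<Omega> \<Longrightarrow> (\<integral>x. d x * \<phi> x \<partial>lebesgue_on \<Omega>) = 0"
    and ab: "cbox a b \<subseteq> \<Omega>"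
  shows "(\<integral>x. d x * indicator (box a b) x \<partial>lebesgue_on \<Omega>) = 0"
proof -
  define \<beta> where "\<beta> k x = (\<Prod>i\<in>UNIV. flat (1 / real (Suc k)) 1 (x $ i - a $ i) * flat (1 / real (Suc k)) 1 (b $ i - x $ i))"
    for k and x :: "real^'n"
  have \<beta>: "\<beta> k \<in> test_functions \<Omega>" for k
    unfolding \<beta>_def by (rule box_test_functions) (auto simp: ab)
  have \<beta>m: "\<beta> k \<in> borel_measurable (lebesgue_on \<Omega>)" for k
    using test_functions_integrable[OF \<beta> \<Omega>] by auto
  have dm: "d \<in> borel_measurable (lebesgue_on \<Omega>)" using d by auto
  have \<beta>1: "0 \<le> \<beta> k x \<and> \<beta> k x \<le> 1" for k x
    unfolding \<beta>_def by (auto intro!: prod_nonneg prod_le_1 mult_nonneg_nonneg mult_le_one simp: flat_1_bounds)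
  have \<beta>lim: "(\<lambda>k. \<beta> k x) \<longlonglongrightarrow> indicator (box a b) x" for x
  proof -
    have "(\<lambda>k. \<beta> k x) \<longlonglongrightarrow> (\<Prod>i\<in>UNIV. (if 0 < x $ i - a $ i then 1 else 0) * (if 0 < b $ i - x $ i then 1 else 0))"
      unfolding \<beta>_def by (intro tendsto_prod tendsto_mult flat_tendsto_indicator)
    also have "(\<Prod>i\<in>UNIV. (if 0 < x $ i - a $ i then 1 else 0) * (if 0 < b $ i - x $ i then 1 else 0)) = (indicator (box a b) x :: real)"
    proof (cases "x \<in> box a b")
      case True thus ?thesis by (auto simp: mem_box_cart)
    next
      case False
      then obtain i where "\<not> (a $ i < x $ i \<and> x $ i < b $ i)" by (auto simp: mem_box_cart)
      hence "(if 0 < x $ i - a $ i then 1 else 0) * (if 0 < b $ i - x $ i then 1 else 0) = (0::real)" by auto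
      hence "(\<Prod>i\<in>UNIV. (if 0 < x $ i - a $ i then 1 else 0) * (if 0 < b $ i - x $ i then 1 else 0)) = (0::real)"
        by (meson UNIV_I finite prod_zero)
      thus ?thesis using False by simp
    qed
    finally show ?thesis .
  qed
  have bm: "indicat_real (box a b) \<in> borel_measurable (lebesgue_on \<Omega>)"
    by (intro measurable_restrict_space1 borel_measurable_indicator) auto
  have "(\<lambda>k. \<integral>x. d x * \<beta> k x \<partial>lebesgue_on \<Omega>) \<longlonglongrightarrow> (\<integral>x. d x * indicator (box a b) x \<partial>lebesgue_on \<Omega>)"
  proof (rule integral_dominated_convergence[where w = "\<lambda>x. \<bar>d x\<bar>"])
    show "AE x in lebesgue_on \<Omega>. norm (d x * \<beta> k x) \<le> \<bar>d x\<bar>" for k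
      using \<beta>1[of k] by (auto simp: abs_mult intro!: mult_left_le)
    show "AE x in lebesgue_on \<Omega>. (\<lambda>k. d x * \<beta> k x) \<longlonglongrightarrow> d x * indicator (box a b) x"
      by (intro AE_I2 tendsto_mult tendsto_const \<beta>lim)
  qed (use d dm \<beta>m bm in auto)
  thus ?thesis using orth[OF \<beta>] by (simp add: LIMSEQ_const_iff)
qed


text \<open>
  The open boxes are a generator of the Borel sets that is stable under intersection, so the integral
  vanishes over every Borel set.
\<close>

lemma box_integrals_0_imp_AE_0:
  fixes f :: "'a::euclidean_space \<Rightarrow> real"
  assumes f: "integrable lebesgue f"
    and box: "\<And>a b. (\<integral>x. f x * indicator (box a b) x \<partial>lebesgue) = 0"
    and total: "(\<integral>x. f x \<partial>lebesgue) = 0"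
  shows "AE x in lebesgue. f x = 0"
proof -
  obtain g where gm: "g \<in> borel_measurable lborel" and "AE x in lborel. f x = g x"
    using completion_ex_borel_measurable_real[OF borel_measurable_integrable[OF f]] by blast
  hence eq: "AE x in lebesgue. f x = g x" by (intro AE_completion)
  have fm: "f \<in> borel_measurable lebesgue" using f by auto
  have gm': "g \<in> borel_measurable lebesgue" using gm by (rule measurable_completion)
  have gL: "integrable lebesgue g" using f integrable_cong_AE[OF fm gm' eq] by simp
  hence g: "integrable lborel g" using gm by (simp add: integrable_completion)
  have trans: "(\<integral>x. g x * indicator A x \<partial>lborel) = (\<integral>x. f x * indicator A x \<partial>lebesgue)"
    if "A \<in> sets borel" for A
  proof -
    have [measurable]: "A \<in> sets lborel" "A \<in> sets lebesgue" using that by auto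
    have "(\<integral>x. g x * indicator A x \<partial>lborel) = (\<integral>x. g x * indicator A x \<partial>lebesgue)"
      using gm by (subst integral_completion) auto
    also have "\<dots> = (\<integral>x. f x * indicator A x \<partial>lebesgue)"
      using eq fm gm' by (intro integral_cong_AE) auto
    finally show ?thesis .
  qed
  have ext: "(\<integral>x\<in>A. g x \<partial>lborel) = 0" if "A \<in> sets borel" for A
  proof -
    have S: "sigma_sets UNIV (range (\<lambda>(a, b). box a b :: 'a set)) = sets borel"
      unfolding borel_eq_box by (subst sets_measure_of) auto
    have 1: "A \<in> sigma_sets UNIV (range (\<lambda>(a, b). box a b :: 'a set))"
      using that S by simp
    have B: "box u v \<in> range (\<lambda>(a, b). box a b :: 'a set)" for u v
      by (rule range_eqI[of _ _ "(u, v)"]) simp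
    have 2: "Int_stable (range (\<lambda>(a, b). box a b :: 'a set))"
    proof (rule Int_stableI)
      fix X Y :: "'a set"
      assume "X \<in> range (\<lambda>(a, b). box a b)" "Y \<in> range (\<lambda>(a, b). box a b)"
      then obtain a b c d where "X = box a b" "Y = box c d" by auto
      thus "X \<inter> Y \<in> range (\<lambda>(a, b). box a b)"
        by (simp only: box_Int_box B)
    qed
    have 3: "range (\<lambda>(a, b). box a b :: 'a set) \<subseteq> Pow UNIV" by simp
    from 2 3 1 show ?thesis
    proof (induction rule: sigma_sets_induct_disjoint)
      case (basic A)
      then obtain a b where "A = box a b" by auto
      thus ?case using trans[of A] box[of a b] by (simp add: set_lebesgue_integral_def mult.commute)
    next
      case empty show ?case by (simp add: set_lebesgue_integral_def)
    next
      case (compl A)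
      hence A: "A \<in> sets lborel" using S by simp
      have i: "set_integrable lborel B g" if "B \<in> sets lborel" for B
        unfolding set_integrable_def using that g by (rule integrable_mult_indicator)
      have A': "UNIV - A \<in> sets lborel" using A by auto
      have "(\<integral>x\<in>A \<union> (UNIV - A). g x \<partial>lborel) = (\<integral>x\<in>A. g x \<partial>lborel) + (\<integral>x\<in>UNIV - A. g x \<partial>lborel)"
        by (rule set_integral_Un[OF _ i[OF A] i[OF A']]) simp
      moreover have "A \<union> (UNIV - A) = UNIV" by simp
      ultimately show ?case using compl trans[of UNIV] total by (simp add: set_lebesgue_integral_def)
    next
      case (union A)
      hence A: "A i \<in> sets lborel" for i using S by auto
      have "(\<integral>x\<in>(\<Union>i. A i). g x \<partial>lborel) = (\<Sum>i. \<integral>x\<in>A i. g x \<partial>lborel)"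
      proof (rule lebesgue_integral_countable_add[OF A])
        show "A i \<inter> A j = {}" if "i \<noteq> j" for i j
          using union(1) that by (auto simp: disjoint_family_on_def)
        have "(\<Union>i. A i) \<in> sets lborel" using A by (intro sets.countable_UN') auto
        thus "set_integrable lborel (\<Union>i. A i) g"
          unfolding set_integrable_def using g by (rule integrable_mult_indicator)
      qed
      thus ?case using union by simp
    qed
  qed
  have "AE x in lborel. g x = 0"
    using density_unique_real[OF g, of "\<lambda>x. 0"] ext by (auto simp: set_lebesgue_integral_def)
  hence "AE x in lebesgue. g x = 0" by (rule AE_completion)
  thus ?thesis using eq by eventually_elim simp
qed


text \<open>
  The open set is a countable union of closed boxes, and the boundaries of boxes are null sets.
\<close>

lemma orthogonal_to_test_functions_imp_AE_0:
  fixes d :: "real^'n \<Rightarrow> real"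
  assumes \<Omega>: "open \<Omega>" and d: "integrable (lebesgue_on \<Omega>) d"
    and orth: "\<And>\<phi>. \<phi> \<in> test_functions \<Omega> \<Longrightarrow> (\<integral>x. d x * \<phi> x \<partial>lebesgue_on \<Omega>) = 0"
  shows "AE x in lebesgue_on \<Omega>. d x = 0"
proof -
  have \<Omega>m: "\<Omega> \<in> sets lebesgue" using \<Omega> by auto
  have local: "AE x in lebesgue. x \<in> cbox p q \<longrightarrow> d x = 0" if pq: "cbox p q \<subseteq> \<Omega>" for p q
  proof -
    define f where "f x = indicator \<Omega> x * d x * indicator (box p q) x" for x
    have dL: "integrable lebesgue (\<lambda>x. indicator \<Omega> x * d x)"
      using d \<Omega>m by (simp add: integrable_restrict_space)
    have f: "integrable lebesgue f"
      unfolding f_def using integrable_mult_indicator[OF _ dL, of "box p q"] by (simp add: mult.commute)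
    have box: "(\<integral>x. f x * indicator (box a b) x \<partial>lebesgue) = 0" for a b
    proof -
      define a' b' where "a' = (\<Sum>i\<in>Basis. max (p\<bullet>i) (a\<bullet>i) *\<^sub>R i)" and "b' = (\<Sum>i\<in>Basis. min (q\<bullet>i) (b\<bullet>i) *\<^sub>R i)"
      have I: "box p q \<inter> box a b = box a' b'" "cbox p q \<inter> cbox a b = cbox a' b'"
        unfolding a'_def b'_def by (rule box_Int_box Int_interval)+
      hence sub: "cbox a' b' \<subseteq> \<Omega>" using pq by blast
      have "(\<integral>x. f x * indicator (box a b) x \<partial>lebesgue) = (\<integral>x. indicator \<Omega> x *\<^sub>R (d x * indicator (box a' b') x) \<partial>lebesgue)"
        unfolding f_def I(1)[symmetric] by (simp add: indicator_inter_arith mult_ac)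
      also have "\<dots> = (\<integral>x. d x * indicator (box a' b') x \<partial>lebesgue_on \<Omega>)"
        using \<Omega>m by (simp add: integral_restrict_space)
      also have "\<dots> = 0"
        by (rule orthogonal_to_test_functions_imp_box_integral_0[OF \<Omega>m d orth sub])
      finally show ?thesis .
    qed
    have "(\<lambda>x. f x * indicator (box p q) x) = f" by (auto simp: f_def indicator_def fun_eq_iff)
    with box[of p q] have "(\<integral>x. f x \<partial>lebesgue) = 0" by simp
    hence "AE x in lebesgue. f x = 0" by (rule box_integrals_0_imp_AE_0[OF f box])
    moreover have "AE x in lebesgue. x \<notin> cbox p q - box p q"
      by (rule AE_not_in) (simp add: negligible_frontier_interval flip: negligible_iff_null_sets)
    ultimately show ?thesis
    proof eventually_elim
      case (elim x)
      thus ?case using pq by (auto simp: f_def indicator_def split: if_splits)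
    qed
  qed
  obtain \<D> where \<D>: "countable \<D>" "\<D> \<subseteq> Pow \<Omega>" "\<And>X. X \<in> \<D> \<Longrightarrow> \<exists>a b. X = cbox a b" "\<Union>\<D> = \<Omega>"
    by (rule open_countable_Union_open_cbox[OF \<Omega>], rule that)
  have "AE x in lebesgue. \<forall>X\<in>\<D>. x \<in> X \<longrightarrow> d x = 0"
    unfolding AE_ball_countable[OF \<D>(1)]
  proof
    fix X assume X: "X \<in> \<D>"
    then obtain p q where pq: "X = cbox p q" using \<D>(3) by blast
    with X \<D>(2) have "cbox p q \<subseteq> \<Omega>" by auto
    from local[OF this] show "AE x in lebesgue. x \<in> X \<longrightarrow> d x = 0" by (simp add: pq)
  qed
  hence "AE x in lebesgue. x \<in> \<Omega> \<longrightarrow> d x = 0" by eventually_elim (use \<D>(4) in blast)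
  thus ?thesis using \<Omega>m by (subst AE_restrict_space_iff) auto
qed


section \<open>Weak derivatives\<close>

lemma L2_diff:
  fixes f g :: "'a \<Rightarrow> real"
  assumes "f \<in> L2 M" "g \<in> L2 M"
  shows "(\<lambda>x. f x - g x) \<in> L2 M"
proof -
  have [measurable]: "f \<in> borel_measurable M" "g \<in> borel_measurable M" using assms by (auto simp: L2_def)
  have "integrable M (\<lambda>x. (f x - g x)\<^sup>2)"
  proof (rule Bochner_Integration.integrable_bound)
    show "integrable M (\<lambda>x. 2 * (f x)\<^sup>2 + 2 * (g x)\<^sup>2)" using assms by (auto simp: L2_def)
    have "(f x - g x)\<^sup>2 \<le> 2 * (f x)\<^sup>2 + 2 * (g x)\<^sup>2" for x
      using zero_le_power2[of "f x + g x"] by (simp add: power2_eq_square algebra_simps)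
    thus "AE x in M. norm ((f x - g x)\<^sup>2) \<le> norm (2 * (f x)\<^sup>2 + 2 * (g x)\<^sup>2)" by simp
  qed measurable
  thus ?thesis by (simp add: L2_def)
qed

lemma L2_mult_integrable:
  fixes f g :: "'a \<Rightarrow> real"
  assumes "f \<in> L2 M" "g \<in> L2 M"
  shows "integrable M (\<lambda>x. f x * g x)"
proof -
  have [measurable]: "f \<in> borel_measurable M" "g \<in> borel_measurable M" using assms by (auto simp: L2_def)
  show ?thesis
  proof (rule Bochner_Integration.integrable_bound)
    show "integrable M (\<lambda>x. (f x)\<^sup>2 + (g x)\<^sup>2)" using assms by (auto simp: L2_def)
    have "\<bar>f x\<bar> * \<bar>g x\<bar> \<le> (f x)\<^sup>2 + (g x)\<^sup>2" for x
    proof -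
      have "2 * \<bar>f x\<bar> * \<bar>g x\<bar> \<le> (f x)\<^sup>2 + (g x)\<^sup>2" using sum_squares_bound[of "\<bar>f x\<bar>" "\<bar>g x\<bar>"] by simp
      moreover have "0 \<le> \<bar>f x\<bar> * \<bar>g x\<bar>" by simp
      ultimately show ?thesis by linarith
    qed
    thus "AE x in M. norm (f x * g x) \<le> norm ((f x)\<^sup>2 + (g x)\<^sup>2)" by (simp add: abs_mult)
  qed measurable
qed

lemma L2_bounded:
  fixes f :: "'a \<Rightarrow> real"
  assumes "finite_measure M" "f \<in> borel_measurable M" "\<And>x. x \<in> space M \<Longrightarrow> \<bar>f x\<bar> \<le> B"
  shows "f \<in> L2 M"
proof -
  have "\<bar>f x\<bar>\<^sup>2 \<le> B\<^sup>2" if "x \<in> space M" for x using assms(3)[OF that] by (intro power_mono) auto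
  hence "integrable M (\<lambda>x. (f x)\<^sup>2)"
    using assms by (intro finite_measure.integrable_const_bound[of M _ "B\<^sup>2"]) auto
  thus ?thesis using assms by (simp add: L2_def)
qed

lemma L2_integrable:
  fixes f :: "'a \<Rightarrow> real"
  assumes "finite_measure M" "f \<in> L2 M"
  shows "integrable M f"
  using L2_mult_integrable[OF assms(2) L2_bounded[OF assms(1), of "\<lambda>x. 1" 1]] by simp

lemma smooth_measurable_lebesgue_on: "smooth f \<Longrightarrow> f \<in> borel_measurable (lebesgue_on \<Omega>)"
  by (intro measurable_restrict_space1 measurable_completion) (simp add: smooth_borel_measurable)

lemma test_functions_L2:
  assumes "\<phi> \<in> test_functions \<Omega>" "\<Omega> \<in> lmeasurable"
  shows "\<phi> \<in> L2 (lebesgue_on \<Omega>)"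
proof -
  obtain B where "\<And>x. \<bar>\<phi> x\<bar> \<le> B" using test_functions_bounded[OF assms(1)] by metis
  thus ?thesis
    using assms by (intro L2_bounded[of _ _ B] finite_measure_lebesgue_on smooth_measurable_lebesgue_on)
                   (auto simp: test_functions_smooth)
qed

lemma bounded_continuous_bounded:
  fixes f :: "'a::euclidean_space \<Rightarrow> real"
  assumes "bounded \<Omega>" "continuous_on UNIV f"
  obtains B where "\<And>x. x \<in> \<Omega> \<Longrightarrow> \<bar>f x\<bar> \<le> B"
proof -
  have "bounded (f ` closure \<Omega>)"
    using assms by (intro compact_imp_bounded compact_continuous_image) (auto intro: continuous_on_subset)
  then obtain B where "\<And>x. x \<in> closure \<Omega> \<Longrightarrow> \<bar>f x\<bar> \<le> B" by (auto simp: bounded_iff)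
  thus ?thesis using that closure_subset by blast
qed

lemma smooth_L2:
  assumes "smooth f" "\<Omega> \<in> lmeasurable" "bounded \<Omega>"
  shows "f \<in> L2 (lebesgue_on \<Omega>)"
proof -
  obtain B where "\<And>x. x \<in> \<Omega> \<Longrightarrow> \<bar>f x\<bar> \<le> B"
    using bounded_continuous_bounded[OF assms(3) smooth_continuous[OF assms(1)]] by metis
  thus ?thesis
    using assms by (intro L2_bounded[of _ _ B] finite_measure_lebesgue_on smooth_measurable_lebesgue_on) auto
qed

lemma has_weak_partial_diff:
  assumes \<Omega>: "\<Omega> \<in> lmeasurable"
    and L2: "f \<in> L2 (lebesgue_on \<Omega>)" "f' \<in> L2 (lebesgue_on \<Omega>)" "g \<in> L2 (lebesgue_on \<Omega>)" "g' \<in> L2 (lebesgue_on \<Omega>)"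
    and "has_weak_partial \<Omega> j f g" "has_weak_partial \<Omega> j f' g'"
  shows "has_weak_partial \<Omega> j (\<lambda>x. f x - f' x) (\<lambda>x. g x - g' x)"
  unfolding has_weak_partial_def
proof
  fix \<phi> assume \<phi>: "\<phi> \<in> test_functions \<Omega>"
  have \<phi>2: "\<phi> \<in> L2 (lebesgue_on \<Omega>)" "partial j \<phi> \<in> L2 (lebesgue_on \<Omega>)"
    using \<phi> \<Omega> test_functions_partial by (auto intro: test_functions_L2)
  show "(\<integral>x. (f x - f' x) * partial j \<phi> x \<partial>lebesgue_on \<Omega>) = - (\<integral>x. (g x - g' x) * \<phi> x \<partial>lebesgue_on \<Omega>)"
    using assms(6,7) \<phi> unfolding has_weak_partial_def
    by (simp add: left_diff_distrib L2_mult_integrable[OF _ \<phi>2(1)] L2_mult_integrable[OF _ \<phi>2(2)] L2)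
qed

lemma has_weak_partial_unique:
  assumes \<Omega>: "open \<Omega>" "\<Omega> \<in> lmeasurable"
    and L2: "g \<in> L2 (lebesgue_on \<Omega>)" "g' \<in> L2 (lebesgue_on \<Omega>)"
    and w: "has_weak_partial \<Omega> j f g" "has_weak_partial \<Omega> j f g'"
  shows "AE x in lebesgue_on \<Omega>. g x = g' x"
proof -
  have "AE x in lebesgue_on \<Omega>. g x - g' x = 0"
  proof (rule orthogonal_to_test_functions_imp_AE_0[OF \<Omega>(1)])
    show "integrable (lebesgue_on \<Omega>) (\<lambda>x. g x - g' x)"
      using L2 by (intro Bochner_Integration.integrable_diff L2_integrable finite_measure_lebesgue_on \<Omega>)
    fix \<phi> assume \<phi>: "\<phi> \<in> test_functions \<Omega>"
    have "(\<integral>x. g x * \<phi> x \<partial>lebesgue_on \<Omega>) = (\<integral>x. g' x * \<phi> x \<partial>lebesgue_on \<Omega>)"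
      using w \<phi> unfolding has_weak_partial_def by fastforce
    thus "(\<integral>x. (g x - g' x) * \<phi> x \<partial>lebesgue_on \<Omega>) = 0"
      using test_functions_L2[OF \<phi> \<Omega>(2)] L2 by (simp add: left_diff_distrib L2_mult_integrable)
  qed
  thus ?thesis by simp
qed

lemma weak_partial_spec:
  assumes "f \<in> W12 \<Omega>"
  shows "weak_partial \<Omega> j f \<in> L2 (lebesgue_on \<Omega>)" "has_weak_partial \<Omega> j f (weak_partial \<Omega> j f)"
proof -
  have "\<exists>g. g \<in> L2 (lebesgue_on \<Omega>) \<and> has_weak_partial \<Omega> j f g" using assms by (auto simp: W12_def)
  from someI_ex[OF this] show "weak_partial \<Omega> j f \<in> L2 (lebesgue_on \<Omega>)"
    "has_weak_partial \<Omega> j f (weak_partial \<Omega> j f)" by (auto simp: weak_partial_def)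
qed

lemma W12_L2: "f \<in> W12 \<Omega> \<Longrightarrow> f \<in> L2 (lebesgue_on \<Omega>)"
  by (simp add: W12_def)

lemma W12_diff:
  assumes "\<Omega> \<in> lmeasurable" "f \<in> W12 \<Omega>" "g \<in> W12 \<Omega>"
  shows "(\<lambda>x. f x - g x) \<in> W12 \<Omega>"
  using assms weak_partial_spec[OF assms(2)] weak_partial_spec[OF assms(3)]
  unfolding W12_def
  by (auto intro!: L2_diff bexI[of _ "\<lambda>x. weak_partial \<Omega> j f x - weak_partial \<Omega> j g x" for j]
      has_weak_partial_diff)

lemma weak_partial_eq_AE:
  assumes "open \<Omega>" "\<Omega> \<in> lmeasurable" "f \<in> L2 (lebesgue_on \<Omega>)" "g \<in> L2 (lebesgue_on \<Omega>)"
    "has_weak_partial \<Omega> j f g"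
  shows "AE x in lebesgue_on \<Omega>. weak_partial \<Omega> j f x = g x"
proof -
  have "\<exists>g. g \<in> L2 (lebesgue_on \<Omega>) \<and> has_weak_partial \<Omega> j f g" using assms by blast
  from someI_ex[OF this] show ?thesis
    using assms by (intro has_weak_partial_unique[where f = f and j = j]) (auto simp: weak_partial_def)
qed

lemma test_functions_W12:
  assumes "\<phi> \<in> test_functions \<Omega>" "\<Omega> \<in> lmeasurable"
  shows "\<phi> \<in> W12 \<Omega>"
  unfolding W12_def using assms
  by (auto intro!: test_functions_L2 bexI[of _ "partial j \<phi>" for j] test_functions_partial
      has_weak_partial_smooth test_functions_smooth)

lemma weak_partial_test_function:
  assumes "\<phi> \<in> test_functions \<Omega>" "open \<Omega>" "\<Omega> \<in> lmeasurable"
  shows "AE x in lebesgue_on \<Omega>. weak_partial \<Omega> j \<phi> x = partial j \<phi> x"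
  using assms
  by (intro weak_partial_eq_AE test_functions_L2 test_functions_partial has_weak_partial_smooth test_functions_smooth)
     auto

text \<open>
  The constant sequence approximates. That its distance from \<open>\<phi>\<close> is 0 has to be derived from the uniqueness of weak
  derivatives, because \<open>weak_partial\<close> of the zero function is a choice within its class.
\<close>

lemma test_functions_W12_0:
  assumes "\<phi> \<in> test_functions \<Omega>" "open \<Omega>" "\<Omega> \<in> lmeasurable"
  shows "\<phi> \<in> W12_0 \<Omega>"
proof -
  have "AE x in lebesgue_on \<Omega>. weak_partial \<Omega> j (\<lambda>x. 0) x = 0" for j
    using weak_partial_test_function[OF test_functions_0 assms(2,3)] by simp
  moreover have "weak_partial \<Omega> j (\<lambda>x. 0) \<in> borel_measurable (lebesgue_on \<Omega>)" for j
    using weak_partial_spec(1)[OF test_functions_W12[OF test_functions_0 assms(3)]] by (simp add: L2_def)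
  ultimately have "L2_norm (lebesgue_on \<Omega>) (weak_partial \<Omega> j (\<lambda>x. 0)) = 0" for j
    unfolding L2_norm_def by (subst integral_cong_AE[where g = "\<lambda>x. 0"]) auto
  hence "W12_norm \<Omega> (\<lambda>x. \<phi> x - \<phi> x) = 0"
    by (simp add: W12_norm_def L2_norm_def[of _ "\<lambda>x. 0"])
  thus ?thesis using assms test_functions_W12[OF assms(1,3)]
    by (auto simp: W12_0_def intro!: exI[of _ "\<lambda>n. \<phi>"])
qed

lemma W12_norm_bounds:
  shows "L2_norm (lebesgue_on \<Omega>) f \<le> W12_norm \<Omega> f"
    and "L2_norm (lebesgue_on \<Omega>) (weak_partial \<Omega> j f) \<le> W12_norm \<Omega> f"
proof -
  have "(\<Sum>j\<in>{j}. (L2_norm (lebesgue_on \<Omega>) (weak_partial \<Omega> j f))\<^sup>2)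
      \<le> (\<Sum>j\<in>UNIV. (L2_norm (lebesgue_on \<Omega>) (weak_partial \<Omega> j f))\<^sup>2)"
    by (rule sum_mono2) auto
  thus "L2_norm (lebesgue_on \<Omega>) (weak_partial \<Omega> j f) \<le> W12_norm \<Omega> f"
    unfolding W12_norm_def by (intro real_le_rsqrt) (simp add: add_increasing)
  show "L2_norm (lebesgue_on \<Omega>) f \<le> W12_norm \<Omega> f"
    unfolding W12_norm_def by (intro real_le_rsqrt) (simp add: sum_nonneg)
qed


section \<open>The divergence theorem in a ball\<close>

lemma lborel_integral_scaleR:
  fixes f :: "'a::euclidean_space \<Rightarrow> real"
  assumes "0 < c" "f \<in> borel_measurable borel"
  shows "(\<integral>x. f x \<partial>lborel) = c ^ DIM('a) * (\<integral>x. f (c *\<^sub>R x) \<partial>lborel)"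
proof -
  have [measurable]: "f \<in> borel_measurable borel" by fact
  have "(\<integral>x. f x \<partial>lborel) = (\<integral>x. f x \<partial>density (distr lborel borel (\<lambda>x. 0 + c *\<^sub>R x)) (\<lambda>_. ennreal (\<bar>c\<bar> ^ DIM('a))))"
    using assms(1) by (subst lborel_affine[of c 0]) (auto simp: ennreal_power)
  also have "\<dots> = (\<integral>x. c ^ DIM('a) * f (c *\<^sub>R x) \<partial>lborel)"
    using assms(1) by (subst integral_density) (auto simp: integral_distr)
  finally show ?thesis by simp
qed

lemma integral_cball_homogeneous:
  fixes f :: "real^3 \<Rightarrow> real"
  assumes "0 < r" "f \<in> borel_measurable borel" "\<And>c x. 0 < c \<Longrightarrow> f (c *\<^sub>R x) = f x"
  shows "(\<integral>x. indicator (cball 0 r) x * f x \<partial>lborel) = r ^ 3 * (\<integral>x. indicator (cball 0 1) x * f x \<partial>lborel)"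
proof -
  have [measurable]: "f \<in> borel_measurable borel" by fact
  have "indicator (cball 0 r) (r *\<^sub>R x) * f (r *\<^sub>R x) = indicator (cball 0 1) x * f x" for x
    using assms(1,3) by (auto simp: indicator_def abs_mult)
  moreover have "(\<lambda>x. indicator (cball 0 r) x * f x) \<in> borel_measurable borel"
    using assms(2) by (intro borel_measurable_times borel_measurable_indicator) auto
  ultimately show ?thesis
    using assms(1) by (subst lborel_integral_scaleR[of r]) auto
qed

lemma C1_bounds_on_cball:
  fixes F :: "real^'n \<Rightarrow> real"
  assumes "0 < R" and diff: "\<And>x. F differentiable (at x)" and cont: "\<And>j. continuous_on UNIV (partial j F)"
  obtains mF M where "\<And>x. x \<in> cball 0 R \<Longrightarrow> \<bar>F x\<bar> \<le> mF" "0 \<le> mF"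
    "\<And>j x. x \<in> cball 0 R \<Longrightarrow> \<bar>partial j F x\<bar> \<le> M" "0 \<le> M"
proof -
  have zero: "0 \<in> cball (0::real^'n) R" using assms(1) by simp
  have bound: "\<exists>b. \<forall>x\<in>cball 0 R. \<bar>f x\<bar> \<le> b" if "continuous_on UNIV f" for f :: "real^'n \<Rightarrow> real"
    by (rule bounded_continuous_bounded[OF bounded_cball that]) (intro exI ballI, assumption)
  have "continuous_on UNIV F"
    by (intro continuous_at_imp_continuous_on ballI differentiable_imp_continuous_within diff)
  from bound[OF this] obtain mF where mF: "\<And>x. x \<in> cball 0 R \<Longrightarrow> \<bar>F x\<bar> \<le> mF" by (elim exE) blast
  have "\<forall>j. \<exists>b. \<forall>x\<in>cball 0 R. \<bar>partial j F x\<bar> \<le> b" by (intro allI bound[OF cont])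
  from choice[OF this] obtain m where m: "\<And>j x. x \<in> cball 0 R \<Longrightarrow> \<bar>partial j F x\<bar> \<le> m j" by blast
  have M: "\<bar>partial j F x\<bar> \<le> Max (range m)" if "x \<in> cball 0 R" for j x
    by (rule order_trans[OF m[OF that]]) (intro Max_ge, auto)
  show ?thesis
    by (rule that[OF mF order_trans[OF abs_ge_zero mF[OF zero]] M order_trans[OF abs_ge_zero M[OF zero]]])
qed

text \<open>
  The integral of the derivative of \<open>F \<rho>\<close> vanishes, where \<open>\<rho>\<close> falls linearly from 1 to 0 in the layer
  \<open>r \<le> |x| \<le> R\<close>. Its gradient there is \<open>- x / (|x| (R - r))\<close>.
\<close>

lemma cutoff_integral_identity:
  fixes F :: "real^3 \<Rightarrow> real"
  assumes diff: "\<And>x. F differentiable (at x)" and cont: "\<And>j. continuous_on UNIV (partial j F)"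
    and r: "0 < r" "r < R"
  shows "(\<integral>x. indicator (cball 0 R) x * (max 0 (min 1 ((R - norm x) / (R - r))) * partial i F x) \<partial>lborel)
       = (\<integral>x. indicator (cball 0 R - cball 0 r) x * (F x * (x $ i / norm x)) \<partial>lborel) / (R - r)"
proof -
  define \<rho> where "\<rho> x = max 0 (min 1 ((R - norm x) / (R - r)))" for x :: "real^3"
  define G where "G x = F x * \<rho> x" for x
  define A where "A x = indicat_real (cball 0 R) x * (\<rho> x * partial i F x)" for x
  define B where "B x = indicat_real (cball 0 R - cball 0 r) x * (F x * (x $ i / norm x))" for x
  have Fc: "continuous_on S F" for S
    by (intro continuous_at_imp_continuous_on ballI differentiable_imp_continuous_within diff)
  have \<rho>01: "0 \<le> \<rho> x" "\<rho> x \<le> 1" for x by (auto simp: \<rho>_def)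
  have \<rho>0: "\<rho> x = 0" if "R \<le> norm x" for x
  proof -
    have "(R - norm x) / (R - r) \<le> 0" using that r by (intro divide_nonpos_pos) auto
    thus ?thesis by (simp add: \<rho>_def)
  qed
  have \<rho>lip: "\<bar>\<rho> x - \<rho> y\<bar> \<le> 1 / (R - r) * norm (x - y)" for x y
  proof -
    have "\<bar>\<rho> x - \<rho> y\<bar> \<le> \<bar>(R - norm x) / (R - r) - (R - norm y) / (R - r)\<bar>"
    proof -
      have "\<bar>max 0 (min 1 a) - max 0 (min 1 b)\<bar> \<le> \<bar>a - b\<bar>" for a b :: real by linarith
      thus ?thesis unfolding \<rho>_def .
    qed
    also have "\<dots> = \<bar>norm y - norm x\<bar> / (R - r)"
      using r by (simp flip: diff_divide_distrib)
    also have "\<dots> \<le> norm (x - y) / (R - r)"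
      using r norm_triangle_ineq3[of x y] by (intro divide_right_mono) (auto simp: abs_minus_commute)
    finally show ?thesis by simp
  qed
  have Rpos: "0 < R" using r by simp
  obtain mF M where mF: "\<And>x. x \<in> cball 0 R \<Longrightarrow> \<bar>F x\<bar> \<le> mF" and mF0: "0 \<le> mF"
    and M: "\<And>j x. x \<in> cball 0 R \<Longrightarrow> \<bar>partial j F x\<bar> \<le> M" and M0: "0 \<le> M"
    using C1_bounds_on_cball[OF Rpos diff cont] by metis
  define L where "L = mF * (1 / (R - r)) + 3 * M"
  have Glip: "\<bar>G x - G y\<bar> \<le> L * norm (x - y)" for x y
  proof -
    have one: "\<bar>G x - G y\<bar> \<le> L * norm (x - y)" if x: "x \<in> cball 0 R" for x y
    proof (cases "y \<in> cball 0 R")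
      case True
      have "G x - G y = F x * (\<rho> x - \<rho> y) + (F x - F y) * \<rho> y" by (simp add: G_def algebra_simps)
      hence "\<bar>G x - G y\<bar> \<le> \<bar>F x\<bar> * \<bar>\<rho> x - \<rho> y\<bar> + \<bar>F x - F y\<bar> * \<bar>\<rho> y\<bar>"
        using abs_triangle_ineq[of "F x * (\<rho> x - \<rho> y)" "(F x - F y) * \<rho> y"] by (simp add: abs_mult)
      also have "\<dots> \<le> mF * (1 / (R - r) * norm (x - y)) + (3 * M * norm (x - y)) * 1"
        using partial_bound_imp_Lipschitz[OF convex_cball diff M x True] \<rho>01[of y] x mF0 M0
        by (intro add_mono mult_mono \<rho>lip mF) auto
      finally show ?thesis by (simp add: L_def algebra_simps)
    next
      case False
      hence "G y = 0" "\<rho> y = 0" using \<rho>0[of y] by (auto simp: G_def)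
      hence "\<bar>G x - G y\<bar> = \<bar>F x\<bar> * \<bar>\<rho> x - \<rho> y\<bar>" by (simp add: G_def abs_mult)
      also have "\<dots> \<le> mF * (1 / (R - r) * norm (x - y))"
        using x mF0 by (intro mult_mono \<rho>lip mF) auto
      also have "\<dots> \<le> L * norm (x - y)" using M0 by (simp add: L_def algebra_simps)
      finally show ?thesis .
    qed
    show ?thesis
    proof (cases "x \<in> cball 0 R \<or> y \<in> cball 0 R")
      case True thus ?thesis using one[of x y] one[of y x] by (auto simp: abs_minus_commute norm_minus_commute)
    next
      case False
      hence "G x = 0" "G y = 0" using \<rho>0[of x] \<rho>0[of y] by (auto simp: G_def)
      moreover have "0 \<le> L" using mF0 M0 r by (simp add: L_def)
      ultimately show ?thesis by simp
    qed
  qed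
  have [measurable]: "F \<in> borel_measurable borel" "partial i F \<in> borel_measurable borel"
    using Fc cont by (auto intro: borel_measurable_continuous_onI)
  have [measurable]: "(\<lambda>x::real^3. x $ i) \<in> borel_measurable borel"
    by (intro borel_measurable_continuous_onI continuous_intros)
  have [measurable]: "\<rho> \<in> borel_measurable borel" unfolding \<rho>_def by measurable
  have [measurable]: "cball (0::real^3) s \<in> sets borel" for s by auto
  have [measurable]: "A \<in> borel_measurable borel" "B \<in> borel_measurable borel"
    unfolding A_def B_def by measurable
  have G: "continuous_on UNIV G"
    unfolding G_def \<rho>_def using r by (intro continuous_intros Fc) auto
  have deriv: "((\<lambda>t. G (x + t *\<^sub>R axis i 1)) has_real_derivative (A x - B x / (R - r))) (at 0)"
    if x: "norm x \<noteq> r" "norm x \<noteq> R" for x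
  proof -
    have F': "(F has_derivative frechet_derivative F (at x)) (at x)"
      using diff by (simp add: frechet_derivative_works)
    have key: ?thesis if "(G has_derivative G') (at x)" "G' (axis i 1) = A x - B x / (R - r)" for G'
      using has_real_derivative_along_axis[of G x i] has_derivative_imp_partial[OF that(1), of i] that
      by (auto simp: differentiable_def)
    consider "norm x < r" | "r < norm x" "norm x < R" | "R < norm x" using x by linarith
    thus ?thesis
    proof cases
      case 1
      have "open {x::real^3. norm x < r}" by (intro open_Collect_less continuous_intros)
      moreover have "F y = G y" if "norm y < r" for y
      proof -
        have "1 \<le> (R - norm y) / (R - r)" using that r by simp
        thus ?thesis by (simp add: G_def \<rho>_def)
      qed
      ultimately have "(G has_derivative frechet_derivative F (at x)) (at x)"
        using 1 by (intro has_derivative_transform_within_open[OF F', of "{x. norm x < r}"]) auto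
      moreover have "1 \<le> (R - norm x) / (R - r)" using 1 r by simp
      hence "\<rho> x = 1" by (simp add: \<rho>_def)
      ultimately show ?thesis
        using 1 r by (intro key) (auto simp: A_def B_def partial_def)
    next
      case 2
      have op: "open {x::real^3. r < norm x \<and> norm x < R}"
        by (intro open_Collect_conj open_Collect_less continuous_intros)
      have \<rho>eq: "\<rho> y = (R - norm y) / (R - r)" if "r < norm y \<and> norm y < R" for y
        using that r by (auto simp: \<rho>_def max_def min_def)
      have "x \<noteq> 0" using 2 r by auto
      hence nd: "(norm has_derivative (\<lambda>v. v \<bullet> sgn x)) (at x)"
        using has_derivative_norm[OF \<open>x \<noteq> 0\<close>] by (simp add: inner_commute)
      have "((\<lambda>y. (R - norm y) / (R - r)) has_derivative (\<lambda>v. (0 - v \<bullet> sgn x) / (R - r))) (at x)"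
        by (intro bounded_linear.has_derivative[OF bounded_linear_divide] has_derivative_diff has_derivative_const nd)
      from has_derivative_mult[OF F' this] have prod: "((\<lambda>y. F y * ((R - norm y) / (R - r))) has_derivative
          (\<lambda>v. F x * ((0 - v \<bullet> sgn x) / (R - r)) + frechet_derivative F (at x) v * ((R - norm x) / (R - r)))) (at x)"
        .
      have Gd: "(G has_derivative
          (\<lambda>v. F x * ((0 - v \<bullet> sgn x) / (R - r)) + frechet_derivative F (at x) v * ((R - norm x) / (R - r)))) (at x)"
      proof (rule has_derivative_transform_within_open[OF prod op])
        show "x \<in> {x. r < norm x \<and> norm x < R}" using 2 by simp
        show "F y * ((R - norm y) / (R - r)) = G y" if "y \<in> {x. r < norm x \<and> norm x < R}" for y
          unfolding G_def using \<rho>eq[of y] that by simp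
      qed
      have ax: "axis i 1 \<bullet> sgn x = x $ i / norm x"
        by (simp add: inner_axis' sgn_div_norm divide_inverse mult.commute)
      have AB: "A x = \<rho> x * partial i F x" "B x = F x * (x $ i / norm x)"
        using 2 by (auto simp: A_def B_def)
      have alg: "f * ((0 - t) / d) + p * q = q * p - (f * t) / d" for f t d p q :: real
        by (simp add: algebra_simps)
      have \<rho>x: "\<rho> x = (R - norm x) / (R - r)" using 2 by (intro \<rho>eq) simp
      show ?thesis
        by (rule key[OF Gd]) (simp only: ax AB \<rho>x partial_def alg)
    next
      case 3
      have "open {x::real^3. R < norm x}" by (intro open_Collect_less continuous_intros)
      hence "(G has_derivative (\<lambda>v. 0)) (at x)"
        using 3 \<rho>0 by (intro has_derivative_transform_within_open[OF has_derivative_const, of "{x. R < norm x}"])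
                       (auto simp: G_def)
      thus ?thesis using 3 r by (intro key) (auto simp: A_def B_def)
    qed
  qed
  have null: "AE x::real^3 in lborel. norm x \<noteq> s" for s
  proof -
    have "sphere (0::real^3) s \<in> null_sets lebesgue"
      using negligible_sphere[of 0 s] by (simp add: negligible_iff_null_sets)
    hence "sphere (0::real^3) s \<in> null_sets lborel"
      by (subst (asm) null_sets_completion_iff) auto
    from AE_not_in[OF this] show ?thesis by simp
  qed
  have "AE x in lborel. ((\<lambda>t. G (x + t *\<^sub>R axis i 1)) has_real_derivative (A x - B x / (R - r))) (at 0)"
    using null[of r] null[of R] by eventually_elim (use deriv in auto)
  moreover have "\<bar>G (x + t *\<^sub>R axis i 1) - G x\<bar> \<le> L * \<bar>t\<bar>" for x t
    using Glip[of "x + t *\<^sub>R axis i 1" x] by simp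
  moreover have "G x = 0" if "R < norm x" for x using \<rho>0[of x] that by (simp add: G_def)
  ultimately have I: "(\<integral>x. A x - B x / (R - r) \<partial>lborel) = 0"
    by (intro integral_line_derivative_eq_0[OF G, where R = R]) auto
  have ind: "integrable lborel (\<lambda>x. indicat_real (cball (0::real^3) R) x)"
    by (intro integrable_real_indicator) (auto simp: emeasure_lborel_cball_finite[unfolded infinity_ennreal_def])
  have "integrable lborel A"
  proof (rule Bochner_Integration.integrable_bound)
    show "integrable lborel (\<lambda>x. M * indicat_real (cball (0::real^3) R) x)" using ind by simp
    show "AE x in lborel. norm (A x) \<le> norm (M * indicat_real (cball 0 R) x)"
    proof (intro AE_I2)
      fix x
      have "\<rho> x * \<bar>partial i F x\<bar> \<le> 1 * M" if "x \<in> cball 0 R"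
        using that M[OF that] \<rho>01 by (intro mult_mono) auto
      thus "norm (A x) \<le> norm (M * indicat_real (cball 0 R) x)"
        using M0 \<rho>01 by (auto simp: A_def indicator_def abs_mult)
    qed
  qed measurable
  moreover have "integrable lborel B"
  proof (rule Bochner_Integration.integrable_bound)
    show "integrable lborel (\<lambda>x. mF * indicat_real (cball (0::real^3) R) x)" using ind by simp
    show "AE x in lborel. norm (B x) \<le> norm (mF * indicat_real (cball 0 R) x)"
    proof (intro AE_I2)
      fix x :: "real^3"
      have "\<bar>x $ i / norm x\<bar> \<le> 1" using component_le_norm_cart[of x i] by (simp add: divide_le_eq)
      hence "\<bar>F x\<bar> * \<bar>x $ i / norm x\<bar> \<le> mF * 1" if "x \<in> cball 0 R"
        using that mF[OF that] mF0 by (intro mult_mono) auto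
      thus "norm (B x) \<le> norm (mF * indicat_real (cball 0 R) x)"
        using mF0 by (auto simp: B_def indicator_def abs_mult)
    qed
  qed measurable
  ultimately have "(\<integral>x. A x \<partial>lborel) = (\<integral>x. B x \<partial>lborel) / (R - r)"
    using I by (subst (asm) Bochner_Integration.integral_diff) auto
  thus ?thesis by (simp add: A_def B_def \<rho>_def)
qed


lemma cutoff_radii:
  fixes R :: real
  assumes "0 < R"
  defines "r \<equiv> \<lambda>k::nat. R * (1 - 1 / (real k + 2))"
  shows "0 < r k" "r k < R" "r \<longlonglongrightarrow> R"
proof -
  have "0 < 1 - 1 / (real k + 2)" "1 - 1 / (real k + 2) < 1" by (simp_all add: field_simps)
  thus "0 < r k" "r k < R" unfolding r_def using assms(1)
    by (simp_all only: zero_less_mult_iff mult_less_cancel_left1) auto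
  have "(\<lambda>k. 1 / (real k + 2)) \<longlonglongrightarrow> 0"
    using LIMSEQ_ignore_initial_segment[OF lim_1_over_n[where 'a = real], of 2] by (simp add: add.commute)
  hence "(\<lambda>k. R * (1 - 1 / (real k + 2))) \<longlonglongrightarrow> R * (1 - 0)"
    by (intro tendsto_intros)
  thus "r \<longlonglongrightarrow> R" by (simp add: r_def)
qed

text \<open>
  In \<open>cutoff_integral_identity\<close> let \<open>r\<close> tend to \<open>R\<close>. In the thin layer \<open>F\<close> may be replaced by its values on
  the sphere, extended to be homogeneous of degree 0, and a function with this homogeneity
  is integrated over the layer by scaling. The right-hand side is the
  integral of \<open>F x\<^sub>i / R\<close> with respect to \<open>sphere_measure R\<close>, unfolded.
\<close>

theorem divergence_ball:
  fixes F :: "real^3 \<Rightarrow> real"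
  assumes diff: "\<And>x. F differentiable (at x)" and cont: "\<And>j. continuous_on UNIV (partial j F)"
    and R: "0 < R"
  shows "(\<integral>x. indicator (ball 0 R) x * partial i F x \<partial>lborel)
       = 3 / R * (\<integral>x. indicator (cball 0 R) x * (F ((R / norm x) *\<^sub>R x) * (x $ i / norm x)) \<partial>lborel)"
proof -
  define r where "r k = R * (1 - 1 / (real k + 2))" for k :: nat
  note r = cutoff_radii[OF R, folded r_def]
  define f where "f x = F ((R / norm x) *\<^sub>R x) * (x $ i / norm x)" for x
  define S where "S k = cball (0::real^3) R - cball 0 (r k)" for k
  define W where "W = (\<integral>x. indicator (cball 0 1) x * f x \<partial>lborel)"
  define v where "v = (\<integral>x. indicat_real (cball (0::real^3) 1) x \<partial>lborel)"
  have Fc: "continuous_on T F" for T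
    by (intro continuous_at_imp_continuous_on ballI differentiable_imp_continuous_within diff)
  obtain mF M where mF: "\<And>x. x \<in> cball 0 R \<Longrightarrow> \<bar>F x\<bar> \<le> mF" and mF0: "0 \<le> mF"
    and M: "\<And>j x. x \<in> cball 0 R \<Longrightarrow> \<bar>partial j F x\<bar> \<le> M" and M0: "0 \<le> M"
    using C1_bounds_on_cball[OF R diff cont] by metis
  have [measurable]: "F \<in> borel_measurable borel" "partial i F \<in> borel_measurable borel"
    using Fc cont by (auto intro: borel_measurable_continuous_onI)
  have comp[measurable]: "(\<lambda>x::real^3. x $ i) \<in> borel_measurable borel"
    by (intro borel_measurable_continuous_onI continuous_intros)
  have [measurable]: "cball (0::real^3) s \<in> sets borel" "ball (0::real^3) s \<in> sets borel" for s by auto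
  have [measurable]: "S k \<in> sets borel" for k unfolding S_def by measurable
  have fm[measurable]: "f \<in> borel_measurable borel" unfolding f_def by measurable
  have cint: "integrable lborel (\<lambda>x. indicat_real (cball (0::real^3) s) x)" for s
    by (intro integrable_real_indicator) (auto simp: emeasure_lborel_cball_finite[unfolded infinity_ennreal_def])
  have dir: "\<bar>x $ i / norm x\<bar> \<le> 1" for x :: "real^3"
    using component_le_norm_cart[of x i] by (simp add: divide_le_eq)
  have scaled: "(R / norm x) *\<^sub>R x \<in> cball 0 R" for x :: "real^3" using R by simp
  have fbound: "\<bar>f x\<bar> \<le> mF" for x
    using mult_mono[OF mF[OF scaled[of x]] dir[of x]] mF0 by (simp add: f_def abs_mult)
  have fint: "integrable lborel (\<lambda>x. indicator (cball 0 s) x * f x)" for s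
  proof (rule Bochner_Integration.integrable_bound)
    show "integrable lborel (\<lambda>x. mF * indicat_real (cball (0::real^3) s) x)" using cint by simp
    show "AE x in lborel. norm (indicator (cball 0 s) x * f x) \<le> norm (mF * indicat_real (cball 0 s) x)"
      using fbound mF0 by (auto simp: indicator_def)
  qed measurable
  have hom: "(\<integral>x. indicator (cball 0 s) x * f x \<partial>lborel) = s ^ 3 * W" if "0 < s" for s
    unfolding W_def using R that
    by (intro integral_cball_homogeneous fm) (auto simp: f_def)
  have vol: "(\<integral>x. indicat_real (cball (0::real^3) s) x \<partial>lborel) = s ^ 3 * v" if "0 < s" for s
    unfolding v_def using integral_cball_homogeneous[OF that, of "\<lambda>x. 1"] by simp
  have Sind: "indicator (S k) x = indicat_real (cball 0 R) x - indicator (cball 0 (r k)) x" for k x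
    using r(2)[of k] by (auto simp: S_def indicator_def)
  have fS: "(\<integral>x. indicator (S k) x * f x \<partial>lborel) = (R ^ 3 - r k ^ 3) * W" for k
    using hom[OF R] hom[OF r(1)[of k]] by (simp add: Sind left_diff_distrib fint)
  have volS: "(\<integral>x. indicat_real (S k) x \<partial>lborel) = (R ^ 3 - r k ^ 3) * v" for k
    using vol[OF R] vol[OF r(1)[of k]] by (simp add: Sind left_diff_distrib cint)
  have Sint: "integrable lborel (\<lambda>x. indicat_real (S k) x)" for k
    unfolding Sind by (intro Bochner_Integration.integrable_diff cint)
  have Sfint: "integrable lborel (\<lambda>x. indicator (S k) x * f x)" for k
    unfolding Sind left_diff_distrib by (intro Bochner_Integration.integrable_diff fint)
  have quot: "(R ^ 3 - r k ^ 3) / (R - r k) = R\<^sup>2 + R * r k + (r k)\<^sup>2" for k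
    using r(2)[of k] by (simp add: divide_eq_eq power2_eq_square power3_eq_cube algebra_simps)
  define J where "J k = (\<integral>x. indicator (S k) x * (F x * (x $ i / norm x)) \<partial>lborel) / (R - r k)" for k
  have SFint: "integrable lborel (\<lambda>x. indicator (S k) x * (F x * (x $ i / norm x)))" for k
  proof (rule Bochner_Integration.integrable_bound)
    show "integrable lborel (\<lambda>x. mF * indicat_real (cball (0::real^3) R) x)" using cint by simp
    show "AE x in lborel. norm (indicator (S k) x * (F x * (x $ i / norm x))) \<le> norm (mF * indicat_real (cball 0 R) x)"
    proof (intro AE_I2)
      fix x :: "real^3"
      have "\<bar>F x\<bar> * \<bar>x $ i / norm x\<bar> \<le> mF * 1" if "x \<in> cball 0 R"
        using that mF[OF that] mF0 dir by (intro mult_mono) auto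
      thus "norm (indicator (S k) x * (F x * (x $ i / norm x))) \<le> norm (mF * indicat_real (cball 0 R) x)"
        using mF0 by (auto simp: S_def indicator_def abs_mult)
    qed
  qed measurable
  have close: "\<bar>J k - (R\<^sup>2 + R * r k + (r k)\<^sup>2) * W\<bar> \<le> 3 * M * ((R ^ 3 - r k ^ 3) * v)" for k
  proof -
    have pw: "\<bar>indicator (S k) x * (F x * (x $ i / norm x)) - indicator (S k) x * f x\<bar>
        \<le> (3 * M * (R - r k)) * indicator (S k) x" for x
    proof (cases "x \<in> S k")
      case True
      hence x: "r k < norm x" "norm x \<le> R" by (auto simp: S_def)
      with r(1)[of k] have x0: "0 < norm x" by linarith
      have "x - (R / norm x) *\<^sub>R x = (1 - R / norm x) *\<^sub>R x" by (simp add: scaleR_left_diff_distrib)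
      hence "norm (x - (R / norm x) *\<^sub>R x) = \<bar>1 - R / norm x\<bar> * norm x" by simp
      also have "\<dots> = R - norm x" using x x0 by (simp add: abs_if field_simps)
      finally have n: "norm (x - (R / norm x) *\<^sub>R x) \<le> R - r k" using x by simp
      have "\<bar>F x - F ((R / norm x) *\<^sub>R x)\<bar> \<le> 3 * M * norm (x - (R / norm x) *\<^sub>R x)"
        using partial_bound_imp_Lipschitz[OF convex_cball diff M _ scaled, of x] x by simp
      also have "\<dots> \<le> 3 * M * (R - r k)" using n M0 by (intro mult_left_mono) auto
      finally have "\<bar>F x - F ((R / norm x) *\<^sub>R x)\<bar> * \<bar>x $ i / norm x\<bar> \<le> 3 * M * (R - r k) * 1"
        using dir[of x] by (intro mult_mono) auto
      moreover have "F x * (x $ i / norm x) - f x = (F x - F ((R / norm x) *\<^sub>R x)) * (x $ i / norm x)"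
        unfolding f_def by (rule left_diff_distrib[symmetric])
      ultimately show ?thesis using True by (simp add: abs_mult)
    qed simp
    have "\<bar>(\<integral>x. indicator (S k) x * (F x * (x $ i / norm x)) - indicator (S k) x * f x \<partial>lborel)\<bar>
        \<le> (\<integral>x. (3 * M * (R - r k)) * indicator (S k) x \<partial>lborel)"
      by (rule order_trans[OF integral_abs_bound])
         (intro integral_mono integrable_abs Bochner_Integration.integrable_diff SFint Sfint
            integrable_mult_right Sint pw)
    hence "\<bar>J k * (R - r k) - (R ^ 3 - r k ^ 3) * W\<bar> \<le> 3 * M * (R - r k) * ((R ^ 3 - r k ^ 3) * v)"
      using r(2)[of k]
      unfolding Bochner_Integration.integral_diff[OF SFint Sfint] integral_mult_right_zero fS volS J_def by simp
    moreover have "(R ^ 3 - r k ^ 3) * W = (R\<^sup>2 + R * r k + (r k)\<^sup>2) * W * (R - r k)"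
      by (simp add: power2_eq_square power3_eq_cube algebra_simps)
    moreover have "\<bar>J k - (R\<^sup>2 + R * r k + (r k)\<^sup>2) * W\<bar> * (R - r k)
        = \<bar>J k * (R - r k) - (R\<^sup>2 + R * r k + (r k)\<^sup>2) * W * (R - r k)\<bar>"
      using r(2)[of k] unfolding left_diff_distrib[symmetric] abs_mult by simp
    ultimately have "\<bar>J k - (R\<^sup>2 + R * r k + (r k)\<^sup>2) * W\<bar> * (R - r k)
        \<le> (3 * M * ((R ^ 3 - r k ^ 3) * v)) * (R - r k)"
      by (simp only: mult_ac)
    thus ?thesis using r(2)[of k] by simp
  qed
  have "(\<lambda>k. J k - (R\<^sup>2 + R * r k + (r k)\<^sup>2) * W) \<longlonglongrightarrow> 0"
  proof (rule Lim_null_comparison)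
    show "\<forall>\<^sub>F k in sequentially. norm (J k - (R\<^sup>2 + R * r k + (r k)\<^sup>2) * W) \<le> 3 * M * ((R ^ 3 - r k ^ 3) * v)"
      using close by simp
    have "(\<lambda>k. 3 * M * ((R ^ 3 - r k ^ 3) * v)) \<longlonglongrightarrow> 3 * M * ((R ^ 3 - R ^ 3) * v)"
      by (intro tendsto_intros r(3))
    thus "(\<lambda>k. 3 * M * ((R ^ 3 - r k ^ 3) * v)) \<longlonglongrightarrow> 0" by simp
  qed
  moreover have "(\<lambda>k. (R\<^sup>2 + R * r k + (r k)\<^sup>2) * W) \<longlonglongrightarrow> (R\<^sup>2 + R * R + R\<^sup>2) * W"
    by (intro tendsto_intros r(3))
  ultimately have "(\<lambda>k. (J k - (R\<^sup>2 + R * r k + (r k)\<^sup>2) * W) + (R\<^sup>2 + R * r k + (r k)\<^sup>2) * W)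
      \<longlonglongrightarrow> 0 + (R\<^sup>2 + R * R + R\<^sup>2) * W" by (rule tendsto_add)
  hence J1: "J \<longlonglongrightarrow> 3 * R\<^sup>2 * W" by (simp add: power2_eq_square)
  have "J \<longlonglongrightarrow> (\<integral>x. indicator (ball 0 R) x * partial i F x \<partial>lborel)"
  proof -
    have "(\<lambda>k. \<integral>x. indicator (cball 0 R) x * (max 0 (min 1 ((R - norm x) / (R - r k))) * partial i F x) \<partial>lborel)
        \<longlonglongrightarrow> (\<integral>x. indicator (ball 0 R) x * partial i F x \<partial>lborel)"
    proof (rule integral_dominated_convergence[where w = "\<lambda>x. M * indicat_real (cball 0 R) x"])
      show "integrable lborel (\<lambda>x. M * indicat_real (cball (0::real^3) R) x)" using cint by simp
      show "AE x in lborel. (\<lambda>k. indicator (cball 0 R) x * (max 0 (min 1 ((R - norm x) / (R - r k))) * partial i F x))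
          \<longlonglongrightarrow> indicator (ball 0 R) x * partial i F x"
      proof (intro AE_I2)
        fix x :: "real^3"
        show "(\<lambda>k. indicator (cball 0 R) x * (max 0 (min 1 ((R - norm x) / (R - r k))) * partial i F x))
          \<longlonglongrightarrow> indicator (ball 0 R) x * partial i F x"
        proof (cases "norm x < R")
          case True
          have "\<forall>\<^sub>F k in sequentially. norm x < r k" by (rule order_tendstoD(1)[OF r(3) True])
          hence "\<forall>\<^sub>F k in sequentially. indicator (ball 0 R) x * partial i F x
              = indicator (cball 0 R) x * (max 0 (min 1 ((R - norm x) / (R - r k))) * partial i F x)"
          proof eventually_elim
            case (elim k)
            hence "1 \<le> (R - norm x) / (R - r k)" using r(2)[of k] by simp
            thus ?case using True by simp
          qed
          thus ?thesis by (rule Lim_transform_eventually[OF tendsto_const])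
        next
          case False
          have "indicator (cball 0 R) x * (max 0 (min 1 ((R - norm x) / (R - r k))) * partial i F x) = 0" for k
            using False by (cases "norm x = R") auto
          hence "(\<lambda>k. indicator (cball 0 R) x * (max 0 (min 1 ((R - norm x) / (R - r k))) * partial i F x)) = (\<lambda>k. 0)"
            by (rule ext)
          thus ?thesis using False by (simp only:) simp
        qed
      qed
      show "AE x in lborel. norm (indicator (cball 0 R) x * (max 0 (min 1 ((R - norm x) / (R - r k))) * partial i F x))
          \<le> M * indicat_real (cball 0 R) x" for k
      proof (intro AE_I2)
        fix x
        have "\<bar>max 0 (min 1 ((R - norm x) / (R - r k)))\<bar> * \<bar>partial i F x\<bar> \<le> 1 * M" if "x \<in> cball 0 R"
          using that M[OF that] by (intro mult_mono) auto
        thus "norm (indicator (cball 0 R) x * (max 0 (min 1 ((R - norm x) / (R - r k))) * partial i F x))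
          \<le> M * indicat_real (cball 0 R) x"
          by (auto simp: indicator_def abs_mult)
      qed
    qed measurable
    thus ?thesis
      unfolding J_def S_def by (subst (asm) cutoff_integral_identity[OF diff cont r(1) r(2)]) simp
  qed
  from LIMSEQ_unique[OF this J1]
  have "(\<integral>x. indicator (ball 0 R) x * partial i F x \<partial>lborel) = 3 * R\<^sup>2 * W" .
  also have "\<dots> = 3 / R * (\<integral>x. indicator (cball 0 R) x * f x \<partial>lborel)"
    using R by (simp add: hom power2_eq_square power3_eq_cube)
  finally show ?thesis by (simp add: f_def)
qed


section \<open>Surface measure and traces\<close>

text \<open>
  In this form integrals against the surface measure reduce to volume integrals over the ball.
\<close>

lemma sphere_measure_eq_density:
  "sphere_measure R = density (distr (restrict_space lborel (cball 0 R - {0})) borel (\<lambda>x. (R / norm x) *\<^sub>R x)) (\<lambda>_. ennreal (3 / R))"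
  unfolding sphere_measure_def
  by (rule measure_eqI) (auto simp: emeasure_density_const)

lemma radial_projection_measurable:
  "(\<lambda>x::real^3. (R / norm x) *\<^sub>R x) \<in> restrict_space lborel (cball 0 R - {0}) \<rightarrow>\<^sub>M borel"
  by (rule measurable_restrict_space1) measurable

lemma integral_sphere_measure:
  fixes g :: "real^3 \<Rightarrow> real"
  assumes "0 < R" and g: "g \<in> borel_measurable borel"
  shows "(\<integral>x. g x \<partial>sphere_measure R) = 3 / R * (\<integral>x. indicator (cball 0 R) x * g ((R / norm x) *\<^sub>R x) \<partial>lborel)"
proof -
  have meas: "(\<lambda>x. indicator (cball 0 R - {0}) x * g ((R / norm x) *\<^sub>R x)) \<in> borel_measurable borel"
             "(\<lambda>x. indicator (cball 0 R) x * g ((R / norm x) *\<^sub>R x)) \<in> borel_measurable borel"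
    using g by (auto intro!: borel_measurable_times borel_measurable_indicator measurable_compose[OF _ g])
  have "(\<integral>x. g x \<partial>sphere_measure R)
      = (\<integral>x. 3 / R * g x \<partial>distr (restrict_space lborel (cball 0 R - {0})) borel (\<lambda>x. (R / norm x) *\<^sub>R x))"
    unfolding sphere_measure_eq_density using assms by (subst integral_density) auto
  also have "\<dots> = (\<integral>x. 3 / R * g ((R / norm x) *\<^sub>R x) \<partial>restrict_space lborel (cball 0 R - {0}))"
    using g by (subst integral_distr[OF radial_projection_measurable]) auto
  also have "\<dots> = 3 / R * (\<integral>x. indicator (cball 0 R - {0}) x * g ((R / norm x) *\<^sub>R x) \<partial>lborel)"
    by (subst integral_restrict_space)
       (auto simp del: times_divide_eq_left simp: mult.left_commute[of _ "3 / R"])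
  also have "(\<integral>x. indicator (cball 0 R - {0}) x * g ((R / norm x) *\<^sub>R x) \<partial>lborel)
      = (\<integral>x. indicator (cball 0 R) x * g ((R / norm x) *\<^sub>R x) \<partial>lborel)"
  proof (rule integral_cong_AE)
    have "AE x::real^3 in lborel. x \<noteq> 0" by (rule AE_lborel_singleton)
    thus "AE x in lborel. indicator (cball 0 R - {0}) x * g ((R / norm x) *\<^sub>R x)
        = indicator (cball 0 R) x * g ((R / norm x) *\<^sub>R x)"
      by eventually_elim (auto simp: indicator_def)
  qed (use meas in auto)
  finally show ?thesis .
qed

lemma finite_measure_sphere_measure: "finite_measure (sphere_measure R)"
proof
  have "emeasure lborel (cball (0::real^3) R - {0}) \<le> emeasure lborel (cball (0::real^3) R)"
    by (intro emeasure_mono) auto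
  also have "\<dots> < \<infinity>" by (rule emeasure_lborel_cball_finite)
  finally have fin: "emeasure lborel (cball (0::real^3) R - {0}) \<noteq> \<infinity>" by simp
  have "space (sphere_measure R) = UNIV"
    using sets_eq_imp_space_eq[OF sets_sphere_measure] by simp
  moreover have "emeasure (distr (restrict_space lborel (cball 0 R - {0})) borel (\<lambda>x::real^3. (R / norm x) *\<^sub>R x)) UNIV
      = emeasure lborel (cball (0::real^3) R - {0})"
    using radial_projection_measurable[of R]
    by (subst emeasure_distr) (auto simp: emeasure_restrict_space space_restrict_space)
  ultimately show "emeasure (sphere_measure R) (space (sphere_measure R)) \<noteq> \<infinity>"
    using fin by (simp add: sphere_measure_def ennreal_mult_eq_top_iff)
qed

lemma AE_sphere_measure_norm:
  assumes "0 < R"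
  shows "AE x in sphere_measure R. norm x = R"
proof -
  have "AE x in distr (restrict_space lborel (cball 0 R - {0})) borel (\<lambda>x::real^3. (R / norm x) *\<^sub>R x). norm x = R"
    using assms by (subst AE_distr_iff[OF radial_projection_measurable])
      (auto simp: AE_restrict_space_iff)
  thus ?thesis unfolding sphere_measure_eq_density by (subst AE_density) auto
qed

lemma sphere_measure_le_shell_boundary_measure:
  "sphere_measure R2 \<le> shell_boundary_measure R1 R2"
  by (subst le_measure) (auto simp: emeasure_shell_boundary_measure)

lemma L2_norm_nonneg: "0 \<le> L2_norm M f"
  by (simp add: L2_norm_def)

lemma L2_mono_measure:
  fixes f :: "'a \<Rightarrow> real"
  assumes "M \<le> N" "sets M = sets N" "f \<in> L2 N"
  shows "f \<in> L2 M" "L2_norm M f \<le> L2_norm N f"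
proof -
  have fN: "f \<in> borel_measurable N" "integrable N (\<lambda>x. (f x)\<^sup>2)" using assms(3) by (auto simp: L2_def)
  hence [measurable]: "f \<in> borel_measurable M" using measurable_cong_sets[OF assms(2) refl] by blast
  have nn: "(\<integral>\<^sup>+ x. ennreal ((f x)\<^sup>2) \<partial>M) \<le> (\<integral>\<^sup>+ x. ennreal ((f x)\<^sup>2) \<partial>N)"
    by (rule nn_integral_mono_measure[OF assms(2,1)])
  also have fin: "\<dots> < \<infinity>" using fN(2) by (simp add: nn_integral_eq_integral)
  finally have "(\<integral>\<^sup>+ x. ennreal (norm ((f x)\<^sup>2)) \<partial>M) < \<infinity>" by simp
  hence iM: "integrable M (\<lambda>x. (f x)\<^sup>2)" by (intro integrableI_bounded) measurable
  thus "f \<in> L2 M" by (simp add: L2_def)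
  have "ennreal (\<integral>x. (f x)\<^sup>2 \<partial>M) \<le> ennreal (\<integral>x. (f x)\<^sup>2 \<partial>N)"
    using nn iM fN(2) by (simp add: nn_integral_eq_integral)
  thus "L2_norm M f \<le> L2_norm N f" by (simp add: L2_norm_def)
qed

text \<open>
  The bound \<open>|f| \<le> f\<^sup>2 / t + t\<close> is used with \<open>t\<close> slightly above the norm of \<open>f\<close>, so that \<open>t > 0\<close>.
\<close>

lemma L2_tendsto_0_imp_integral_tendsto_0:
  fixes f :: "nat \<Rightarrow> 'a \<Rightarrow> real"
  assumes fin: "finite_measure M" and f: "\<And>n. f n \<in> L2 M" and lim: "(\<lambda>n. L2_norm M (f n)) \<longlonglongrightarrow> 0"
    and b: "b \<in> borel_measurable M" "AE x in M. \<bar>b x\<bar> \<le> B"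
  shows "(\<lambda>n. \<integral>x. f n x * b x \<partial>M) \<longlonglongrightarrow> 0"
proof -
  interpret finite_measure M by fact
  have fm: "f n \<in> borel_measurable M" "integrable M (\<lambda>x. (f n x)\<^sup>2)" for n using f by (auto simp: L2_def)
  define t where "t n = L2_norm M (f n) + 1 / real (Suc n)" for n
  have t0: "0 < t n" for n
    unfolding t_def by (intro add_nonneg_pos) (auto simp: L2_norm_def)
  define \<mu> where "\<mu> = measure M (space M)"
  have est: "\<bar>\<integral>x. f n x * b x \<partial>M\<bar> \<le> \<bar>B\<bar> * (t n * (1 + \<mu>))" for n
  proof -
    have ib: "integrable M (\<lambda>x. (f n x)\<^sup>2 / t n + t n)" using fm by simp
    have pt: "\<bar>f n x\<bar> \<le> (f n x)\<^sup>2 / t n + t n" for x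
    proof (cases "\<bar>f n x\<bar> \<le> t n")
      case True thus ?thesis using t0[of n] by (simp add: add_increasing)
    next
      case False
      hence "\<bar>f n x\<bar> * t n \<le> \<bar>f n x\<bar> * \<bar>f n x\<bar>" by (intro mult_left_mono) auto
      hence "\<bar>f n x\<bar> \<le> (f n x)\<^sup>2 / t n" using t0[of n] by (simp add: pos_le_divide_eq power2_eq_square)
      thus ?thesis using t0[of n] by linarith
    qed
    have bd: "AE x in M. \<bar>f n x * b x\<bar> \<le> \<bar>B\<bar> * ((f n x)\<^sup>2 / t n + t n)"
      using b(2)
    proof eventually_elim
      case (elim x)
      have "\<bar>f n x\<bar> * \<bar>b x\<bar> \<le> ((f n x)\<^sup>2 / t n + t n) * \<bar>B\<bar>"
        using pt[of x] elim t0[of n] by (intro mult_mono) auto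
      thus ?case by (simp add: abs_mult mult.commute)
    qed
    have i: "integrable M (\<lambda>x. f n x * b x)"
    proof (rule Bochner_Integration.integrable_bound)
      show "integrable M (\<lambda>x. \<bar>B\<bar> * ((f n x)\<^sup>2 / t n + t n))" using ib by (rule integrable_mult_right)
      show "(\<lambda>x. f n x * b x) \<in> borel_measurable M" using fm b by (intro borel_measurable_times)
      show "AE x in M. norm (f n x * b x) \<le> norm (\<bar>B\<bar> * ((f n x)\<^sup>2 / t n + t n))"
        using bd by eventually_elim simp
    qed
    have "\<bar>\<integral>x. f n x * b x \<partial>M\<bar> \<le> (\<integral>x. \<bar>f n x * b x\<bar> \<partial>M)" by (rule integral_abs_bound)
    also have "\<dots> \<le> (\<integral>x. \<bar>B\<bar> * ((f n x)\<^sup>2 / t n + t n) \<partial>M)"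
      by (rule integral_mono_AE[OF integrable_abs[OF i] integrable_mult_right[OF ib] bd])
    also have "\<dots> = \<bar>B\<bar> * ((\<integral>x. (f n x)\<^sup>2 \<partial>M) / t n + t n * \<mu>)"
      using fm by (simp add: \<mu>_def mult.commute)
    also have "\<dots> \<le> \<bar>B\<bar> * (t n * (1 + \<mu>))"
    proof (intro mult_left_mono)
      have "(\<integral>x. (f n x)\<^sup>2 \<partial>M) = (L2_norm M (f n))\<^sup>2" by (simp add: L2_norm_def)
      also have "\<dots> \<le> (t n)\<^sup>2" by (intro power_mono) (auto simp: t_def L2_norm_def)
      finally have "(\<integral>x. (f n x)\<^sup>2 \<partial>M) / t n \<le> t n"
        using t0[of n] by (simp add: pos_divide_le_eq power2_eq_square)
      thus "(\<integral>x. (f n x)\<^sup>2 \<partial>M) / t n + t n * \<mu> \<le> t n * (1 + \<mu>)" by (simp add: distrib_left)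
    qed simp
    finally show ?thesis .
  qed
  have "t \<longlonglongrightarrow> 0 + 0"
    unfolding t_def by (intro tendsto_add lim LIMSEQ_Suc[OF lim_1_over_n])
  hence "(\<lambda>n. \<bar>B\<bar> * (t n * (1 + \<mu>))) \<longlonglongrightarrow> \<bar>B\<bar> * (0 * (1 + \<mu>))"
    by (intro tendsto_intros) simp
  hence z: "(\<lambda>n. \<bar>B\<bar> * (t n * (1 + \<mu>))) \<longlonglongrightarrow> 0" by simp
  show ?thesis
    by (rule Lim_null_comparison[OF _ z]) (use est in simp)
qed

section \<open>The flux through the shell\<close>

lemma open_shell: "open (shell R1 R2)"
  unfolding shell_def by (intro open_Collect_conj open_Collect_less continuous_intros)

lemma bounded_shell: "bounded (shell R1 R2)"
  by (rule boundedI[of _ R2]) (auto simp: shell_def)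

lemma lmeasurable_shell: "shell R1 R2 \<in> lmeasurable"
  by (intro bounded_set_imp_lmeasurable bounded_shell) (use open_shell in auto)

lemma sets_shell: "shell R1 R2 \<in> sets lebesgue"
  using open_shell by auto

lemma smooth_radial: "smooth_real h \<Longrightarrow> smooth (\<lambda>x. h ((norm x)\<^sup>2))"
  by (rule smooth_compose_real[OF _ smooth_norm_sq])

lemma partial_radial:
  assumes "smooth_real h"
  shows "partial j (\<lambda>x. h ((norm x)\<^sup>2)) x = 2 * x $ j * deriv h ((norm x)\<^sup>2)"
  using partial_compose[OF norm_sq_differentiable smooth_real_has_deriv[OF assms], of j x]
  by (simp add: partial_norm_sq)

lemma normal_component_sphere:
  assumes "0 < R"
  shows "(\<lambda>x. x $ i / R) \<in> borel_measurable (sphere_measure R)"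
    and "AE x in sphere_measure R. \<bar>x $ i / R\<bar> \<le> 1"
    and "(\<lambda>x. x $ i / R) \<in> L2 (sphere_measure R)"
proof -
  have "(\<lambda>x::real^3. x $ i) \<in> borel_measurable (sphere_measure R)"
    using smooth_borel_measurable[OF smooth_component[of i]] measurable_cong_sets[OF sets_sphere_measure refl] by blast
  thus meas: "(\<lambda>x. x $ i / R) \<in> borel_measurable (sphere_measure R)" by simp
  show bound: "AE x in sphere_measure R. \<bar>x $ i / R\<bar> \<le> 1"
    using AE_sphere_measure_norm[OF assms]
  proof eventually_elim
    case (elim x) thus ?case using component_le_norm_cart[of x i] assms by simp
  qed
  have "integrable (sphere_measure R) (\<lambda>x. (x $ i / R)\<^sup>2)"
  proof (rule finite_measure.integrable_const_bound[OF finite_measure_sphere_measure])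
    show "AE x in sphere_measure R. norm ((x $ i / R)\<^sup>2) \<le> 1"
      using bound by eventually_elim (simp only: real_norm_def abs_power2 abs_square_le_1)
  qed (use meas in simp)
  thus "(\<lambda>x. x $ i / R) \<in> L2 (sphere_measure R)" using meas by (simp add: L2_def)
qed

lemma smooth_shell_divergence:
  assumes R: "0 < R1" "R1 < R2" and \<phi>: "smooth \<phi>" and H: "smooth_real H"
    and a: "R1\<^sup>2 < a" "\<And>s. s < a \<Longrightarrow> H s = 0"
  shows "(\<integral>x. partial i \<phi> x * H ((norm x)\<^sup>2) + \<phi> x * partial i (\<lambda>x. H ((norm x)\<^sup>2)) x \<partial>lebesgue_on (shell R1 R2))
       = H (R2\<^sup>2) * (\<integral>x. \<phi> x * (x $ i / R2) \<partial>sphere_measure R2)"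
proof -
  define F where "F x = \<phi> x * H ((norm x)\<^sup>2)" for x
  have sH: "smooth (\<lambda>x::real^3. H ((norm x)\<^sup>2))" by (rule smooth_radial[OF H])
  have F: "smooth F" unfolding F_def by (rule smooth_mult[OF \<phi> sH])
  have pF: "partial i F x = partial i \<phi> x * H ((norm x)\<^sup>2) + \<phi> x * partial i (\<lambda>x. H ((norm x)\<^sup>2)) x" for x
    unfolding F_def by (intro partial_mult smooth_differentiable \<phi> sH)
  \<comment> \<open>so the integral over the shell is an integral over the whole ball\<close>
  have F0: "partial i F x = 0" if "norm x \<le> R1" for x
  proof -
    have op: "open {x::real^3. (norm x)\<^sup>2 < a}" by (intro open_Collect_less continuous_intros)
    have "(norm x)\<^sup>2 \<le> R1\<^sup>2" using that by (intro power_mono) auto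
    hence "x \<in> {x. (norm x)\<^sup>2 < a}" using a(1) by simp
    hence "(F has_derivative (\<lambda>v. 0)) (at x)"
      by (rule has_derivative_transform_within_open[OF has_derivative_const op]) (simp add: F_def a(2))
    thus ?thesis using has_derivative_imp_partial by blast
  qed
  have meas: "partial i F \<in> borel_measurable borel" by (intro smooth_borel_measurable smooth_partial F)
  have "(\<integral>x. partial i F x \<partial>lebesgue_on (shell R1 R2)) = (\<integral>x. indicator (shell R1 R2) x * partial i F x \<partial>lebesgue)"
    by (simp add: integral_restrict_space sets_shell)
  also have "\<dots> = (\<integral>x. indicator (ball 0 R2) x * partial i F x \<partial>lebesgue)"
    using F0 by (intro Bochner_Integration.integral_cong) (auto simp: indicator_def shell_def not_less)
  also have "\<dots> = (\<integral>x. indicator (ball 0 R2) x * partial i F x \<partial>lborel)"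
    using meas by (subst integral_completion) (auto intro!: borel_measurable_times borel_measurable_indicator)
  also have "\<dots> = 3 / R2 * (\<integral>x. indicator (cball 0 R2) x * (F ((R2 / norm x) *\<^sub>R x) * (x $ i / norm x)) \<partial>lborel)"
    using R by (intro divergence_ball smooth_differentiable smooth_continuous smooth_partial F) auto
  also have "\<dots> = 3 / R2 * (\<integral>x. indicator (cball 0 R2) x
      * (F ((R2 / norm x) *\<^sub>R x) * (((R2 / norm x) *\<^sub>R x) $ i / R2)) \<partial>lborel)"
    using R by simp
  also have "\<dots> = (\<integral>x. F x * (x $ i / R2) \<partial>sphere_measure R2)"
    using R smooth_borel_measurable[OF F] smooth_borel_measurable[OF smooth_component[of i]]
    by (subst integral_sphere_measure) auto
  also have "\<dots> = (\<integral>x. H (R2\<^sup>2) * (\<phi> x * (x $ i / R2)) \<partial>sphere_measure R2)"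
  proof (rule integral_cong_AE)
    show "AE x in sphere_measure R2. F x * (x $ i / R2) = H (R2\<^sup>2) * (\<phi> x * (x $ i / R2))"
      using AE_sphere_measure_norm[of R2] R by (auto simp: F_def)
  qed (use smooth_borel_measurable[OF F] smooth_borel_measurable[OF \<phi>] smooth_borel_measurable[OF smooth_component[of i]] in \<open>auto\<close>)
  finally show ?thesis by (simp add: pF)
qed

text \<open>
  The identity holds for the smooth functions that approximate \<open>f\<close> by
  \<open>smooth_shell_divergence\<close>, and all terms are continuous along the approximation. For
  the derivatives this needs the uniqueness of weak derivatives, since the norm of \<open>f - \<phi>\<^sub>n\<close> is
  built from a chosen weak derivative of the difference.
\<close>

lemma trace_divergence:
  assumes R: "0 < R1" "R1 < R2"
    and f: "has_trace (shell R1 R2) (shell_boundary_measure R1 R2) f g" and H: "smooth_real H"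
    and a: "R1\<^sup>2 < a" "\<And>s. s < a \<Longrightarrow> H s = 0"
  shows "(\<integral>x. weak_partial (shell R1 R2) i f x * H ((norm x)\<^sup>2) \<partial>lebesgue_on (shell R1 R2))
       + (\<integral>x. f x * partial i (\<lambda>x. H ((norm x)\<^sup>2)) x \<partial>lebesgue_on (shell R1 R2))
       = H (R2\<^sup>2) * (\<integral>x. g x * (x $ i / R2) \<partial>sphere_measure R2)"
proof -
  define \<Omega> where "\<Omega> = shell R1 R2"
  define \<sigma> where "\<sigma> = shell_boundary_measure R1 R2"
  define M where "M = lebesgue_on \<Omega>"
  define w where "w = weak_partial \<Omega> i f"
  have \<Omega>: "open \<Omega>" "\<Omega> \<in> lmeasurable" "bounded \<Omega>"
    by (auto simp: \<Omega>_def open_shell lmeasurable_shell bounded_shell)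
  have finM: "finite_measure M" unfolding M_def by (rule finite_measure_lebesgue_on[OF \<Omega>(2)])
  obtain \<phi> where fW: "f \<in> W12 \<Omega>" and g: "g \<in> L2 \<sigma>"
    and \<phi>: "\<And>n. smooth (\<phi> n)" "\<And>n. \<phi> n \<in> W12 \<Omega>" "\<And>n. \<phi> n \<in> L2 \<sigma>"
    and lim: "(\<lambda>n. W12_norm \<Omega> (\<lambda>x. f x - \<phi> n x)) \<longlonglongrightarrow> 0" "(\<lambda>n. L2_norm \<sigma> (\<lambda>x. g x - \<phi> n x)) \<longlonglongrightarrow> 0"
    using f unfolding has_trace_def \<Omega>_def \<sigma>_def by (elim conjE exE) blast
  define \<Psi> where "\<Psi> x = H ((norm x)\<^sup>2)" for x :: "real^3"
  have \<Psi>: "smooth \<Psi>" unfolding \<Psi>_def by (rule smooth_radial[OF H])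
  have p\<Psi>: "smooth (partial i \<Psi>)" by (rule smooth_partial[OF \<Psi>])
  have L2s: "h \<in> L2 M" if "smooth h" for h
    unfolding M_def by (rule smooth_L2[OF that \<Omega>(2,3)])
  have fL2: "f \<in> L2 M" unfolding M_def by (rule W12_L2[OF fW])
  have wL2: "w \<in> L2 M" unfolding w_def M_def by (rule weak_partial_spec(1)[OF fW])
  have diffW: "(\<lambda>x. f x - \<phi> n x) \<in> W12 \<Omega>" for n by (rule W12_diff[OF \<Omega>(2) fW \<phi>(2)])
  have wlim: "(\<lambda>n. \<integral>x. (f x - \<phi> n x) * b x \<partial>M) \<longlonglongrightarrow> 0"
    and dlim: "(\<lambda>n. \<integral>x. weak_partial \<Omega> i (\<lambda>x. f x - \<phi> n x) x * b x \<partial>M) \<longlonglongrightarrow> 0"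
    if b: "smooth b" for b
  proof -
    obtain B where "\<And>x. x \<in> \<Omega> \<Longrightarrow> \<bar>b x\<bar> \<le> B"
      using bounded_continuous_bounded[OF \<Omega>(3) smooth_continuous[OF b]] by metis
    hence B: "AE x in M. \<bar>b x\<bar> \<le> B" by (intro AE_I2) (auto simp: M_def)
    have bm: "b \<in> borel_measurable M" unfolding M_def by (rule smooth_measurable_lebesgue_on[OF b])
    show "(\<lambda>n. \<integral>x. (f x - \<phi> n x) * b x \<partial>M) \<longlonglongrightarrow> 0"
    proof (rule L2_tendsto_0_imp_integral_tendsto_0[OF finM _ _ bm B])
      show "(\<lambda>x. f x - \<phi> n x) \<in> L2 M" for n unfolding M_def by (rule W12_L2[OF diffW])
      show "(\<lambda>n. L2_norm M (\<lambda>x. f x - \<phi> n x)) \<longlonglongrightarrow> 0"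
        by (rule tendsto_sandwich[OF _ _ tendsto_const lim(1)])
           (auto simp: M_def W12_norm_bounds(1) L2_norm_nonneg)
    qed
    show "(\<lambda>n. \<integral>x. weak_partial \<Omega> i (\<lambda>x. f x - \<phi> n x) x * b x \<partial>M) \<longlonglongrightarrow> 0"
    proof (rule L2_tendsto_0_imp_integral_tendsto_0[OF finM _ _ bm B])
      show "weak_partial \<Omega> i (\<lambda>x. f x - \<phi> n x) \<in> L2 M" for n
        unfolding M_def by (rule weak_partial_spec(1)[OF diffW])
      show "(\<lambda>n. L2_norm M (weak_partial \<Omega> i (\<lambda>x. f x - \<phi> n x))) \<longlonglongrightarrow> 0"
        by (rule tendsto_sandwich[OF _ _ tendsto_const lim(1)])
           (auto simp: M_def W12_norm_bounds(2) L2_norm_nonneg)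
    qed
  qed
  have e: "(\<integral>x. weak_partial \<Omega> i (\<lambda>x. f x - \<phi> n x) x * \<Psi> x \<partial>M) = (\<integral>x. w x * \<Psi> x \<partial>M) - (\<integral>x. partial i (\<phi> n) x * \<Psi> x \<partial>M)" for n
  proof -
    have p: "smooth (partial i (\<phi> n))" by (rule smooth_partial[OF \<phi>(1)])
    have hw: "has_weak_partial \<Omega> i (\<lambda>x. f x - \<phi> n x) (\<lambda>x. w x - partial i (\<phi> n) x)"
      using fL2 L2s[OF \<phi>(1)] wL2 L2s[OF p] \<Omega>(2) unfolding M_def w_def
      by (intro has_weak_partial_diff weak_partial_spec(2)[OF fW] has_weak_partial_smooth \<phi>(1)) auto
    have "AE x in M. weak_partial \<Omega> i (\<lambda>x. f x - \<phi> n x) x = w x - partial i (\<phi> n) x"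
      unfolding M_def
      by (rule weak_partial_eq_AE[OF \<Omega>(1,2) W12_L2[OF diffW] L2_diff[OF wL2[unfolded M_def] L2s[OF p, unfolded M_def]] hw])
    moreover have "weak_partial \<Omega> i (\<lambda>x. f x - \<phi> n x) \<in> borel_measurable M" "w \<in> borel_measurable M"
      "partial i (\<phi> n) \<in> borel_measurable M" "\<Psi> \<in> borel_measurable M"
      using weak_partial_spec(1)[OF diffW] wL2 L2s[OF p] L2s[OF \<Psi>] by (auto simp: L2_def M_def)
    ultimately have "(\<integral>x. weak_partial \<Omega> i (\<lambda>x. f x - \<phi> n x) x * \<Psi> x \<partial>M) = (\<integral>x. (w x - partial i (\<phi> n) x) * \<Psi> x \<partial>M)"
      by (intro integral_cong_AE) auto
    thus ?thesis
      using L2_mult_integrable[OF wL2 L2s[OF \<Psi>]] L2_mult_integrable[OF L2s[OF p] L2s[OF \<Psi>]]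
      by (simp add: left_diff_distrib)
  qed
  have e2: "(\<integral>x. (f x - \<phi> n x) * partial i \<Psi> x \<partial>M) = (\<integral>x. f x * partial i \<Psi> x \<partial>M) - (\<integral>x. \<phi> n x * partial i \<Psi> x \<partial>M)" for n
    using L2_mult_integrable[OF fL2 L2s[OF p\<Psi>]] L2_mult_integrable[OF L2s[OF \<phi>(1)] L2s[OF p\<Psi>]]
    by (simp add: left_diff_distrib)
  define D where "D n = (\<integral>x. partial i (\<phi> n) x * \<Psi> x \<partial>M) + (\<integral>x. \<phi> n x * partial i \<Psi> x \<partial>M)" for n
  have "(\<lambda>n. ((\<integral>x. w x * \<Psi> x \<partial>M) + (\<integral>x. f x * partial i \<Psi> x \<partial>M))
      - ((\<integral>x. weak_partial \<Omega> i (\<lambda>x. f x - \<phi> n x) x * \<Psi> x \<partial>M) + (\<integral>x. (f x - \<phi> n x) * partial i \<Psi> x \<partial>M)))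
      \<longlonglongrightarrow> ((\<integral>x. w x * \<Psi> x \<partial>M) + (\<integral>x. f x * partial i \<Psi> x \<partial>M)) - (0 + 0)"
    by (intro tendsto_intros wlim dlim \<Psi> p\<Psi>)
  hence D1: "D \<longlonglongrightarrow> (\<integral>x. w x * \<Psi> x \<partial>M) + (\<integral>x. f x * partial i \<Psi> x \<partial>M)"
    by (simp add: e e2 D_def[abs_def])
  have Dn: "D n = H (R2\<^sup>2) * (\<integral>x. \<phi> n x * (x $ i / R2) \<partial>sphere_measure R2)" for n
  proof -
    have "D n = (\<integral>x. partial i (\<phi> n) x * \<Psi> x + \<phi> n x * partial i \<Psi> x \<partial>M)"
      unfolding D_def
      using L2_mult_integrable[OF L2s[OF smooth_partial[OF \<phi>(1)]] L2s[OF \<Psi>]] L2_mult_integrable[OF L2s[OF \<phi>(1)] L2s[OF p\<Psi>]]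
      by simp
    also have "\<dots> = H (R2\<^sup>2) * (\<integral>x. \<phi> n x * (x $ i / R2) \<partial>sphere_measure R2)"
      using smooth_shell_divergence[OF R \<phi>(1)[of n] H a, of i] by (simp add: M_def \<Omega>_def \<Psi>_def[abs_def])
    finally show ?thesis .
  qed
  let ?S = "sphere_measure R2"
  note le = sphere_measure_le_shell_boundary_measure[of R2 R1, folded \<sigma>_def]
  have sets: "sets ?S = sets \<sigma>" by (simp add: \<sigma>_def)
  have gS: "g \<in> L2 ?S" "\<phi> n \<in> L2 ?S" for n
    using L2_mono_measure(1)[OF le sets] g \<phi>(3) by auto
  have "0 < R2" using R by simp
  note normal = normal_component_sphere[OF this, of i]
  have "(\<lambda>n. \<integral>x. (g x - \<phi> n x) * (x $ i / R2) \<partial>?S) \<longlonglongrightarrow> 0"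
  proof (rule L2_tendsto_0_imp_integral_tendsto_0[OF finite_measure_sphere_measure _ _ normal(1,2)])
    show "(\<lambda>x. g x - \<phi> n x) \<in> L2 ?S" for n by (rule L2_diff[OF gS])
    show "(\<lambda>n. L2_norm ?S (\<lambda>x. g x - \<phi> n x)) \<longlonglongrightarrow> 0"
      by (rule tendsto_sandwich[OF _ _ tendsto_const lim(2)])
         (auto simp: L2_mono_measure(2)[OF le sets L2_diff[OF g \<phi>(3)]] L2_norm_nonneg)
  qed
  moreover have "(\<integral>x. (g x - \<phi> n x) * (x $ i / R2) \<partial>?S)
      = (\<integral>x. g x * (x $ i / R2) \<partial>?S) - (\<integral>x. \<phi> n x * (x $ i / R2) \<partial>?S)" for n
    unfolding left_diff_distrib
    by (rule Bochner_Integration.integral_diff[OF L2_mult_integrable[OF gS(1) normal(3)] L2_mult_integrable[OF gS(2) normal(3)]])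
  ultimately have "(\<lambda>n. (\<integral>x. g x * (x $ i / R2) \<partial>?S) - (\<integral>x. \<phi> n x * (x $ i / R2) \<partial>?S)) \<longlonglongrightarrow> 0" by simp
  from tendsto_diff[OF tendsto_const[of "\<integral>x. g x * (x $ i / R2) \<partial>?S"] this]
  have "(\<lambda>n. \<integral>x. \<phi> n x * (x $ i / R2) \<partial>?S) \<longlonglongrightarrow> (\<integral>x. g x * (x $ i / R2) \<partial>?S)" by simp
  hence "D \<longlonglongrightarrow> H (R2\<^sup>2) * (\<integral>x. g x * (x $ i / R2) \<partial>?S)"
    unfolding Dn[abs_def] by (intro tendsto_mult tendsto_const)
  from LIMSEQ_unique[OF D1 this] show ?thesis
    by (simp add: w_def M_def \<Omega>_def \<Psi>_def[abs_def])
qed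

text \<open>
  The flux of \<open>V\<close> through the outer sphere determines its pairing with the gradient of a radial
  function, because \<open>div V = 0\<close>. The radial function vanishes near the inner sphere, which
  therefore does not contribute.
\<close>

lemma flux_radial:
  assumes R: "0 < R1" "R1 < R2" and V: "V \<in> W12_field (shell R1 R2)" and sol: "solenoidal (shell R1 R2) V"
    and tr: "\<And>i. has_trace (shell R1 R2) (shell_boundary_measure R1 R2) (\<lambda>x. V x $ i) (\<lambda>x. v x $ i)"
    and H: "smooth_real H" and a: "R1\<^sup>2 < a" "\<And>s. s < a \<Longrightarrow> H s = 0"
  shows "(\<Sum>i\<in>UNIV. \<integral>x. V x $ i * partial i (\<lambda>x. H ((norm x)\<^sup>2)) x \<partial>lebesgue_on (shell R1 R2))
       = H (R2\<^sup>2) * (\<integral>x. v x \<bullet> outer_normal R1 R2 x \<partial>sphere_measure R2)"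
proof -
  let ?M = "lebesgue_on (shell R1 R2)" and ?S = "sphere_measure R2"
  define w where "w i = weak_partial (shell R1 R2) i (\<lambda>x. V x $ i)" for i
  define \<Psi> where "\<Psi> x = H ((norm x)\<^sup>2)" for x :: "real^3"
  have \<Psi>: "\<Psi> \<in> L2 ?M" unfolding \<Psi>_def by (rule smooth_L2[OF smooth_radial[OF H] lmeasurable_shell bounded_shell])
  have w: "w i \<in> L2 ?M" for i
    using V unfolding w_def W12_field_def by (intro weak_partial_spec(1)) auto
  have "(\<Sum>i\<in>UNIV. \<integral>x. w i x * \<Psi> x \<partial>?M) = (\<integral>x. (\<Sum>i\<in>UNIV. w i x * \<Psi> x) \<partial>?M)"
    by (rule Bochner_Integration.integral_sum[symmetric]) (rule L2_mult_integrable[OF w \<Psi>])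
  also have "\<dots> = (\<integral>x. 0 \<partial>?M)"
  proof (rule integral_cong_AE)
    show "AE x in ?M. (\<Sum>i\<in>UNIV. w i x * \<Psi> x) = 0"
      using sol unfolding solenoidal_def w_def
      by eventually_elim (simp add: sum_distrib_right[symmetric])
    show "(\<lambda>x. \<Sum>i\<in>UNIV. w i x * \<Psi> x) \<in> borel_measurable ?M"
      using w \<Psi> by (intro borel_measurable_sum borel_measurable_times) (auto simp: L2_def)
  qed simp
  finally have 0: "(\<Sum>i\<in>UNIV. \<integral>x. w i x * \<Psi> x \<partial>?M) = 0" by simp
  have le: "?S \<le> shell_boundary_measure R1 R2" by (rule sphere_measure_le_shell_boundary_measure)
  have vL2: "(\<lambda>x. v x $ i) \<in> L2 ?S" for i
    using tr[of i] L2_mono_measure(1)[OF le, of "\<lambda>x. v x $ i"] by (simp add: has_trace_def)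
  have "0 < R2" using R by simp
  note xL2 = normal_component_sphere(3)[OF this]
  have "(\<integral>x. v x \<bullet> outer_normal R1 R2 x \<partial>?S) = (\<integral>x. (\<Sum>i\<in>UNIV. v x $ i * (x $ i / R2)) \<partial>?S)"
  proof -
    have eq: "AE x in ?S. v x \<bullet> outer_normal R1 R2 x = (\<Sum>i\<in>UNIV. v x $ i * (x $ i / R2))"
      using AE_sphere_measure_norm[OF \<open>0 < R2\<close>]
    proof eventually_elim
      case (elim x) thus ?case by (simp add: outer_normal_def inner_vec_def divide_inverse mult_ac)
    qed
    have m: "(\<lambda>x. v x \<bullet> outer_normal R1 R2 x) \<in> borel_measurable ?S"
    proof -
      have "(\<lambda>x. v x $ i) \<in> borel_measurable ?S" for i using vL2 by (simp add: L2_def)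
      hence "v \<in> borel_measurable borel"
        by (subst borel_measurable_euclidean_space) (auto simp: Basis_vec_def cart_eq_inner_axis[symmetric])
      moreover have "outer_normal R1 R2 \<in> borel_measurable borel"
        unfolding outer_normal_def[abs_def] by measurable
      ultimately show ?thesis by simp
    qed
    have m2: "(\<lambda>x. (\<Sum>i\<in>UNIV. v x $ i * (x $ i / R2))) \<in> borel_measurable ?S"
      using vL2 xL2 by (intro borel_measurable_sum borel_measurable_times) (auto simp: L2_def)
    show ?thesis by (rule integral_cong_AE[OF m m2 eq])
  qed
  also have "\<dots> = (\<Sum>i\<in>UNIV. \<integral>x. v x $ i * (x $ i / R2) \<partial>?S)"
    by (rule Bochner_Integration.integral_sum) (rule L2_mult_integrable[OF vL2 xL2])
  finally have 1: "(\<Sum>i\<in>UNIV. \<integral>x. v x $ i * (x $ i / R2) \<partial>?S) = (\<integral>x. v x \<bullet> outer_normal R1 R2 x \<partial>?S)" ..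
  have "(\<Sum>i\<in>UNIV. (\<integral>x. w i x * \<Psi> x \<partial>?M) + (\<integral>x. V x $ i * partial i \<Psi> x \<partial>?M))
      = (\<Sum>i\<in>UNIV. H (R2\<^sup>2) * (\<integral>x. v x $ i * (x $ i / R2) \<partial>?S))"
    unfolding w_def \<Psi>_def[abs_def] by (intro sum.cong refl trace_divergence[OF R tr H a])
  from this[unfolded sum.distrib sum_distrib_left[symmetric] 0 1]
  show ?thesis by (simp only: \<Psi>_def[abs_def] add_0)
qed


section \<open>An isotropic family of monomials\<close>

primrec monomial :: "'n list \<Rightarrow> real^'n \<Rightarrow> real" where
  "monomial [] x = 1"
| "monomial (i # I) x = x $ i * monomial I x"

definition words :: "nat \<Rightarrow> 'n list set" where
  "words m = {I. length I = m}"

lemma words_0: "words 0 = {[]}"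
  by (auto simp: words_def)

lemma finite_words: "finite (words m :: 'n::finite list set)"
  unfolding words_def using finite_lists_length_eq[of "UNIV :: 'n set" m] by simp

lemma sum_words_Suc:
  "(\<Sum>I\<in>words (Suc m). f I) = (\<Sum>i\<in>(UNIV :: 'n::finite set). \<Sum>I\<in>words m. f (i # I))"
proof -
  have eq: "words (Suc m) = (\<lambda>(i, I). i # I) ` (UNIV \<times> words m)"
    by (force simp: words_def length_Suc_conv image_iff)
  show ?thesis
    unfolding eq by (subst sum.reindex) (auto simp: inj_on_def sum.cartesian_product o_def case_prod_unfold)
qed

lemma monomial_Cons_eq: "monomial (i # I) = (\<lambda>x. x $ i * monomial I x)"
  by (rule ext) simp

lemma smooth_monomial: "smooth (monomial I)"
proof (induction I)
  case Nil
  have "monomial [] = (\<lambda>x. 1)" by (rule ext) simp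
  thus ?case by simp
next
  case (Cons i I) thus ?case
    unfolding monomial_Cons_eq by (intro smooth_mult smooth_component)
qed

lemma partial_monomial_Cons:
  "partial j (monomial (i # I)) x = (if i = j then monomial I x else 0) + x $ i * partial j (monomial I) x"
  unfolding monomial_Cons_eq
  by (simp add: partial_mult smooth_differentiable smooth_monomial smooth_component partial_component)

lemma partial_monomial_Nil: "partial j (monomial []) x = 0"
proof -
  have "monomial [] = (\<lambda>x::real^'a. 1)" by (rule ext) simp
  thus ?thesis by (metis partial_const)
qed

lemma norm_sq_eq_sum: "(norm x)\<^sup>2 = (\<Sum>i\<in>UNIV. (x $ i)\<^sup>2)" for x :: "real^'n"
  by (simp add: norm_vec_def L2_set_def sum_nonneg)

text \<open>
  The value at \<open>y = x\<close> of the kernel \<open>\<Sum> P(x) P(y) = (x \<cdot> y)\<^sup>m\<close>. The next two lemmas give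
  the values there of \<open>\<partial>/\<partial>y\<^sub>j\<close> and \<open>\<partial>/\<partial>x\<^sub>i \<partial>/\<partial>y\<^sub>j\<close> of the kernel; powers of \<open>|x|\<^sup>2\<close> with negative exponents are
  written as quotients, so that small \<open>m\<close> need no special treatment.
\<close>

lemma sum_monomial_sq: "(\<Sum>I\<in>words m. (monomial I x)\<^sup>2) = ((norm x)\<^sup>2) ^ m" for x :: "real^'n"
proof (induction m)
  case 0 show ?case by (simp add: words_0)
next
  case (Suc m)
  have "(\<Sum>I\<in>words (Suc m). (monomial I x)\<^sup>2) = (\<Sum>i\<in>UNIV. (x $ i)\<^sup>2 * (\<Sum>I\<in>words m. (monomial I x)\<^sup>2))"
    by (simp add: sum_words_Suc power_mult_distrib sum_distrib_left)
  thus ?case by (simp add: Suc norm_sq_eq_sum sum_distrib_right)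
qed

lemma sum_monomial_partial:
  fixes x :: "real^'n"
  assumes "x \<noteq> 0"
  shows "(\<Sum>I\<in>words m. monomial I x * partial j (monomial I) x)
       = real m * ((norm x)\<^sup>2) ^ m / (norm x)\<^sup>2 * x $ j"
proof (induction m)
  case 0 show ?case by (simp add: words_0 partial_monomial_Nil)
next
  case (Suc m)
  have "(\<Sum>I\<in>words (Suc m). monomial I x * partial j (monomial I) x)
      = (\<Sum>i\<in>UNIV. (if i = j then x $ i * (\<Sum>I\<in>words m. (monomial I x)\<^sup>2) else 0)
          + (x $ i)\<^sup>2 * (\<Sum>I\<in>words m. monomial I x * partial j (monomial I) x))"
    unfolding sum_words_Suc partial_monomial_Cons monomial.simps
    by (intro sum.cong refl)
       (auto simp: sum_distrib_left sum.distrib[symmetric] power2_eq_square algebra_simps intro!: sum.cong)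
  also have "\<dots> = x $ j * ((norm x)\<^sup>2) ^ m
      + (norm x)\<^sup>2 * (real m * ((norm x)\<^sup>2) ^ m / (norm x)\<^sup>2 * x $ j)"
    unfolding sum.distrib sum_distrib_right[symmetric] norm_sq_eq_sum[symmetric] Suc sum_monomial_sq by simp
  finally show ?case using assms by (simp add: field_simps)
qed

lemma sum_partial_monomial_partial:
  fixes x :: "real^'n"
  assumes "x \<noteq> 0"
  shows "(\<Sum>I\<in>words m. partial i (monomial I) x * partial j (monomial I) x)
       = real m * (real m - 1) * ((norm x)\<^sup>2) ^ m / ((norm x)\<^sup>2)\<^sup>2 * (x $ i * x $ j)
         + (if i = j then real m * ((norm x)\<^sup>2) ^ m / (norm x)\<^sup>2 else 0)"
proof (induction m)
  case 0 show ?case by (simp add: words_0 partial_monomial_Nil)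
next
  case (Suc m)
  define s where "s = (norm x)\<^sup>2"
  have s: "s \<noteq> 0" using assms by (simp add: s_def)
  have "(\<Sum>I\<in>words (Suc m). partial i (monomial I) x * partial j (monomial I) x)
      = (\<Sum>k\<in>UNIV. (if k = i then (if k = j then (\<Sum>I\<in>words m. (monomial I x)\<^sup>2) else 0) else 0)
          + (if k = i then x $ k * (\<Sum>I\<in>words m. monomial I x * partial j (monomial I) x) else 0)
          + (if k = j then x $ k * (\<Sum>I\<in>words m. monomial I x * partial i (monomial I) x) else 0)
          + (x $ k)\<^sup>2 * (\<Sum>I\<in>words m. partial i (monomial I) x * partial j (monomial I) x))"
    unfolding sum_words_Suc partial_monomial_Cons
    by (intro sum.cong refl)
       (auto simp: sum_distrib_left sum.distrib[symmetric] power2_eq_square algebra_simps intro!: sum.cong)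
  also have "\<dots> = (if i = j then s ^ m else 0)
      + x $ i * (real m * s ^ m / s * x $ j) + x $ j * (real m * s ^ m / s * x $ i)
      + s * (real m * (real m - 1) * s ^ m / s\<^sup>2 * (x $ i * x $ j) + (if i = j then real m * s ^ m / s else 0))"
    unfolding sum.distrib sum_distrib_right[symmetric] norm_sq_eq_sum[symmetric] Suc sum_monomial_sq
      sum_monomial_partial[OF assms] s_def by simp
  also have "\<dots> = real (Suc m) * (real (Suc m) - 1) * s ^ Suc m / s\<^sup>2 * (x $ i * x $ j)
         + (if i = j then real (Suc m) * s ^ Suc m / s else 0)"
    using s by (simp add: field_simps power2_eq_square)
  finally show ?case by (simp only: s_def)
qed

lemma sum_partial_radial_monomial:
  fixes x :: "real^'n"
  assumes "x \<noteq> 0" "smooth_real h"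
  shows "(\<Sum>I\<in>words m. partial i (\<lambda>x. h ((norm x)\<^sup>2) * monomial I x) x * partial j (\<lambda>x. h ((norm x)\<^sup>2) * monomial I x) x)
     = (let s = (norm x)\<^sup>2 in
         s ^ m * (4 * (deriv h s)\<^sup>2 + 4 * real m * h s * deriv h s / s + real m * (real m - 1) * (h s)\<^sup>2 / s\<^sup>2)
           * (x $ i * x $ j)
         + (if i = j then real m * (h s)\<^sup>2 * s ^ m / s else 0))"
proof -
  define s where "s = (norm x)\<^sup>2"
  have s: "s \<noteq> 0" using assms by (simp add: s_def)
  have p: "partial k (\<lambda>x. h ((norm x)\<^sup>2) * monomial I x) x = 2 * x $ k * deriv h s * monomial I x + h s * partial k (monomial I) x" for k I
    by (simp add: partial_mult smooth_differentiable smooth_monomial smooth_radial assms partial_radial s_def)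
  have "(\<Sum>I\<in>words m. partial i (\<lambda>x. h ((norm x)\<^sup>2) * monomial I x) x * partial j (\<lambda>x. h ((norm x)\<^sup>2) * monomial I x) x)
    = (\<Sum>I\<in>words m. (4 * x $ i * x $ j * (deriv h s)\<^sup>2) * (monomial I x)\<^sup>2
        + (2 * x $ i * deriv h s * h s) * (monomial I x * partial j (monomial I) x)
        + (2 * x $ j * deriv h s * h s) * (monomial I x * partial i (monomial I) x)
        + (h s)\<^sup>2 * (partial i (monomial I) x * partial j (monomial I) x))"
    unfolding p by (intro sum.cong refl) (simp add: power2_eq_square algebra_simps)
  also have "\<dots> = (4 * x $ i * x $ j * (deriv h s)\<^sup>2) * s ^ m
        + (2 * x $ i * deriv h s * h s) * (real m * s ^ m / s * x $ j)
        + (2 * x $ j * deriv h s * h s) * (real m * s ^ m / s * x $ i)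
        + (h s)\<^sup>2 * (real m * (real m - 1) * s ^ m / s\<^sup>2 * (x $ i * x $ j) + (if i = j then real m * s ^ m / s else 0))"
    unfolding sum.distrib sum_distrib_left[symmetric] sum_monomial_sq
      sum_monomial_partial[OF assms(1)] sum_partial_monomial_partial[OF assms(1)] s_def ..
  also have "\<dots> = s ^ m * (4 * (deriv h s)\<^sup>2 + 4 * real m * h s * deriv h s / s + real m * (real m - 1) * (h s)\<^sup>2 / s\<^sup>2)
           * (x $ i * x $ j)
         + (if i = j then real m * (h s)\<^sup>2 * s ^ m / s else 0)"
    using s by (simp add: field_simps power2_eq_square)
  finally show ?thesis by (simp only: s_def Let_def)
qed


section \<open>The radial profile\<close>

lemma smooth_real_power: "smooth_real f \<Longrightarrow> smooth_real (\<lambda>x. f x ^ k)"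
  by (induction k) (auto intro: smooth_real_const smooth_real_mult)

lemma ex_antiderivative:
  assumes "continuous_on UNIV (f :: real \<Rightarrow> real)"
  obtains F where "\<And>x. (F has_real_derivative f x) (at x)"
proof -
  have "\<exists>F. \<forall>x::real. -\<infinity> < ereal x \<longrightarrow> ereal x < \<infinity> \<longrightarrow> (F has_vector_derivative f x) (at x)"
    using assms by (intro einterval_antiderivative) (auto simp: continuous_on_eq_continuous_at)
  thus ?thesis using that by (auto simp: has_real_derivative_iff_has_vector_derivative)
qed

lemma deriv_eq_0_locally_constant:
  fixes f :: "real \<Rightarrow> real"
  assumes "open S" "s \<in> S" "\<And>t. t \<in> S \<Longrightarrow> f t = 0"
  shows "deriv f s = 0"
proof (rule DERIV_imp_deriv)
  have "((\<lambda>t. 0) has_real_derivative 0) (at s)" by simp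
  thus "(f has_real_derivative 0) (at s)"
    by (rule has_field_derivative_transform_within_open[OF _ assms(1,2)]) (simp add: assms(3))
qed

text \<open>
  With \<open>m = 2n\<close> and \<open>h = w / s\<^sup>n\<close> the coefficient of \<open>x \<otimes> x\<close> in \<open>sum_partial_radial_monomial\<close> becomes
  \<open>A = 4 w'\<^sup>2 - m w\<^sup>2 / s\<^sup>2\<close>. The function \<open>H\<close> is \<open>s A\<close> plus the antiderivative of \<open>A\<close> that vanishes at \<open>a\<close>, so
  \<open>H t\<close> is the integral of \<open>A\<close> from \<open>a\<close> to \<open>t\<close>, which is negative for large \<open>m\<close>. The factor \<open>flat 1 (monom 1 n)\<close>
  supplies \<open>1 / s\<^sup>n\<close> as a function that is smooth on the whole line.
\<close>

lemma ex_radial_profile: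
  fixes a b t :: real
  assumes "0 < a" "a < b" "b < t"
  obtains m :: nat and h A H :: "real \<Rightarrow> real" where
    "smooth_real h" "smooth_real A" "smooth_real H"
    "\<And>s. s \<notin> {a..b} \<Longrightarrow> h s = 0" "\<And>s. s \<notin> {a..b} \<Longrightarrow> A s = 0" "\<And>s. s < a \<Longrightarrow> H s = 0"
    "\<And>s. 0 < s \<Longrightarrow> A s = s ^ m * (4 * (deriv h s)\<^sup>2 + 4 * real m * h s * deriv h s / s
                              + real m * (real m - 1) * (h s)\<^sup>2 / s\<^sup>2)"
    "\<And>s. deriv H s = 2 * A s + s * deriv A s"
    "H t < 0"
proof -
  define bump where "bump s = flat 1 1 (s - a) * flat 1 1 (b - s)" for s
  define e where "e n s = flat 1 (monom 1 n) s * bump s" for n s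
  have bump: "smooth_real bump"
  proof -
    have "smooth_real (\<lambda>s. flat 1 1 (- a + 1 * s))" "smooth_real (\<lambda>s. flat 1 1 (b + (-1) * s))"
      by (intro smooth_real_affine smooth_real_flat zero_less_one)+
    from smooth_real_mult[OF this] show ?thesis by (simp add: bump_def[abs_def])
  qed
  have e: "smooth_real (e n)" for n
    unfolding e_def[abs_def] by (intro smooth_real_mult smooth_real_flat bump) simp
  have e_out: "e n s = 0" if "s \<notin> {a<..<b}" for n s
    using that by (auto simp: e_def bump_def flat_1)
  have e_pos: "e n s > 0" if "s \<in> {a<..<b}" for n s
    using that assms by (auto simp: e_def bump_def flat_def poly_monom)
  \<comment> \<open>multiplication by \<open>s\<^sup>n\<close> cancels \<open>n\<close> of the factors \<open>1 / s\<close>\<close>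
  have e_mult: "e k s = s ^ n * e (k + n) s" for k n s
    using assms e_out[of s k] e_out[of s "k + n"]
    by (cases "s \<in> {a<..<b}") (auto simp: e_def flat_def poly_monom power_add power_divide)
  define w where "w = e 0"
  have w': "deriv w s = s ^ n * deriv (e n) s + real n * s ^ n / s * e n s" if "0 < s" for n s
  proof -
    have "((\<lambda>s. s ^ n * e n s) has_real_derivative (real n * s ^ (n - 1)) * e n s + deriv (e n) s * s ^ n) (at s)"
      by (intro DERIV_mult smooth_real_has_deriv e) (auto intro!: derivative_eq_intros)
    moreover have "(\<lambda>s. s ^ n * e n s) = w" using e_mult[of 0 _ n] by (auto simp: w_def)
    ultimately have "deriv w s = (real n * s ^ (n - 1)) * e n s + deriv (e n) s * s ^ n"
      using DERIV_imp_deriv by metis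
    moreover have "real n * s ^ (n - 1) = real n * s ^ n / s" using that by (cases n) auto
    ultimately show ?thesis by (simp add: mult.commute)
  qed
  obtain F1 where F1: "\<And>s. (F1 has_real_derivative (deriv w s)\<^sup>2) (at s)"
    by (rule ex_antiderivative[of "\<lambda>s. (deriv w s)\<^sup>2"])
       (auto intro!: smooth_real_continuous smooth_real_power smooth_real_deriv simp: w_def e)
  obtain F2 where F2: "\<And>s. (F2 has_real_derivative (e 1 s)\<^sup>2) (at s)"
    by (rule ex_antiderivative[of "\<lambda>s. (e 1 s)\<^sup>2"])
       (auto intro!: smooth_real_continuous smooth_real_power simp: e)
  have K2: "F2 a < F2 t"
  proof -
    \<comment> \<open>any subinterval inside the support gives strict growth\<close>
    define c d where "c = (2 * a + b) / 3" and "d = (a + 2 * b) / 3"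
    have cd: "a < c" "c < d" "d < b" using assms by (auto simp: c_def d_def)
    have nonneg: "F2 x \<le> F2 y" if "x \<le> y" for x y
      by (rule DERIV_nonneg_imp_nondecreasing[OF that]) (use F2 in \<open>auto intro!: exI\<close>)
    have "F2 c < F2 d"
    proof (rule DERIV_pos_imp_increasing[OF cd(2)])
      fix x assume "c \<le> x" "x \<le> d"
      hence "e 1 x > 0" using cd by (intro e_pos) auto
      thus "\<exists>y. (F2 has_real_derivative y) (at x) \<and> 0 < y" using F2[of x] by auto
    qed
    thus ?thesis using nonneg[of a c] nonneg[of d t] cd assms by linarith
  qed
  obtain n :: nat where n: "2 * (F1 t - F1 a) / (F2 t - F2 a) < real n"
    using reals_Archimedean2 by blast
  define A where "A s = 4 * (deriv w s)\<^sup>2 - 2 * real n * (e 1 s)\<^sup>2" for s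
  define F where "F s = 4 * F1 s - 2 * real n * F2 s" for s
  define H where "H s = s * A s + (F s - F a)" for s
  have F: "(F has_real_derivative A s) (at s)" for s
    unfolding F_def[abs_def] A_def by (auto intro!: derivative_eq_intros F1 F2)
  have A: "smooth_real A"
  proof -
    have "smooth_real (\<lambda>s. 4 * (deriv w s)\<^sup>2 + (- 2 * real n) * (e 1 s)\<^sup>2)"
      by (intro smooth_real_add smooth_real_mult smooth_real_const smooth_real_power smooth_real_deriv)
         (auto simp: w_def e)
    thus ?thesis by (simp add: A_def[abs_def])
  qed
  have H': "(H has_real_derivative 2 * A s + s * deriv A s) (at s)" for s
    unfolding H_def[abs_def]
    by (auto intro!: derivative_eq_intros F smooth_real_has_deriv[OF A])
  have H: "smooth_real H"
    by (rule smooth_realI[OF H'])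
       (intro smooth_real_add smooth_real_mult smooth_real_const smooth_real_ident A smooth_real_deriv)
  have A_out: "A s = 0" if "s \<notin> {a..b}" for s
  proof -
    have "open (- {a..b})" by (simp add: open_Compl)
    hence "deriv w s = 0"
      by (rule deriv_eq_0_locally_constant) (use that in \<open>auto simp: w_def e_out\<close>)
    moreover have "e 1 s = 0" using that by (intro e_out) auto
    ultimately show ?thesis by (simp only: A_def) simp
  qed
  show thesis
  proof (rule that[of "e n" A H "2 * n"])
    show "smooth_real (e n)" "smooth_real A" "smooth_real H" by fact+
    show "e n s = 0" if "s \<notin> {a..b}" for s using that by (intro e_out) auto
    show "A s = 0" if "s \<notin> {a..b}" for s using that by (rule A_out)
    show "H s = 0" if sa: "s < a" for s
    proof -
      obtain z where "s < z" "z < a" "F a - F s = (a - s) * A z"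
        using MVT2[OF sa F] by blast
      thus ?thesis using A_out[of z] A_out[of s] sa by (simp add: H_def)
    qed
    show "deriv H s = 2 * A s + s * deriv A s" for s by (rule DERIV_imp_deriv[OF H'])
    show "H t < 0"
    proof -
      have "2 * (F1 t - F1 a) < real n * (F2 t - F2 a)" using n K2 by (simp add: pos_divide_less_eq)
      hence "F t - F a < 0" by (simp add: F_def algebra_simps)
      moreover have "A t = 0" using assms by (intro A_out) auto
      ultimately show ?thesis by (simp add: H_def)
    qed
    fix s :: real assume s: "0 < s"
    have e1: "e 1 s = s ^ n / s * e n s"
      using e_mult[of 0 s 1] e_mult[of 0 s n] s by (simp add: field_simps)
    show "A s = s ^ (2 * n) * (4 * (deriv (e n) s)\<^sup>2 + 4 * real (2 * n) * e n s * deriv (e n) s / s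
        + real (2 * n) * (real (2 * n) - 1) * (e n s)\<^sup>2 / s\<^sup>2)"
      unfolding A_def w'[OF s, of n] e1 power_mult[of s 2 n] using s
      by (simp add: field_simps power2_eq_square power_mult_distrib)
  qed
qed


section \<open>Symmetry of second derivatives\<close>

text \<open>
  This property is inherited by products; so it passes to the functions \<open>h(|x|\<^sup>2) P(x)\<close> with a
  monomial \<open>P\<close>.
\<close>

definition symmetric_hessian :: "(real^'n \<Rightarrow> real) \<Rightarrow> bool" where
  "symmetric_hessian f \<longleftrightarrow> (\<forall>i j x. partial i (partial j f) x = partial j (partial i f) x)"

lemma symmetric_hessian_mult:
  assumes "smooth f" "smooth g" "symmetric_hessian f" "symmetric_hessian g"
  shows "symmetric_hessian (\<lambda>x. f x * g x)"
proof -
  have p: "partial j (\<lambda>x. f x * g x) = (\<lambda>x. partial j f x * g x + f x * partial j g x)" for j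
    by (intro ext partial_mult smooth_differentiable assms)
  have d: "u differentiable (at x)" if "smooth u" for u :: "real^'a \<Rightarrow> real" and x
    by (rule smooth_differentiable[OF that])
  have pp: "partial i (\<lambda>x. partial j f x * g x + f x * partial j g x) x
      = (partial i (partial j f) x * g x + partial j f x * partial i g x)
      + (partial i f x * partial j g x + f x * partial i (partial j g) x)" for i j x
    by (subst partial_add)
       (auto simp: partial_mult d assms smooth_partial intro!: d smooth_mult)
  show ?thesis
    unfolding symmetric_hessian_def p pp using assms(3,4) by (simp add: symmetric_hessian_def)
qed

lemma symmetric_hessian_monomial: "symmetric_hessian (monomial I)"
proof (induction I)
  case Nil
  have "monomial [] = (\<lambda>x::real^'a. 1)" by (rule ext) simp
  thus ?case by (simp add: symmetric_hessian_def)
next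
  case (Cons i I)
  have "symmetric_hessian (\<lambda>x::real^'a. x $ i)"
    by (simp add: symmetric_hessian_def partial_component)
  thus ?case
    unfolding monomial_Cons_eq by (intro symmetric_hessian_mult smooth_component smooth_monomial Cons)
qed

lemma symmetric_hessian_radial:
  assumes "smooth_real h"
  shows "symmetric_hessian (\<lambda>x. h ((norm x)\<^sup>2))"
proof -
  have p: "partial j (\<lambda>x. h ((norm x)\<^sup>2)) = (\<lambda>x. (2 * x $ j) * deriv h ((norm x)\<^sup>2))" for j
    using partial_radial[OF assms] by auto
  have pp: "partial i (\<lambda>x. (2 * x $ j) * deriv h ((norm x)\<^sup>2)) x
     = (if i = j then 2 else 0) * deriv h ((norm x)\<^sup>2) + (2 * x $ j) * (2 * x $ i * deriv (deriv h) ((norm x)\<^sup>2))" for i j x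
  proof -
    have "partial i (\<lambda>x. 2 * x $ j) x = (if i = j then 2 else 0)"
      by (subst partial_mult) (auto simp: partial_component)
    thus ?thesis
      by (subst partial_mult)
         (auto simp: partial_radial[OF smooth_real_deriv[OF assms]]
           intro!: smooth_differentiable smooth_mult smooth_component smooth_radial smooth_real_deriv assms)
  qed
  thus ?thesis unfolding symmetric_hessian_def p pp by auto
qed


section \<open>Solenoidal test fields\<close>

text \<open>
  The divergence of the skew matrix field \<open>g (e\<^sub>p \<otimes> e\<^sub>q - e\<^sub>q \<otimes> e\<^sub>p)\<close>. In three dimensions and for
  \<open>p \<noteq> q\<close> it is, up to sign, the curl of \<open>g e\<^sub>k\<close> for the third index \<open>k\<close>.
\<close>

definition skew_gradient :: "'n \<Rightarrow> 'n \<Rightarrow> (real^'n \<Rightarrow> real) \<Rightarrow> real^'n \<Rightarrow> real^'n" where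
  "skew_gradient p q g x = (\<chi> i. (if i = p then partial q g x else 0) - (if i = q then partial p g x else 0))"

lemma skew_gradient_component:
  "(\<lambda>x. skew_gradient p q g x $ i) = (\<lambda>x. (if i = p then partial q g x else 0) - (if i = q then partial p g x else 0))"
  by (simp add: skew_gradient_def)

lemma skew_gradient_test:
  assumes "g \<in> test_functions \<Omega>"
  shows "(\<lambda>x. skew_gradient p q g x $ i) \<in> test_functions \<Omega>"
proof -
  have "(\<lambda>x. if P then partial k g x else 0) \<in> test_functions \<Omega>" for k P
    using test_functions_partial[OF assms] test_functions_0 by (cases P) auto
  thus ?thesis unfolding skew_gradient_component by (intro test_functions_diff)
qed

lemma skew_gradient_W12_0_field:
  assumes "g \<in> test_functions \<Omega>" "open \<Omega>" "\<Omega> \<in> lmeasurable"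
  shows "skew_gradient p q g \<in> W12_0_field \<Omega>"
  using test_functions_W12_0[OF skew_gradient_test[OF assms(1)] assms(2,3)]
  by (simp add: W12_0_field_def)

text \<open>
  The divergence is \<open>\<partial>\<^sub>p\<partial>\<^sub>q g - \<partial>\<^sub>q\<partial>\<^sub>p g\<close>; the chosen weak derivatives agree with the classical ones
  almost everywhere.
\<close>

lemma skew_gradient_solenoidal:
  assumes g: "g \<in> test_functions \<Omega>" and \<Omega>: "open \<Omega>" "\<Omega> \<in> lmeasurable" and sym: "symmetric_hessian g"
  shows "solenoidal \<Omega> (skew_gradient p q g)"
proof -
  have d: "(\<lambda>x. if P then partial k g x else 0) differentiable (at x)" for k x P
    using smooth_differentiable[OF smooth_partial[OF test_functions_smooth[OF g]]] by (cases P) auto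
  have pif: "partial i (\<lambda>x. if P then partial k g x else 0) x = (if P then partial i (partial k g) x else 0)" for i k x P
    by (cases P) auto
  have "(\<Sum>i\<in>UNIV. partial i (\<lambda>x. skew_gradient p q g x $ i) x) = 0" for x
    using sym unfolding skew_gradient_component
    by (simp add: partial_diff d pif sum_subtractf symmetric_hessian_def)
  moreover have "AE x in lebesgue_on \<Omega>. \<forall>i\<in>UNIV. weak_partial \<Omega> i (\<lambda>x. skew_gradient p q g x $ i) x
      = partial i (\<lambda>x. skew_gradient p q g x $ i) x"
    by (intro AE_finite_allI weak_partial_test_function skew_gradient_test g \<Omega>) auto
  ultimately show ?thesis
    unfolding solenoidal_def by (auto elim!: eventually_mono)
qed

lemma sum_skew_mult:
  fixes G :: "'n::finite \<Rightarrow> real"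
  shows "(\<Sum>p\<in>UNIV. \<Sum>q\<in>UNIV. ((if i = p then G q else 0) - (if i = q then G p else 0))
            * ((if j = p then G q else 0) - (if j = q then G p else 0)))
       = 2 * ((if i = j then \<Sum>q\<in>UNIV. (G q)\<^sup>2 else 0) - G i * G j)"
proof -
  have "((if i = p then G q else 0) - (if i = q then G p else 0)) * ((if j = p then G q else 0) - (if j = q then G p else 0))
     = (if p = i then (if i = j then (G q)\<^sup>2 else 0) else 0) - (if p = i then (if q = j then G i * G j else 0) else 0)
     - (if p = j then (if q = i then G i * G j else 0) else 0) + (if q = i then (if i = j then (G p)\<^sup>2 else 0) else 0)" for p q
    by (auto simp: power2_eq_square)
  note expand = this
  have s1: "(\<Sum>q\<in>UNIV. if p = i then f q else 0) = (if p = i then \<Sum>q\<in>UNIV. f q else 0)" for p and f :: "'n \<Rightarrow> real"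
    by simp
  have s2: "(\<Sum>q\<in>UNIV. if p = j then f q else 0) = (if p = j then \<Sum>q\<in>UNIV. f q else 0)" for p and f :: "'n \<Rightarrow> real"
    by simp
  show ?thesis
    unfolding expand sum.distrib sum_subtractf s1 s2 by (auto simp: sum_distrib_left)
qed

lemma skew_gradient_mult_sum:
  "(\<Sum>p\<in>UNIV. \<Sum>q\<in>UNIV. skew_gradient p q g x $ j * skew_gradient p q g x $ i)
     = 2 * ((if i = j then \<Sum>q\<in>UNIV. (partial q g x)\<^sup>2 else 0) - partial i g x * partial j g x)"
  using sum_skew_mult[of i "\<lambda>k. partial k g x" j] by (simp add: skew_gradient_def mult.commute)

text \<open>
  The part of \<open>\<Sum> u \<otimes> u\<close> that is a multiple of the identity pairs with \<open>\<nabla>V\<close> to a multiple of \<open>div V = 0\<close>; the rest is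
  \<open>- 2 T\<close>, and the derivatives of \<open>V\<close> are moved to \<open>T\<close>.
\<close>

lemma sum_convective_form_skew_gradient:
  fixes V :: "real^3 \<Rightarrow> real^3"
  assumes \<Omega>: "open \<Omega>" "\<Omega> \<in> lmeasurable"
    and V: "V \<in> W12_field \<Omega>" "solenoidal \<Omega> V"
    and W: "finite W" and g: "\<And>I. I \<in> W \<Longrightarrow> g I \<in> test_functions \<Omega>"
    and T: "\<And>i j. T i j \<in> test_functions \<Omega>"
    and iso: "\<And>x i j. x \<in> \<Omega> \<Longrightarrow> (\<Sum>I\<in>W. partial i (g I) x * partial j (g I) x) = T i j x + (if i = j then B x else 0)"
  shows "(\<Sum>I\<in>W. \<Sum>p\<in>UNIV. \<Sum>q\<in>UNIV. convective_form \<Omega> (skew_gradient p q (g I)) V)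
       = 2 * (\<Sum>i\<in>UNIV. \<integral>x. V x $ i * (\<Sum>j\<in>UNIV. partial j (T i j) x) \<partial>lebesgue_on \<Omega>)"
proof -
  define M where "M = lebesgue_on \<Omega>"
  define w where "w i j = weak_partial \<Omega> j (\<lambda>y. V y $ i)" for i j
  have VW: "(\<lambda>y. V y $ i) \<in> W12 \<Omega>" for i using V(1) by (simp add: W12_field_def)
  have w: "w i j \<in> L2 M" "has_weak_partial \<Omega> j (\<lambda>y. V y $ i) (w i j)" for i j
    unfolding w_def M_def by (rule weak_partial_spec[OF VW])+
  have VL2: "(\<lambda>y. V y $ i) \<in> L2 M" for i unfolding M_def by (rule W12_L2[OF VW])
  have TL2: "\<phi> \<in> L2 M" if "\<phi> \<in> test_functions \<Omega>" for \<phi>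
    unfolding M_def by (rule test_functions_L2[OF that \<Omega>(2)])
  let ?u = "\<lambda>I p q. skew_gradient p q (g I)"
  have int1: "integrable M (\<lambda>x. ?u I p q x $ j * w i j x * ?u I p q x $ i)" if I: "I \<in> W" for I p q i j
  proof -
    have "(\<lambda>x. ?u I p q x $ j * ?u I p q x $ i) \<in> test_functions \<Omega>"
      by (intro test_functions_mult skew_gradient_test test_functions_smooth[OF skew_gradient_test[OF g[OF I]]] g I)
    from L2_mult_integrable[OF TL2[OF this] w(1)[of i j]] show ?thesis by (simp add: mult_ac)
  qed
  have wT: "integrable M (\<lambda>x. w i j x * T i j x)" for i j
    by (rule L2_mult_integrable[OF w(1) TL2[OF T]])
  have "(\<Sum>I\<in>W. \<Sum>p\<in>UNIV. \<Sum>q\<in>UNIV. convective_form \<Omega> (?u I p q) V)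
      = (\<integral>x. (\<Sum>I\<in>W. \<Sum>p\<in>UNIV. \<Sum>q\<in>UNIV. \<Sum>i\<in>UNIV. \<Sum>j\<in>UNIV. ?u I p q x $ j * w i j x * ?u I p q x $ i) \<partial>M)"
  proof -
    have "(\<Sum>p\<in>UNIV. \<Sum>q\<in>UNIV. convective_form \<Omega> (?u I p q) V)
        = (\<integral>x. (\<Sum>p\<in>UNIV. \<Sum>q\<in>UNIV. \<Sum>i\<in>UNIV. \<Sum>j\<in>UNIV. ?u I p q x $ j * w i j x * ?u I p q x $ i) \<partial>M)"
      if "I \<in> W" for I
      unfolding convective_form_def M_def[symmetric] w_def[symmetric]
      by (simp only: Bochner_Integration.integral_sum Bochner_Integration.integrable_sum int1[OF that])
    thus ?thesis
      by (subst Bochner_Integration.integral_sum) (auto intro!: Bochner_Integration.integrable_sum int1)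
  qed
  also have "\<dots> = (\<integral>x. - 2 * (\<Sum>i\<in>UNIV. \<Sum>j\<in>UNIV. w i j x * T i j x) \<partial>M)"
  proof (rule integral_cong_AE)
    show "(\<lambda>x. \<Sum>I\<in>W. \<Sum>p\<in>UNIV. \<Sum>q\<in>UNIV. \<Sum>i\<in>UNIV. \<Sum>j\<in>UNIV. ?u I p q x $ j * w i j x * ?u I p q x $ i) \<in> borel_measurable M"
      by (intro borel_measurable_sum borel_measurable_integrable[OF int1]) auto
    show "(\<lambda>x. - 2 * (\<Sum>i\<in>UNIV. \<Sum>j\<in>UNIV. w i j x * T i j x)) \<in> borel_measurable M"
      by (intro borel_measurable_times borel_measurable_const borel_measurable_sum borel_measurable_integrable[OF wT])
    have div: "AE x in M. (\<Sum>i\<in>UNIV. w i i x) = 0"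
      using V(2) unfolding solenoidal_def w_def M_def .
    have inM: "AE x in M. x \<in> \<Omega>" by (intro AE_I2) (simp add: M_def)
    show "AE x in M. (\<Sum>I\<in>W. \<Sum>p\<in>UNIV. \<Sum>q\<in>UNIV. \<Sum>i\<in>UNIV. \<Sum>j\<in>UNIV. ?u I p q x $ j * w i j x * ?u I p q x $ i)
        = - 2 * (\<Sum>i\<in>UNIV. \<Sum>j\<in>UNIV. w i j x * T i j x)"
      using div inM
    proof eventually_elim
      case (elim x)
      define N where "N I = (\<Sum>q\<in>UNIV. (partial q (g I) x)\<^sup>2)" for I
      \<comment> \<open>the coefficient of \<open>div V\<close>\<close>
      define N' where "N' = 2 * ((\<Sum>I\<in>W. N I) - B x)"
      have "(\<Sum>p\<in>UNIV. \<Sum>q\<in>UNIV. \<Sum>i\<in>UNIV. \<Sum>j\<in>UNIV. ?u I p q x $ j * w i j x * ?u I p q x $ i)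
          = (\<Sum>i\<in>UNIV. \<Sum>j\<in>UNIV. w i j x * (\<Sum>p\<in>UNIV. \<Sum>q\<in>UNIV. ?u I p q x $ j * ?u I p q x $ i))" for I
      proof -
        have "(\<Sum>p\<in>UNIV. \<Sum>q\<in>UNIV. \<Sum>i\<in>UNIV. \<Sum>j\<in>UNIV. ?u I p q x $ j * w i j x * ?u I p q x $ i)
          = (\<Sum>i\<in>UNIV. \<Sum>j\<in>UNIV. \<Sum>p\<in>UNIV. \<Sum>q\<in>UNIV. ?u I p q x $ j * w i j x * ?u I p q x $ i)"
        proof -
          have "(\<Sum>p\<in>UNIV. \<Sum>q\<in>UNIV. \<Sum>i\<in>UNIV. \<Sum>j\<in>UNIV. f p q i j)
              = (\<Sum>i\<in>UNIV. \<Sum>j\<in>UNIV. \<Sum>p\<in>UNIV. \<Sum>q\<in>UNIV. f p q i j)" for f :: "3 \<Rightarrow> 3 \<Rightarrow> 3 \<Rightarrow> 3 \<Rightarrow> real"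
            by (simp add: sum_3)
          thus ?thesis .
        qed
        thus ?thesis by (simp add: sum_distrib_left mult_ac)
      qed
      hence "(\<Sum>I\<in>W. \<Sum>p\<in>UNIV. \<Sum>q\<in>UNIV. \<Sum>i\<in>UNIV. \<Sum>j\<in>UNIV. ?u I p q x $ j * w i j x * ?u I p q x $ i)
          = (\<Sum>I\<in>W. \<Sum>i\<in>UNIV. \<Sum>j\<in>UNIV. w i j x * (2 * ((if i = j then N I else 0) - partial i (g I) x * partial j (g I) x)))"
        unfolding skew_gradient_mult_sum N_def by simp
      also have "\<dots> = (\<Sum>i\<in>UNIV. \<Sum>j\<in>UNIV. \<Sum>I\<in>W. w i j x * (2 * ((if i = j then N I else 0) - partial i (g I) x * partial j (g I) x)))"
        by (subst sum.swap, intro sum.cong refl, subst sum.swap, intro sum.cong refl)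
      also have "\<dots> = (\<Sum>i\<in>UNIV. \<Sum>j\<in>UNIV. (if i = j then N' * w i i x else 0) - 2 * (w i j x * T i j x))"
      proof (intro sum.cong refl)
        fix i j
        have "(\<Sum>I\<in>W. w i j x * (2 * ((if i = j then N I else 0) - partial i (g I) x * partial j (g I) x)))
            = w i j x * (2 * ((if i = j then \<Sum>I\<in>W. N I else 0) - (\<Sum>I\<in>W. partial i (g I) x * partial j (g I) x)))"
          by (simp add: sum_distrib_left[symmetric] sum_subtractf)
        also have "\<dots> = (if i = j then N' * w i i x else 0) - 2 * (w i j x * T i j x)"
          unfolding iso[OF elim(2)] N'_def by (simp add: algebra_simps)
        finally show "(\<Sum>I\<in>W. w i j x * (2 * ((if i = j then N I else 0) - partial i (g I) x * partial j (g I) x)))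
            = (if i = j then N' * w i i x else 0) - 2 * (w i j x * T i j x)" .
      qed
      also have "\<dots> = N' * (\<Sum>i\<in>UNIV. w i i x) - 2 * (\<Sum>i\<in>UNIV. \<Sum>j\<in>UNIV. w i j x * T i j x)"
        by (simp add: sum_subtractf sum_distrib_left)
      finally show ?case using elim(1) by simp
    qed
  qed
  also have "\<dots> = - 2 * (\<Sum>i\<in>UNIV. \<Sum>j\<in>UNIV. \<integral>x. w i j x * T i j x \<partial>M)"
    by (simp only: Bochner_Integration.integral_sum Bochner_Integration.integrable_sum wT integral_mult_right_zero)
  also have "\<dots> = - 2 * (\<Sum>i\<in>UNIV. \<Sum>j\<in>UNIV. - (\<integral>x. V x $ i * partial j (T i j) x \<partial>M))"
  proof -
    have "(\<integral>x. w i j x * T i j x \<partial>M) = - (\<integral>x. V x $ i * partial j (T i j) x \<partial>M)" for i j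
      using w(2)[of j i] T[of i j] unfolding has_weak_partial_def M_def by simp
    thus ?thesis by simp
  qed
  also have "\<dots> = 2 * (\<Sum>i\<in>UNIV. \<Sum>j\<in>UNIV. \<integral>x. V x $ i * partial j (T i j) x \<partial>M)"
    by (simp add: sum_negf)
  also have "\<dots> = 2 * (\<Sum>i\<in>UNIV. \<integral>x. V x $ i * (\<Sum>j\<in>UNIV. partial j (T i j) x) \<partial>M)"
  proof -
    have "integrable M (\<lambda>x. V x $ i * partial j (T i j) x)" for i j
      by (rule L2_mult_integrable[OF VL2 TL2[OF test_functions_partial[OF T]]])
    thus ?thesis by (simp add: sum_distrib_left Bochner_Integration.integral_sum)
  qed
  finally show ?thesis by (simp only: M_def)
qed

section \<open>Failure of the extension condition\<close>

lemma radial_test_function: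
  assumes "R1\<^sup>2 < a" "b < R2\<^sup>2" "0 < R1" "R1 < R2" "smooth_real f" "smooth \<psi>" "\<And>s. s \<notin> {a..b} \<Longrightarrow> f s = 0"
  shows "(\<lambda>x. f ((norm x)\<^sup>2) * \<psi> x) \<in> test_functions (shell R1 R2)"
proof (rule test_functionsI)
  show "smooth (\<lambda>x. f ((norm x)\<^sup>2) * \<psi> x)" by (intro smooth_mult smooth_radial assms)
  let ?K = "{x::real^3. a \<le> (norm x)\<^sup>2 \<and> (norm x)\<^sup>2 \<le> b}"
  show sub: "?K \<subseteq> shell R1 R2"
  proof
    fix x :: "real^3" assume "x \<in> ?K"
    hence "R1\<^sup>2 < (norm x)\<^sup>2" "(norm x)\<^sup>2 < R2\<^sup>2" using assms(1,2) by auto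
    hence "R1 < norm x" "norm x < R2" using assms(3,4) by (auto intro: power2_less_imp_less)
    thus "x \<in> shell R1 R2" by (simp add: shell_def)
  qed
  have "closed ?K" by (intro closed_Collect_conj closed_Collect_le continuous_intros)
  moreover have "bounded ?K" by (rule bounded_subset[OF bounded_shell sub])
  ultimately show "compact ?K" by (simp add: compact_eq_bounded_closed)
  show "f ((norm x)\<^sup>2) * \<psi> x = 0" if "x \<notin> ?K" for x using that assms(7)[of "(norm x)\<^sup>2"] by auto
qed

text \<open>
  The divergence of \<open>A(s) x \<otimes> x\<close> with \<open>s = |x|\<^sup>2\<close> is \<open>(2 s A' + 4 A) x\<close> in three dimensions, and this is
  the gradient of \<open>H(s)\<close> when \<open>H' = 2 A + s A'\<close>.
\<close>

lemma partial_sum_radial_tensor: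
  fixes x :: "real^3"
  assumes A: "smooth_real A" and H: "smooth_real H" "\<And>s. deriv H s = 2 * A s + s * deriv A s"
  shows "(\<Sum>j\<in>UNIV. partial j (\<lambda>x. A ((norm x)\<^sup>2) * (x $ i * x $ j)) x) = partial i (\<lambda>x. H ((norm x)\<^sup>2)) x"
proof -
  define s where "s = (norm x)\<^sup>2"
  have "partial j (\<lambda>x. A ((norm x)\<^sup>2) * (x $ i * x $ j)) x
      = (2 * deriv A s * x $ i) * (x $ j)\<^sup>2 + (if i = j then A s * x $ i else 0) + A s * x $ i" for j
  proof -
    have "partial j (\<lambda>x. x $ i * x $ j) x = (if i = j then x $ j else 0) + x $ i"
      by (subst partial_mult) (auto simp: partial_component)
    moreover have d: "(\<lambda>x::real^3. A ((norm x)\<^sup>2)) differentiable (at x)"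
      "(\<lambda>x::real^3. x $ i * x $ j) differentiable (at x)"
      by (intro smooth_differentiable smooth_radial A smooth_mult smooth_component)+
    ultimately show ?thesis
      unfolding partial_mult[OF d] partial_radial[OF A] s_def[symmetric]
      by (auto simp: power2_eq_square algebra_simps)
  qed
  hence "(\<Sum>j\<in>UNIV. partial j (\<lambda>x. A ((norm x)\<^sup>2) * (x $ i * x $ j)) x)
      = (2 * deriv A s * x $ i) * (\<Sum>j\<in>UNIV. (x $ j)\<^sup>2) + A s * x $ i + 3 * (A s * x $ i)"
    by (simp add: sum.distrib sum_distrib_left)
  also have "(\<Sum>j\<in>UNIV. (x $ j)\<^sup>2) = s" by (simp add: s_def norm_sq_eq_sum)
  finally show ?thesis
    by (simp add: partial_radial[OF H(1)] H(2) s_def[symmetric] algebra_simps)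
qed

theorem mainTheorem3:
  fixes R1 R2 \<Phi> :: real and v :: "real^3 \<Rightarrow> real^3"
  assumes "0 < R1" and "R1 < R2"
    and "v \<in> W_half2 (shell_boundary_measure R1 R2)"
    and "\<Phi> = (\<integral>x. v x \<bullet> outer_normal R1 R2 x \<partial>sphere_measure R2)"
    and "\<Phi> = - (\<integral>x. v x \<bullet> outer_normal R1 R2 x \<partial>sphere_measure R1)"
    and "\<Phi> > 0"
  shows "\<not> leray_hopf_extension_condition (shell R1 R2) (shell_boundary_measure R1 R2) v"
proof
  assume LH: "leray_hopf_extension_condition (shell R1 R2) (shell_boundary_measure R1 R2) v"
  define \<Omega> where "\<Omega> = shell R1 R2"
  have \<Omega>: "open \<Omega>" "\<Omega> \<in> lmeasurable" by (auto simp: \<Omega>_def open_shell lmeasurable_shell)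
  have "R1\<^sup>2 < R2\<^sup>2" using assms by (intro power_strict_mono) auto
  then obtain a b where ab: "R1\<^sup>2 < a" "a < b" "b < R2\<^sup>2" by (meson dense)
  have a0: "0 < a" using ab(1) zero_le_power2[of R1] by linarith
  obtain m :: nat and h A H where hAH: "smooth_real h" "smooth_real A" "smooth_real H"
    and out: "\<And>s. s \<notin> {a..b} \<Longrightarrow> h s = 0" "\<And>s. s \<notin> {a..b} \<Longrightarrow> A s = 0" "\<And>s. s < a \<Longrightarrow> H s = 0"
    and A: "\<And>s. 0 < s \<Longrightarrow> A s = s ^ m * (4 * (deriv h s)\<^sup>2 + 4 * real m * h s * deriv h s / s
                              + real m * (real m - 1) * (h s)\<^sup>2 / s\<^sup>2)"
    and H: "\<And>s. deriv H s = 2 * A s + s * deriv A s" and neg: "H (R2\<^sup>2) < 0"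
    by (rule ex_radial_profile[OF a0 ab(2,3)]) (rule that)
  define g where "g I x = h ((norm x)\<^sup>2) * monomial I x" for I :: "3 list" and x
  define T where "T i j x = A ((norm x)\<^sup>2) * (x $ i * x $ j)" for i j and x :: "real^3"
  have g: "g I \<in> test_functions \<Omega>" for I
    unfolding g_def \<Omega>_def by (rule radial_test_function[OF ab(1,3) assms(1,2) hAH(1) smooth_monomial out(1)])
  have T: "T i j \<in> test_functions \<Omega>" for i j
    unfolding T_def \<Omega>_def
    by (rule radial_test_function[OF ab(1,3) assms(1,2) hAH(2) smooth_mult[OF smooth_component smooth_component] out(2)])
  have sym: "symmetric_hessian (g I)" for I
    unfolding g_def
    by (intro symmetric_hessian_mult smooth_radial smooth_monomial symmetric_hessian_radial symmetric_hessian_monomial hAH)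
  have iso: "(\<Sum>I\<in>words m. partial i (g I) x * partial j (g I) x)
      = T i j x + (if i = j then real m * (h ((norm x)\<^sup>2))\<^sup>2 * ((norm x)\<^sup>2) ^ m / (norm x)\<^sup>2 else 0)"
    if "x \<in> \<Omega>" for i j x
  proof -
    have "x \<noteq> 0" using that assms(1) by (auto simp: \<Omega>_def shell_def)
    thus ?thesis
      using sum_partial_radial_monomial[OF _ hAH(1), of x i j m] A[of "(norm x)\<^sup>2"]
      by (simp add: g_def[abs_def] T_def Let_def)
  qed
  define C where "C = (\<Sum>I\<in>words m. \<Sum>p\<in>UNIV. \<Sum>q\<in>UNIV. (grad_norm2 \<Omega> (skew_gradient p q (g I)))\<^sup>2)"
  have C0: "0 \<le> C" unfolding C_def by (intro sum_nonneg) auto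
  have key: "- 2 * H (R2\<^sup>2) * \<Phi> \<le> \<epsilon> * C" if "0 < \<epsilon>" for \<epsilon>
  proof -
    from LH that obtain V where V: "V \<in> W12_field \<Omega>" "solenoidal \<Omega> V"
      and tr: "\<And>i. has_trace \<Omega> (shell_boundary_measure R1 R2) (\<lambda>x. V x $ i) (\<lambda>x. v x $ i)"
      and ineq: "\<And>u. u \<in> W12_0_field \<Omega> \<Longrightarrow> solenoidal \<Omega> u \<Longrightarrow> - convective_form \<Omega> u V \<le> \<epsilon> * (grad_norm2 \<Omega> u)\<^sup>2"
      unfolding leray_hopf_extension_condition_def \<Omega>_def by blast
    have "(\<Sum>I\<in>words m. \<Sum>p\<in>UNIV. \<Sum>q\<in>UNIV. convective_form \<Omega> (skew_gradient p q (g I)) V)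
        = 2 * (\<Sum>i\<in>UNIV. \<integral>x. V x $ i * (\<Sum>j\<in>UNIV. partial j (T i j) x) \<partial>lebesgue_on \<Omega>)"
      by (rule sum_convective_form_skew_gradient[OF \<Omega> V finite_words g T iso])
    also have "\<dots> = 2 * (\<Sum>i\<in>UNIV. \<integral>x. V x $ i * partial i (\<lambda>x. H ((norm x)\<^sup>2)) x \<partial>lebesgue_on \<Omega>)"
      unfolding T_def partial_sum_radial_tensor[OF hAH(2,3) H] ..
    also have "\<dots> = 2 * (H (R2\<^sup>2) * \<Phi>)"
      unfolding assms(4) using flux_radial[OF assms(1,2) V[unfolded \<Omega>_def] tr[unfolded \<Omega>_def] hAH(3) ab(1) out(3)]
      by (simp add: \<Omega>_def)
    finally have "- 2 * H (R2\<^sup>2) * \<Phi>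
        = (\<Sum>I\<in>words m. \<Sum>p\<in>UNIV. \<Sum>q\<in>UNIV. - convective_form \<Omega> (skew_gradient p q (g I)) V)"
      by (simp add: sum_negf)
    also have "\<dots> \<le> (\<Sum>I\<in>words m. \<Sum>p\<in>UNIV. \<Sum>q\<in>UNIV. \<epsilon> * (grad_norm2 \<Omega> (skew_gradient p q (g I)))\<^sup>2)"
      by (intro sum_mono ineq skew_gradient_W12_0_field skew_gradient_solenoidal g \<Omega> sym)
    also have "\<dots> = \<epsilon> * C" by (simp add: C_def sum_distrib_left)
    finally show ?thesis .
  qed
  define \<kappa> where "\<kappa> = - 2 * H (R2\<^sup>2) * \<Phi>"
  have \<kappa>: "0 < \<kappa>" using neg \<open>\<Phi> > 0\<close> by (simp add: \<kappa>_def mult_neg_pos)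
  have "0 < \<kappa> / (C + 1)" using \<kappa> C0 by simp
  from key[OF this] have "\<kappa> \<le> (\<kappa> / (C + 1)) * C" unfolding \<kappa>_def[symmetric] .
  also have "\<dots> < \<kappa>" using \<kappa> C0 by (simp add: pos_divide_less_eq)
  finally show False by simp
qed

end
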